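(* We have $\omega\mathbf{BC}\subsetneq\omega\mathbf{FVA}\subsetneq\omega\mathbf{FS}_{\bot}$. Moreover, $\omega\mathbf{FVA}$ and $\omega\mathbf{RB}_{\bot}$ are incomparable: $\omega\mathbf{FVA}\nsubseteq\omega\mathbf{RB}_{\bot}$ and $\omega\mathbf{RB}_{\bot}\nsubseteq\omega\mathbf{FVA}$.
   Context: All categories are full subcategories of the category $\mathbf{DCPO}$ of dcpos (posets in which every nonempty directed subset has a supremum) and Scott-continuous maps (monotone maps preserving directed suprema); inclusions mean inclusions of object classes. A dcpo is pointed if it has a least element. $a\ll b$ means: whenever $b\leq\sup E$ with $E$ directed, some $e\in E$ has $a\leq e$. A basis of $D$ is a subset $B$ such that for each $x$ the set $\{b\in B:b\ll x\}$ is directed with supremum $x$; a domain (= continuous dcpo) is a dcpo with a basis; it is countably based if it has a countable basis. $\omega\mathbf{BC}$: countably based bc-domains, where a bc-domain is a pointed domain in which every subset having an upper bound has a supremum. $\omega\mathbf{RB}_\bot$: pointed countably based RB-domains, where an RB-domain is a dcpo $D$ whose identity is the pointwise supremum of a directed family of Scott-continuous self-maps $f\leq\mathrm{id}_D$ with finite image (equivalently, a Scott-continuous retract of a bifinite domain). $\omega\mathbf{FS}_\bot$: pointed countably based FS-domains. A Scott-continuous $f:D\to D$ is finitely separated from the identity if there is a finite $M\subseteq D$ such that for every $x\in D$ some $m\in M$ satisfies $f(x)\leq m\leq x$; $D$ is an FS-domain if there is a directed family of such maps with pointwise supremum $\mathrm{id}_D$. $\omega\mathbf{FVA}$: finite-valuation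 approximable dcpos, i.e. dcpos $D$ for which there are finite posets $P_n$ and Scott-continuous maps $p_n:D\to\mathcal V_{\leq 1}(P_n)$, $e_n:\mathcal V_{\leq 1}(P_n)\to D$ ($n\in\mathbb N$) such that $a_n=e_n\circ p_n$ satisfies $a_n\leq a_{n+1}\leq\mathrm{id}_D$ and $\sup_n a_n=\mathrm{id}_D$ pointwise. Here, for a finite poset $P$, $\mathcal V_{\leq 1}(P)=\{p\in\mathbb R_{\geq 0}^P:\sum_x p_x\leq 1\}$ with the stochastic order $p\leq q$ iff $\sum_{x\in U}p_x\leq\sum_{x\in U}q_x$ for every upper set $U\subseteq P$ (this is the dcpo of subprobabilistic continuous valuations on $P$). *)

theory Defs
  imports Complex_Main "HOL-Library.Countable_Set" "HOL-Library.FuncSet" "HOL-Algebra.Order"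
begin

section \<open>Dcpos and Scott-continuous maps\<close>

text \<open>Directed sets are nonempty throughout. The order is passed as a relation, so that the same
  notion serves for subsets of a poset and for families of self-maps.\<close>

definition directed :: "('a \<Rightarrow> 'a \<Rightarrow> bool) \<Rightarrow> 'a set \<Rightarrow> bool" where
  "directed r X \<longleftrightarrow> X \<noteq> {} \<and> (\<forall>x\<in>X. \<forall>y\<in>X. \<exists>z\<in>X. r x z \<and> r y z)"

definition dcpo :: "'a gorder \<Rightarrow> bool" where
  "dcpo D \<longleftrightarrow> partial_order D \<and>
     (\<forall>X. X \<subseteq> carrier D \<longrightarrow> directed (le D) X \<longrightarrow> (\<exists>s. is_lub D s X))"

definition pointed :: "'a gorder \<Rightarrow> bool" where
  "pointed D \<longleftrightarrow> (\<exists>x. least D x (carrier D))"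

text \<open>Maps are total functions on the underlying types; only their values on the carrier of the
  source matter.\<close>

definition scott_continuous :: "'a gorder \<Rightarrow> 'b gorder \<Rightarrow> ('a \<Rightarrow> 'b) \<Rightarrow> bool" where
  "scott_continuous D E f \<longleftrightarrow> f \<in> carrier D \<rightarrow> carrier E \<and> isotone D E f \<and>
     (\<forall>X s. X \<subseteq> carrier D \<longrightarrow> directed (le D) X \<longrightarrow> is_lub D s X \<longrightarrow> is_lub E (f s) (f ` X))"

definition pointwise_le :: "'a gorder \<Rightarrow> ('a \<Rightarrow> 'a) \<Rightarrow> ('a \<Rightarrow> 'a) \<Rightarrow> bool" where
  "pointwise_le D f g \<longleftrightarrow> (\<forall>x\<in>carrier D. f x \<sqsubseteq>\<^bsub>D\<^esub> g x)"

definition pointwise_sup_id :: "'a gorder \<Rightarrow> ('a \<Rightarrow> 'a) set \<Rightarrow> bool" where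
  "pointwise_sup_id D F \<longleftrightarrow> (\<forall>x\<in>carrier D. is_lub D x ((\<lambda>f. f x) ` F))"


section \<open>Domains\<close>

definition way_below :: "'a gorder \<Rightarrow> 'a \<Rightarrow> 'a \<Rightarrow> bool" where
  "way_below D a b \<longleftrightarrow>
     (\<forall>E s. E \<subseteq> carrier D \<longrightarrow> directed (le D) E \<longrightarrow> is_lub D s E \<longrightarrow> b \<sqsubseteq>\<^bsub>D\<^esub> s \<longrightarrow>
        (\<exists>e\<in>E. a \<sqsubseteq>\<^bsub>D\<^esub> e))"

definition is_basis :: "'a gorder \<Rightarrow> 'a set \<Rightarrow> bool" where
  "is_basis D B \<longleftrightarrow> B \<subseteq> carrier D \<and>
     (\<forall>x\<in>carrier D. directed (le D) {b \<in> B. way_below D b x} \<and>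
        is_lub D x {b \<in> B. way_below D b x})"

definition continuous_dcpo :: "'a gorder \<Rightarrow> bool" where
  "continuous_dcpo D \<longleftrightarrow> dcpo D \<and> (\<exists>B. is_basis D B)"

definition countably_based :: "'a gorder \<Rightarrow> bool" where
  "countably_based D \<longleftrightarrow> (\<exists>B. countable B \<and> is_basis D B)"

definition bc_domain :: "'a gorder \<Rightarrow> bool" where
  "bc_domain D \<longleftrightarrow> continuous_dcpo D \<and> pointed D \<and>
     (\<forall>X. X \<subseteq> carrier D \<longrightarrow> Upper D X \<noteq> {} \<longrightarrow> (\<exists>s. is_lub D s X))"

definition rb_domain :: "'a gorder \<Rightarrow> bool" where
  "rb_domain D \<longleftrightarrow> dcpo D \<and>
     (\<exists>F. directed (pointwise_le D) F \<and>
        (\<forall>f\<in>F. scott_continuous D D f \<and> pointwise_le D f id \<and> finite (f ` carrier D)) \<and>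
        pointwise_sup_id D F)"

definition finitely_separated :: "'a gorder \<Rightarrow> ('a \<Rightarrow> 'a) \<Rightarrow> bool" where
  "finitely_separated D f \<longleftrightarrow>
     (\<exists>M. finite M \<and> M \<subseteq> carrier D \<and>
        (\<forall>x\<in>carrier D. \<exists>m\<in>M. f x \<sqsubseteq>\<^bsub>D\<^esub> m \<and> m \<sqsubseteq>\<^bsub>D\<^esub> x))"

definition fs_domain :: "'a gorder \<Rightarrow> bool" where
  "fs_domain D \<longleftrightarrow> dcpo D \<and>
     (\<exists>F. directed (pointwise_le D) F \<and>
        (\<forall>f\<in>F. scott_continuous D D f \<and> finitely_separated D f) \<and>
        pointwise_sup_id D F)"


section \<open>Finite valuations\<close>

definition upper_set :: "'p gorder \<Rightarrow> 'p set \<Rightarrow> bool" where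
  "upper_set P U \<longleftrightarrow> U \<subseteq> carrier P \<and>
     (\<forall>x\<in>U. \<forall>y\<in>carrier P. x \<sqsubseteq>\<^bsub>P\<^esub> y \<longrightarrow> y \<in> U)"

definition finite_poset :: "'p gorder \<Rightarrow> bool" where
  "finite_poset P \<longleftrightarrow> partial_order P \<and> finite (carrier P)"

text \<open>The subprobability valuations on a finite poset with the stochastic order.\<close>

definition valuations :: "'p gorder \<Rightarrow> ('p \<Rightarrow> real) gorder" where
  "valuations P =
     \<lparr> carrier = {p \<in> carrier P \<rightarrow>\<^sub>E {0..}. (\<Sum>x\<in>carrier P. p x) \<le> 1},
       eq = (=),
       le = (\<lambda>p q. \<forall>U. upper_set P U \<longrightarrow> (\<Sum>x\<in>U. p x) \<le> (\<Sum>x\<in>U. q x)) \<rparr>"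

text \<open>Every finite poset is isomorphic to one whose carrier consists of natural numbers, so it is
  no restriction to take the posets on that type.\<close>

definition fva :: "'a gorder \<Rightarrow> bool" where
  "fva D \<longleftrightarrow> dcpo D \<and>
     (\<exists>(P :: nat \<Rightarrow> nat gorder) p e.
        (\<forall>n. finite_poset (P n) \<and>
             scott_continuous D (valuations (P n)) (p n) \<and>
             scott_continuous (valuations (P n)) D (e n)) \<and>
        (\<forall>n. pointwise_le D (e n \<circ> p n) (e (Suc n) \<circ> p (Suc n)) \<and>
             pointwise_le D (e n \<circ> p n) id) \<and>
        pointwise_sup_id D (range (\<lambda>n. e n \<circ> p n)))"


section \<open>The classes of dcpos\<close>

text \<open>Each class is the set of its members carried by subsets of a given type. Inclusions are
  therefore statements for every type, while a non-inclusion needs a type with enough elements.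
  The members of all four classes are countably based, hence have at most continuum many elements,
  so every one of them is isomorphic to a member carried by a subset of \<^typ>\<open>nat \<Rightarrow> real\<close>.\<close>

definition omega_BC :: "'a gorder set" where
  "omega_BC = {D. bc_domain D \<and> countably_based D}"

definition omega_RB_bot :: "'a gorder set" where
  "omega_RB_bot = {D. rb_domain D \<and> pointed D \<and> countably_based D}"

definition omega_FS_bot :: "'a gorder set" where
  "omega_FS_bot = {D. fs_domain D \<and> pointed D \<and> countably_based D}"

definition omega_FVA :: "'a gorder set" where
  "omega_FVA = {D. fva D}"

end

theory Submission
  imports Defs
begin

text \<open>
  \<^emph>\<open>FVA-domains are FS.\<close> It suffices that the valuations on a finite poset form an FS-domain. A map
  that lowers the mass of every upper set by a fixed positive amount (down to \<open>0\<close>) is finitely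
  separated from the identity by a grid. Such maps are built by induction on lower sets: mass in
  \<open>\<up>x\<close> that is too small to keep is spread over everything below it, and the excess so created
  is absorbed by the map already constructed for the complement of \<open>\<up>x\<close>.

  \<^emph>\<open>BC-domains are FVA.\<close> The maps \<open>x \<mapsto> \<Squnion>{b\<^sub>i \<ll> x. i < n}\<close> factor through the valuations on the poset of
  bounded subsets of \<open>{b\<^sub>i. i < n}\<close>: a valuation is sent to the join of those \<open>b\<^sub>i\<close> whose up-set
  has mass close to \<open>1\<close>.

  \<^emph>\<open>RB does not imply FVA.\<close> In the poset \<open>\<bottom> < a, b < c, d\<close> the set of common upper bounds of \<open>a\<close> and
  \<open>b\<close> is disconnected, whereas such sets of valuations are convex.

  \<^emph>\<open>FVA does not imply RB.\<close> For the poset \<open>0, 1 < 2\<close> the stochastic order is locally the order of a cone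
  over a square. A monotone step function is, infinitesimally, a sum of jumps \<open>c \<otimes> n\<close> with \<open>c\<close> in the
  cone and \<open>n\<close> in its dual, and as the cone is not simplicial, a linear functional that is positive
  on such jumps vanishes at the identity. So no monotone map with finite image is close to the
  identity. Differentiation is replaced by increments over \<open>h = 2\<^sup>k\<close> on a fine lattice: for some \<open>k\<close>, few
  lattice cells of size \<open>h\<close> see more than one jump.
\<close>

section \<open>Orders, suprema and Scott continuity\<close>

text \<open>Two witnesses serve four non-inclusions. \<open>valuations wedge\<close> is outside
  \<open>omega_RB_bot\<close>, hence outside \<open>omega_BC\<close>, because the maps that
  approximate a bc-domain also have finite image. \<open>five\<close> is finite, hence in both
  \<open>omega_RB_bot\<close> and \<open>omega_FS_bot\<close>, but it is not in
  \<open>omega_FVA\<close>. Passing from finite posets to an arbitrary member of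
  \<open>omega_FVA\<close> is not automatic: a separated map inserted between \<open>p n\<close> and
  \<open>e n\<close> gives a separated self-map, but for different \<open>n\<close> these self-maps
  need not have common upper bounds. A separated map sends each point way below itself, and
  iterating it three times buys enough room for directedness. In the argument against RB the number
  \<open>K\<close> of values of the map is fixed before the lattice is refined. At a single scale
  most cells may see several jumps. Weighted by the inverse of the scale, however, the double jumps
  in one column sum over all scales to at most \<open>K\<close>, whereas the flux forces a
  contribution at every scale that does not depend on the scale. So enough scales give a
  contradiction.\<close>

lemma partial_orderI:
  assumes "eq D = (=)"
    and "\<And>x. x \<in> carrier D \<Longrightarrow> le D x x"
    and "\<And>x y. \<lbrakk>x \<in> carrier D; y \<in> carrier D; le D x y; le D y x\<rbrakk> \<Longrightarrow> x = y"
    and "\<And>x y z. \<lbrakk>x \<in> carrier D; y \<in> carrier D; z \<in> carrier D; le D x y; le D y z\<rbrakk> \<Longrightarrow> le D x z"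
  shows "partial_order D"
  apply unfold_locales
  unfolding assms(1) by (blast intro: assms(2-4))+

lemma po_weak: "partial_order D \<Longrightarrow> weak_partial_order D"
  by (rule partial_order.axioms)

lemma po_refl: "\<lbrakk>partial_order D; x \<in> carrier D\<rbrakk> \<Longrightarrow> le D x x"
  by (meson po_weak weak_partial_order.le_refl)

lemma po_trans:
  "\<lbrakk>partial_order D; le D x y; le D y z; x \<in> carrier D; y \<in> carrier D; z \<in> carrier D\<rbrakk> \<Longrightarrow> le D x z"
  by (meson po_weak weak_partial_order.le_trans)

lemma po_antisym:
  "\<lbrakk>partial_order D; le D x y; le D y x; x \<in> carrier D; y \<in> carrier D\<rbrakk> \<Longrightarrow> x = y"
  by (simp add: partial_order.le_antisym)

lemma is_lub_iff:
  "is_lub D s X \<longleftrightarrow> s \<in> carrier D \<and> (\<forall>x\<in>X \<inter> carrier D. le D x s) \<and>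
     (\<forall>u\<in>carrier D. (\<forall>x\<in>X \<inter> carrier D. le D x u) \<longrightarrow> le D s u)"
  by (auto simp: least_def Upper_def)

lemma is_lubI:
  assumes "s \<in> carrier D" "\<And>x. x \<in> X \<Longrightarrow> le D x s" "X \<subseteq> carrier D"
    and "\<And>u. \<lbrakk>u \<in> carrier D; \<And>x. x \<in> X \<Longrightarrow> le D x u\<rbrakk> \<Longrightarrow> le D s u"
  shows "is_lub D s X"
  unfolding is_lub_iff using assms by blast

lemma is_lub_carrier: "is_lub D s X \<Longrightarrow> s \<in> carrier D"
  by (simp add: is_lub_iff)

lemma is_lub_upper: "\<lbrakk>is_lub D s X; x \<in> X; X \<subseteq> carrier D\<rbrakk> \<Longrightarrow> le D x s"
  by (auto simp: is_lub_iff)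

lemma is_lub_least: "\<lbrakk>is_lub D s X; u \<in> carrier D; \<And>x. x \<in> X \<Longrightarrow> le D x u\<rbrakk> \<Longrightarrow> le D s u"
  by (auto simp: is_lub_iff)

lemma is_lub_unique: "\<lbrakk>partial_order D; is_lub D s X; is_lub D t X\<rbrakk> \<Longrightarrow> s = t"
  by (rule po_antisym) (auto simp: is_lub_iff)

lemma is_lub_greatest:
  "\<lbrakk>s \<in> X; X \<subseteq> carrier D; \<And>x. x \<in> X \<Longrightarrow> le D x s\<rbrakk> \<Longrightarrow> is_lub D s X"
  by (auto simp: is_lub_iff)

lemma dcpo_po: "dcpo D \<Longrightarrow> partial_order D"
  by (simp add: dcpo_def)

lemma directedD: "\<lbrakk>directed r X; x \<in> X; y \<in> X\<rbrakk> \<Longrightarrow> \<exists>z\<in>X. r x z \<and> r y z"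
  by (auto simp: directed_def)

lemma directed_finite_upper:
  assumes "partial_order D" "directed (le D) X" "X \<subseteq> carrier D" "finite A" "A \<subseteq> X"
  shows "\<exists>z\<in>X. \<forall>a\<in>A. le D a z"
  using assms(4,5)
proof (induction A)
  case empty
  then show ?case using assms(2) by (auto simp: directed_def)
next
  case (insert a A)
  then obtain z where z: "z \<in> X" "\<forall>a\<in>A. le D a z" by auto
  obtain w where w: "w \<in> X" "le D a w" "le D z w"
    using directedD[OF assms(2), of a z] insert.prems z by auto
  have "le D b w" if "b \<in> A" for b
    using po_trans[OF assms(1), of b z w] that z w assms(3) insert.prems by blast
  then show ?case using w by auto
qed

lemma directed_finite_has_greatest:
  assumes "partial_order D" "directed (le D) X" "X \<subseteq> carrier D" "finite X"
  shows "\<exists>z\<in>X. \<forall>a\<in>X. le D a z"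
  by (rule directed_finite_upper[OF assms(1-3)]) (use assms in auto)

lemma directed_finite_lub_mem:
  assumes "partial_order D" "directed (le D) X" "X \<subseteq> carrier D" "finite X" "is_lub D s X"
  shows "s \<in> X"
proof -
  obtain z where z: "z \<in> X" "\<forall>a\<in>X. le D a z"
    using directed_finite_has_greatest[OF assms(1-4)] by blast
  then have "is_lub D z X" using assms(3) by (intro is_lub_greatest) auto
  then show ?thesis using is_lub_unique[OF assms(1,5)] z by blast
qed

text \<open>Finitely many requirements, each satisfied by everything above some member, are
  satisfied by a common member. Most finiteness arguments below use directedness in this
  form.\<close>

lemma directed_choose:
  assumes "partial_order D" "directed (le D) X" "X \<subseteq> carrier D" "finite I"
    and "\<And>i. i \<in> I \<Longrightarrow> \<exists>x\<in>X. \<forall>y\<in>X. le D x y \<longrightarrow> Q i y"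
  shows "\<exists>x\<in>X. \<forall>i\<in>I. Q i x"
proof -
  obtain g where g: "\<And>i. i \<in> I \<Longrightarrow> g i \<in> X \<and> (\<forall>y\<in>X. le D (g i) y \<longrightarrow> Q i y)"
    using assms(5) by metis
  have "\<exists>z\<in>X. \<forall>a\<in>g ` I. le D a z"
    by (rule directed_finite_upper[OF assms(1-3)]) (use assms(4) g in auto)
  then show ?thesis using g by fastforce
qed

lemma poset_isotoneI:
  assumes "partial_order D" "partial_order E"
    and "\<And>x y. \<lbrakk>x \<in> carrier D; y \<in> carrier D; le D x y\<rbrakk> \<Longrightarrow> le E (f x) (f y)"
  shows "isotone D E f"
  using assms by (auto simp: isotone_def po_weak)

lemma scott_carrier: "\<lbrakk>scott_continuous D E f; x \<in> carrier D\<rbrakk> \<Longrightarrow> f x \<in> carrier E"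
  by (auto simp: scott_continuous_def)

lemma scott_mono:
  "\<lbrakk>scott_continuous D E f; x \<in> carrier D; y \<in> carrier D; le D x y\<rbrakk> \<Longrightarrow> le E (f x) (f y)"
  by (auto simp: scott_continuous_def isotone_def)

lemma scott_lub:
  "\<lbrakk>scott_continuous D E f; X \<subseteq> carrier D; directed (le D) X; is_lub D s X\<rbrakk> \<Longrightarrow> is_lub E (f s) (f ` X)"
  by (auto simp: scott_continuous_def)

lemma directed_image:
  assumes "directed (le D) X" "X \<subseteq> carrier D"
    and "\<And>x y. \<lbrakk>x \<in> X; y \<in> X; le D x y\<rbrakk> \<Longrightarrow> le E (f x) (f y)"
  shows "directed (le E) (f ` X)"
  using assms unfolding directed_def by (auto simp: subset_iff) metis+

lemma directed_scott_image:
  assumes "scott_continuous D E f" "directed (le D) X" "X \<subseteq> carrier D"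
  shows "directed (le E) (f ` X)"
  by (rule directed_image[OF assms(2,3)]) (use assms in \<open>auto intro!: scott_mono[OF assms(1)]\<close>)

lemma scott_comp:
  assumes f: "scott_continuous D E f" and g: "scott_continuous E F g"
  shows "scott_continuous D F (g \<circ> f)"
  unfolding scott_continuous_def
proof (intro conjI allI impI)
  show "g \<circ> f \<in> carrier D \<rightarrow> carrier F"
    using scott_carrier[OF f] scott_carrier[OF g] by auto
  show "isotone D F (g \<circ> f)"
    using f g scott_carrier[OF f] by (auto simp: scott_continuous_def isotone_def)
  fix X s assume X: "X \<subseteq> carrier D" "directed (le D) X" "is_lub D s X"
  have "is_lub F (g (f s)) (g ` f ` X)"
    using X scott_carrier[OF f]
    by (intro scott_lub[OF g] scott_lub[OF f] directed_scott_image[OF f]) auto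
  then show "is_lub F ((g \<circ> f) s) ((g \<circ> f) ` X)" by (simp add: image_comp)
qed

lemma scott_id: "partial_order D \<Longrightarrow> scott_continuous D D id"
  by (auto simp: scott_continuous_def isotone_def dest: po_weak)

text \<open>If the value at a supremum is already taken inside the directed set, monotonicity alone
  makes it the supremum of the image. This suits maps that are decided by finitely many
  conditions.\<close>

lemma scott_attainedI:
  assumes po: "partial_order D" "partial_order E"
    and car: "\<And>x. x \<in> carrier D \<Longrightarrow> f x \<in> carrier E"
    and mono: "\<And>x y. \<lbrakk>x \<in> carrier D; y \<in> carrier D; le D x y\<rbrakk> \<Longrightarrow> le E (f x) (f y)"
    and att: "\<And>X s. \<lbrakk>X \<subseteq> carrier D; directed (le D) X; is_lub D s X\<rbrakk> \<Longrightarrow> \<exists>x\<in>X. f s = f x"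
  shows "scott_continuous D E f"
  unfolding scott_continuous_def
proof (intro conjI allI impI)
  fix X s assume X: "X \<subseteq> carrier D" "directed (le D) X" "is_lub D s X"
  have "\<And>y. y \<in> f ` X \<Longrightarrow> le E y (f s)"
    using X mono is_lub_upper[OF X(3) _ X(1)] is_lub_carrier[OF X(3)] by auto
  then show "is_lub E (f s) (f ` X)"
    using att[OF X] X car by (intro is_lub_greatest) (auto simp: subset_iff)
qed (use po car in \<open>auto intro!: poset_isotoneI mono\<close>)

lemma finite_dcpo:
  assumes "partial_order D" "finite (carrier D)"
  shows "dcpo D"
  unfolding dcpo_def
proof (intro conjI allI impI assms(1))
  fix X assume X: "X \<subseteq> carrier D" "directed (le D) X"
  obtain z where "z \<in> X" "\<forall>a\<in>X. le D a z"
    using directed_finite_has_greatest[OF assms(1) X(2,1)] finite_subset[OF X(1) assms(2)] by blast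
  then have "is_lub D z X" using X by (intro is_lub_greatest) auto
  then show "\<exists>s. is_lub D s X" ..
qed

lemma way_below_le:
  assumes "partial_order D" "way_below D a b" "b \<in> carrier D"
  shows "le D a b"
proof -
  have "is_lub D b {b}" using assms by (intro is_lub_greatest) (auto intro: po_refl)
  then show ?thesis
    using assms(2)[unfolded way_below_def, rule_format, of "{b}" b] assms
    by (auto simp: directed_def intro: po_refl)
qed

lemma way_below_trans_le:
  assumes "partial_order D" "way_below D a b" "le D b c" "b \<in> carrier D" "c \<in> carrier D"
  shows "way_below D a c"
  using assms po_trans[OF assms(1), of b c] is_lub_carrier
  unfolding way_below_def by blast

lemma le_way_below_trans:
  assumes "partial_order D" "le D a b" "way_below D b c" "a \<in> carrier D" "b \<in> carrier D"
  shows "way_below D a c"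
  unfolding way_below_def
proof (intro allI impI)
  fix E s assume E: "E \<subseteq> carrier D" "directed (le D) E" "is_lub D s E" "le D c s"
  then obtain e where "e \<in> E" "le D b e" using assms(3) unfolding way_below_def by blast
  then show "\<exists>e\<in>E. le D a e" using po_trans[OF assms(1,2), of e] assms E(1) by blast
qed


section \<open>Valuations on a finite poset\<close>

text \<open>Detached from the carrier because the maps built below act on functions whose total mass
  may exceed 1 and which are not restricted to the poset.\<close>

definition mass_le :: "'p gorder \<Rightarrow> ('p \<Rightarrow> real) \<Rightarrow> ('p \<Rightarrow> real) \<Rightarrow> bool" where
  "mass_le P v w \<longleftrightarrow> (\<forall>U. upper_set P U \<longrightarrow> sum v U \<le> sum w U)"

lemma valuations_le [simp]: "le (valuations P) = mass_le P"
  by (simp add: valuations_def mass_le_def fun_eq_iff)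

lemma valuations_carrier:
  "v \<in> carrier (valuations P) \<longleftrightarrow>
     v \<in> extensional (carrier P) \<and> (\<forall>x\<in>carrier P. 0 \<le> v x) \<and> sum v (carrier P) \<le> 1"
  by (auto simp: valuations_def PiE_def)

lemma mass_leD: "\<lbrakk>mass_le P v w; upper_set P U\<rbrakk> \<Longrightarrow> sum v U \<le> sum w U"
  by (simp add: mass_le_def)

lemma mass_le_refl [simp]: "mass_le P v v"
  by (simp add: mass_le_def)

lemma mass_le_trans: "\<lbrakk>mass_le P u v; mass_le P v w\<rbrakk> \<Longrightarrow> mass_le P u w"
  by (force simp: mass_le_def)

locale fin_poset =
  fixes P :: "'p gorder"
  assumes finite_poset: "finite_poset P"
begin

abbreviation "C \<equiv> carrier P"

definition up :: "'p \<Rightarrow> 'p set" where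
  "up x = {y \<in> C. le P x y}"

lemma po: "partial_order P" and fin: "finite C"
  using finite_poset by (auto simp: finite_poset_def)

lemma up_self: "x \<in> C \<Longrightarrow> x \<in> up x"
  by (simp add: up_def po_refl[OF po])

lemma up_subset: "up x \<subseteq> C"
  by (auto simp: up_def)

lemma finite_up [simp]: "finite (up x)"
  by (rule finite_subset[OF up_subset fin])

lemma upper_subset: "upper_set P U \<Longrightarrow> U \<subseteq> C"
  by (simp add: upper_set_def)

lemma upper_finite: "upper_set P U \<Longrightarrow> finite U"
  using upper_subset fin finite_subset by blast

lemma upper_up_subset: "\<lbrakk>upper_set P U; x \<in> U\<rbrakk> \<Longrightarrow> up x \<subseteq> U"
  by (auto simp: upper_set_def up_def)

lemma upper_up: "x \<in> C \<Longrightarrow> upper_set P (up x)"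
  using po_trans[OF po] by (auto simp: upper_set_def up_def)

lemma upper_up': "x \<in> C \<Longrightarrow> upper_set P (up x - {x})"
  using po_trans[OF po, of x] po_antisym[OF po, of x] by (auto simp: upper_set_def up_def)

lemma upper_carrier: "upper_set P C"
  by (simp add: upper_set_def)

lemma upper_empty: "upper_set P {}"
  by (simp add: upper_set_def)

lemma upper_Un: "\<lbrakk>upper_set P U; upper_set P V\<rbrakk> \<Longrightarrow> upper_set P (U \<union> V)"
  by (auto simp: upper_set_def)

lemma upper_Int: "\<lbrakk>upper_set P U; upper_set P V\<rbrakk> \<Longrightarrow> upper_set P (U \<inter> V)"
  by (auto simp: upper_set_def)

lemma finite_uppers: "finite {U. upper_set P U}"
  by (rule finite_subset[of _ "Pow C"]) (auto simp: fin upper_set_def)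

text \<open>Both sets on the right are upper sets, so a function is determined by its masses on
  upper sets. This gives antisymmetry, and it tells how to recover a valuation from its mass
  function.\<close>

lemma point_mass: "x \<in> C \<Longrightarrow> v x = sum v (up x) - sum v (up x - {x})"
  for v :: "'p \<Rightarrow> real"
  by (simp add: sum_diff1 up_self)

lemma mass_le_antisym:
  assumes "mass_le P v w" "mass_le P w v" "x \<in> C"
  shows "v x = w x"
proof -
  have "sum v U = sum w U" if "upper_set P U" for U
    using assms that by (force simp: mass_le_def)
  then show ?thesis using assms(3) point_mass[of x v] point_mass[of x w] upper_up upper_up' by simp
qed

lemma exists_minimal:
  assumes "U \<subseteq> C" "U \<noteq> {}"
  shows "\<exists>x\<in>U. \<forall>y\<in>U. le P y x \<longrightarrow> y = x"
proof -
  have fU: "finite U" using assms fin finite_subset by blast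
  \<comment> \<open>A point of \<open>U\<close> whose up-set has the largest size is minimal in
    \<open>U\<close>.\<close>
  have "Max ((\<lambda>y. card (up y)) ` U) \<in> (\<lambda>y. card (up y)) ` U"
    using assms fU by (intro Max_in) auto
  then obtain x where x: "x \<in> U" "Max ((\<lambda>y. card (up y)) ` U) = card (up x)" by blast
  then have x: "x \<in> U" "\<And>y. y \<in> U \<Longrightarrow> card (up y) \<le> card (up x)"
    using Max_ge[of "(\<lambda>y. card (up y)) ` U"] fU by auto
  have "y = x" if y: "y \<in> U" "le P y x" for y
  proof (rule ccontr)
    assume "y \<noteq> x"
    then have "y \<notin> up x" using y x(1) assms(1) po_antisym[OF po, of y x] by (auto simp: up_def)
    moreover have "up x \<subseteq> up y" using upper_up_subset[OF upper_up, of y x] y x(1) assms(1)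
      by (auto simp: up_def)
    ultimately have "up x \<subset> up y" using up_self[of y] y assms(1) by blast
    then show False using psubset_card_mono[of "up y" "up x"] x(2)[OF y(1)] by simp
  qed
  then show ?thesis using x(1) by blast
qed

text \<open>Peel off a minimal point \<open>x\<close>: the upper sets \<open>U - {x}\<close> and
  \<open>up x\<close> cover \<open>U\<close> and meet in \<open>up x - {x}\<close>, so modularity
  yields exactly the summand at \<open>x\<close>.\<close>

lemma sum_point_masses:
  fixes m :: "'p set \<Rightarrow> real"
  assumes empty: "m {} = 0"
    and modular: "\<And>U V. \<lbrakk>upper_set P U; upper_set P V\<rbrakk> \<Longrightarrow> m (U \<union> V) + m (U \<inter> V) = m U + m V"
    and U: "upper_set P U"
  shows "(\<Sum>x\<in>U. m (up x) - m (up x - {x})) = m U"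
  using upper_finite[OF U] U
proof (induction U rule: finite_psubset_induct)
  case (psubset U)
  show ?case
  proof (cases "U = {}")
    case True
    then show ?thesis by (simp add: empty)
  next
    case False
    then obtain x where x: "x \<in> U" "\<forall>y\<in>U. le P y x \<longrightarrow> y = x"
      using exists_minimal[OF upper_subset[OF psubset.prems]] by blast
    have xC: "x \<in> C" using x psubset.prems upper_subset by blast
    have U': "upper_set P (U - {x})" using psubset.prems x by (auto simp: upper_set_def)
    have e1: "(U - {x}) \<union> up x = U" and e2: "(U - {x}) \<inter> up x = up x - {x}"
      using upper_up_subset[OF psubset.prems x(1)] up_self[OF xC] x(1) by auto
    have "(\<Sum>y\<in>U - {x}. m (up y) - m (up y - {y})) = m (U - {x})"
      by (rule psubset.IH) (use x U' in auto)
    then show ?thesis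
      using modular[OF U' upper_up[OF xC]] e1 e2
      by (simp add: sum.remove[OF upper_finite[OF psubset.prems] x(1)])
  qed
qed

lemma valuations_po: "partial_order (valuations P)"
proof (rule partial_orderI)
  fix v w assume "v \<in> carrier (valuations P)" "w \<in> carrier (valuations P)"
    "le (valuations P) v w" "le (valuations P) w v"
  then show "v = w"
    using mass_le_antisym[of v w] by (auto simp: valuations_carrier intro: extensionalityI)
next
  fix u v w assume "le (valuations P) u v" "le (valuations P) v w"
  then show "le (valuations P) u w" using mass_le_trans[of P u v w] by simp
qed (simp_all add: valuations_def mass_le_def)

lemma upper_mass_bounds:
  assumes "v \<in> carrier (valuations P)" "upper_set P U"
  shows "0 \<le> sum v U" "sum v U \<le> 1"
proof -
  have "sum v U \<le> sum v C"
    using assms upper_subset[of U] by (intro sum_mono2 fin) (auto simp: valuations_carrier)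
  then show "sum v U \<le> 1" using assms by (simp add: valuations_carrier)
  show "0 \<le> sum v U"
    using assms upper_subset[of U] by (intro sum_nonneg) (auto simp: valuations_carrier)
qed

text \<open>The supremum is formed on each upper set separately. As there are only finitely many,
  one member of \<open>X\<close> is close on all of them at once; this uniformity makes the limit
  modular and is itself the second claim, used later in place of topology.\<close>

lemma valuations_lub_exists:
  assumes X: "X \<subseteq> carrier (valuations P)" and dir: "directed (mass_le P) X"
  shows "\<exists>q. is_lub (valuations P) q X \<and>
    (\<forall>\<delta>>0. \<exists>v\<in>X. \<forall>U. upper_set P U \<longrightarrow> sum q U - \<delta> < sum v U)"
proof -
  define m where "m U = (SUP v\<in>X. sum v U)" for U
  have ne: "X \<noteq> {}" using dir by (auto simp: directed_def)
  have bdd: "bdd_above ((\<lambda>v. sum v U) ` X)" if "upper_set P U" for U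
    using X upper_mass_bounds(2)[OF _ that] by (intro bdd_aboveI2[of _ _ 1]) auto
  have m_ge: "sum v U \<le> m U" if "v \<in> X" "upper_set P U" for v U
    unfolding m_def by (rule cSUP_upper[OF that(1) bdd[OF that(2)]])
  have m_le: "m U \<le> c" if "\<And>v. v \<in> X \<Longrightarrow> sum v U \<le> c" for c U
    unfolding m_def by (rule cSUP_least[OF ne that])
  have approx: "\<exists>v\<in>X. \<forall>U\<in>{U. upper_set P U}. m U - \<delta> < sum v U" if d: "0 < \<delta>" for \<delta>
  proof (rule directed_choose[OF valuations_po _ X finite_uppers])
    fix U assume U: "U \<in> {U. upper_set P U}"
    obtain x where "x \<in> X" "m U - \<delta> < sum x U"
      using less_cSUP_iff[OF ne bdd, of U "m U - \<delta>"] d U by (auto simp: m_def)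
    then show "\<exists>x\<in>X. \<forall>y\<in>X. le (valuations P) x y \<longrightarrow> m U - \<delta> < sum y U"
      using U by (force simp: mass_le_def)
  qed (use dir in simp)
  \<comment> \<open>One member of \<open>X\<close> is within \<delta>/4 of the limit on all four
    sets, and for that member the identity is exact.\<close>
  have modular: "m (U \<union> V) + m (U \<inter> V) = m U + m V" if UV: "upper_set P U" "upper_set P V" for U V
  proof -
    have "\<bar>(m (U \<union> V) + m (U \<inter> V)) - (m U + m V)\<bar> \<le> \<delta>" if d: "0 < \<delta>" for \<delta>
    proof -
      obtain v where v: "v \<in> X" "\<And>W. upper_set P W \<Longrightarrow> m W - \<delta>/4 < sum v W"
        using approx[of "\<delta>/4"] d by auto
      have "sum v (U \<union> V) + sum v (U \<inter> V) = sum v U + sum v V"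
        using UV upper_finite by (simp add: sum.union_inter)
      then show ?thesis
        using v(2)[OF UV(1)] v(2)[OF UV(2)] v(2)[OF upper_Un[OF UV]] v(2)[OF upper_Int[OF UV]]
          m_ge[OF v(1) UV(1)] m_ge[OF v(1) UV(2)] m_ge[OF v(1) upper_Un[OF UV]]
          m_ge[OF v(1) upper_Int[OF UV]] by linarith
    qed
    then have "\<bar>(m (U \<union> V) + m (U \<inter> V)) - (m U + m V)\<bar> \<le> 0" by (rule field_le_epsilon) simp
    then show ?thesis by simp
  qed
  define q where "q = restrict (\<lambda>x. m (up x) - m (up x - {x})) C"
  have qm: "sum q U = m U" if U: "upper_set P U" for U
  proof -
    have "m {} = 0" using ne by (simp add: m_def)
    then have "(\<Sum>x\<in>U. m (up x) - m (up x - {x})) = m U" by (rule sum_point_masses[OF _ modular U])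
    moreover have "sum q U = (\<Sum>x\<in>U. m (up x) - m (up x - {x}))"
      using upper_subset[OF U] by (intro sum.cong) (auto simp: q_def)
    ultimately show ?thesis by simp
  qed
  have q: "q \<in> carrier (valuations P)"
    unfolding valuations_carrier
  proof (intro conjI ballI)
    fix x assume x: "x \<in> C"
    have "m (up x - {x}) \<le> m (up x)"
    proof (rule m_le)
      fix v assume v: "v \<in> X"
      then have "0 \<le> v x" using X x by (auto simp: valuations_carrier subset_iff)
      then have "sum v (up x - {x}) \<le> sum v (up x)" using point_mass[OF x, of v] by simp
      then show "sum v (up x - {x}) \<le> m (up x)" using m_ge[OF v upper_up[OF x]] by simp
    qed
    then show "0 \<le> q x" using x by (simp add: q_def)
  next
    show "sum q C \<le> 1"
      using upper_mass_bounds(2)[OF _ upper_carrier] X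
      by (subst qm[OF upper_carrier]) (auto intro!: m_le)
  qed (simp add: q_def)
  have "is_lub (valuations P) q X"
    by (rule is_lubI[OF q]) (use X m_ge m_le qm in \<open>auto simp: mass_le_def\<close>)
  moreover have "\<forall>\<delta>>0. \<exists>v\<in>X. \<forall>U. upper_set P U \<longrightarrow> sum q U - \<delta> < sum v U"
    using approx qm by (metis mem_Collect_eq)
  ultimately show ?thesis by blast
qed

lemma valuations_dcpo: "dcpo (valuations P)"
  unfolding dcpo_def using valuations_po valuations_lub_exists by (metis valuations_le)

lemma valuations_lub_approx:
  assumes "X \<subseteq> carrier (valuations P)" "directed (mass_le P) X" "is_lub (valuations P) q X" "0 < \<delta>"
  shows "\<exists>v\<in>X. \<forall>U. upper_set P U \<longrightarrow> sum q U - \<delta> < sum v U"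
proof -
  obtain q' where q': "is_lub (valuations P) q' X"
    "\<forall>\<delta>>0. \<exists>v\<in>X. \<forall>U. upper_set P U \<longrightarrow> sum q' U - \<delta> < sum v U"
    using valuations_lub_exists[OF assms(1,2)] by blast
  then show ?thesis using is_lub_unique[OF valuations_po assms(3) q'(1)] assms(4) by simp
qed

end

lemma fva_valuations:
  fixes P :: "nat gorder"
  assumes "finite_poset P"
  shows "fva (valuations P)"
proof -
  interpret fin_poset P by unfold_locales (rule assms)
  show ?thesis
    unfolding fva_def
  proof (intro conjI valuations_dcpo exI)
    show "\<forall>n::nat. finite_poset P \<and> scott_continuous (valuations P) (valuations P) id \<and>
             scott_continuous (valuations P) (valuations P) id"
      using assms scott_id[OF valuations_po] by simp
    show "pointwise_sup_id (valuations P) (range (\<lambda>n::nat. id \<circ> id))"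
      by (auto simp: pointwise_sup_id_def intro!: is_lub_greatest)
  qed (auto simp: pointwise_le_def)
qed


section \<open>Finitely separated maps on valuations\<close>

context fin_poset
begin

text \<open>Support and mass bound are parameters because the induction changes both: spreading mass
  shrinks the support but multiplies the total.\<close>

definition cone :: "'p set \<Rightarrow> real \<Rightarrow> ('p \<Rightarrow> real) set" where
  "cone Q B = {v. (\<forall>x\<in>C. 0 \<le> v x) \<and> (\<forall>x\<in>C - Q. v x = 0) \<and> sum v C \<le> B}"

text \<open>The Lipschitz clause concerns comparable pairs only. It is closed under composition and
  will give Scott continuity.\<close>

definition regular :: "'p set \<Rightarrow> real \<Rightarrow> (('p \<Rightarrow> real) \<Rightarrow> 'p \<Rightarrow> real) \<Rightarrow> bool" where
  "regular Q B s \<longleftrightarrow>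
     (\<forall>v\<in>cone Q B. s v \<in> cone Q B \<and> mass_le P (s v) v) \<and>
     (\<forall>v\<in>cone Q B. \<forall>w\<in>cone Q B. mass_le P w v \<longrightarrow> mass_le P (s w) (s v)) \<and>
     (\<exists>c\<ge>0. \<forall>v\<in>cone Q B. \<forall>w\<in>cone Q B. \<forall>\<delta>. mass_le P w v \<longrightarrow>
        (\<forall>U. upper_set P U \<longrightarrow> sum v U - sum w U \<le> \<delta>) \<longrightarrow>
        (\<forall>U. upper_set P U \<longrightarrow> sum (s v) U - sum (s w) U \<le> c * \<delta>))"

definition close :: "'p set \<Rightarrow> real \<Rightarrow> real \<Rightarrow> (('p \<Rightarrow> real) \<Rightarrow> 'p \<Rightarrow> real) \<Rightarrow> bool" where
  "close Q B \<epsilon> s \<longleftrightarrow> (\<forall>v\<in>cone Q B. \<forall>U. upper_set P U \<longrightarrow> sum v U - \<epsilon> \<le> sum (s v) U)"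

text \<open>The gap of \<epsilon> on every upper set leaves room for a grid point between
  \<open>s v\<close> and \<open>v\<close>, and for the next member of an ascending sequence.\<close>

definition drops :: "'p set \<Rightarrow> real \<Rightarrow> real \<Rightarrow> (('p \<Rightarrow> real) \<Rightarrow> 'p \<Rightarrow> real) \<Rightarrow> bool" where
  "drops Q B \<epsilon> s \<longleftrightarrow> (\<forall>v\<in>cone Q B. \<forall>U. upper_set P U \<longrightarrow> sum (s v) U \<le> max 0 (sum v U - \<epsilon>))"

lemma cone_sum_nonneg: "\<lbrakk>v \<in> cone Q B; U \<subseteq> C\<rbrakk> \<Longrightarrow> 0 \<le> sum v U"
  by (intro sum_nonneg) (auto simp: cone_def)

lemma cone_sum_mono: "\<lbrakk>v \<in> cone Q B; U \<subseteq> V; V \<subseteq> C\<rbrakk> \<Longrightarrow> sum v U \<le> sum v V"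
  by (intro sum_mono2) (auto simp: cone_def intro: finite_subset[OF _ fin])

lemma cone_sum_le: "\<lbrakk>v \<in> cone Q B; U \<subseteq> C\<rbrakk> \<Longrightarrow> sum v U \<le> B"
  using cone_sum_mono[of v Q B U C] by (auto simp: cone_def)

text \<open>The mass of the upper set \<open>C - Q\<close> is zero at \<open>v\<close> and can only
  decrease, so a smaller nonnegative function keeps its support in \<open>Q\<close>.\<close>

lemma cone_downward:
  assumes v: "v \<in> cone Q B" and w: "\<And>x. x \<in> C \<Longrightarrow> 0 \<le> w x" "mass_le P w v"
    and Q: "upper_set P (C - Q)"
  shows "w \<in> cone Q B"
proof -
  have "sum w (C - Q) \<le> sum v (C - Q)" by (rule mass_leD[OF w(2) Q])
  also have "sum v (C - Q) = 0" using v by (intro sum.neutral) (auto simp: cone_def)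
  finally have "sum w (C - Q) \<le> 0" .
  moreover have "0 \<le> sum w (C - Q)" using w(1) by (intro sum_nonneg) auto
  ultimately have "\<forall>x\<in>C - Q. w x = 0"
    using sum_nonneg_eq_0_iff[of "C - Q" w] w(1) fin by auto
  then show ?thesis
    using w(1) mass_leD[OF w(2) upper_carrier] v by (auto simp: cone_def)
qed

lemma regularD:
  assumes "regular Q B s" "v \<in> cone Q B"
  shows "s v \<in> cone Q B" "mass_le P (s v) v"
  using assms by (auto simp: regular_def)

lemma regular_mono:
  "\<lbrakk>regular Q B s; v \<in> cone Q B; w \<in> cone Q B; mass_le P w v\<rbrakk> \<Longrightarrow> mass_le P (s w) (s v)"
  by (auto simp: regular_def)

lemma regular_lipschitz:
  assumes "regular Q B s"
  obtains c where "0 \<le> c"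
    "\<And>v w \<delta> U. \<lbrakk>v \<in> cone Q B; w \<in> cone Q B; mass_le P w v;
       \<And>U. upper_set P U \<Longrightarrow> sum v U - sum w U \<le> \<delta>; upper_set P U\<rbrakk> \<Longrightarrow> sum (s v) U - sum (s w) U \<le> c * \<delta>"
proof -
  obtain c where "0 \<le> c" and c: "\<forall>v\<in>cone Q B. \<forall>w\<in>cone Q B. \<forall>\<delta>. mass_le P w v \<longrightarrow>
        (\<forall>U. upper_set P U \<longrightarrow> sum v U - sum w U \<le> \<delta>) \<longrightarrow>
        (\<forall>U. upper_set P U \<longrightarrow> sum (s v) U - sum (s w) U \<le> c * \<delta>)"
    using assms unfolding regular_def by blast
  show thesis by (rule that[OF \<open>0 \<le> c\<close>]) (use c in blast)
qed

lemma regularI: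
  assumes "\<And>v. v \<in> cone Q B \<Longrightarrow> s v \<in> cone Q B"
    and "\<And>v. v \<in> cone Q B \<Longrightarrow> mass_le P (s v) v"
    and "\<And>v w. \<lbrakk>v \<in> cone Q B; w \<in> cone Q B; mass_le P w v\<rbrakk> \<Longrightarrow> mass_le P (s w) (s v)"
    and "0 \<le> c"
    and "\<And>v w \<delta> U. \<lbrakk>v \<in> cone Q B; w \<in> cone Q B; mass_le P w v; 0 \<le> \<delta>;
       \<And>U. upper_set P U \<Longrightarrow> sum v U - sum w U \<le> \<delta>; upper_set P U\<rbrakk> \<Longrightarrow> sum (s v) U - sum (s w) U \<le> c * \<delta>"
  shows "regular Q B s"
  unfolding regular_def
proof (intro conjI ballI impI exI[of _ c] allI assms(1-4))
  fix v w \<delta> U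
  assume vw: "v \<in> cone Q B" "w \<in> cone Q B" "mass_le P w v"
    and d: "\<forall>U. upper_set P U \<longrightarrow> sum v U - sum w U \<le> \<delta>" and U: "upper_set P U"
  have "0 \<le> \<delta>" using d upper_empty by force
  then show "sum (s v) U - sum (s w) U \<le> c * \<delta>" using assms(5)[OF vw _ _ U, of \<delta>] d by blast
qed

lemma regular_id: "regular Q B (\<lambda>v. v)"
  by (rule regularI[where c = 1]) auto

lemma regular_comp:
  assumes s: "regular Q B s" and t: "regular Q B t"
  shows "regular Q B (\<lambda>v. t (s v))"
proof -
  obtain c where c: "0 \<le> c" "\<And>v w \<delta> U. \<lbrakk>v \<in> cone Q B; w \<in> cone Q B; mass_le P w v;
       \<And>U. upper_set P U \<Longrightarrow> sum v U - sum w U \<le> \<delta>; upper_set P U\<rbrakk> \<Longrightarrow> sum (s v) U - sum (s w) U \<le> c * \<delta>"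
    by (rule regular_lipschitz[OF s]) blast
  obtain d where d: "0 \<le> d" "\<And>v w \<delta> U. \<lbrakk>v \<in> cone Q B; w \<in> cone Q B; mass_le P w v;
       \<And>U. upper_set P U \<Longrightarrow> sum v U - sum w U \<le> \<delta>; upper_set P U\<rbrakk> \<Longrightarrow> sum (t v) U - sum (t w) U \<le> d * \<delta>"
    by (rule regular_lipschitz[OF t]) blast
  show ?thesis
  proof (rule regularI[where c = "d * c"])
    fix v w assume *: "v \<in> cone Q B" "w \<in> cone Q B" "mass_le P w v"
    show "mass_le P (t (s w)) (t (s v))"
      by (intro regular_mono[OF t] regular_mono[OF s] regularD[OF s] *)
    fix \<delta> U
    assume **: "\<And>U. upper_set P U \<Longrightarrow> sum v U - sum w U \<le> \<delta>" "upper_set P U"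
    have "sum (t (s v)) U - sum (t (s w)) U \<le> d * (c * \<delta>)"
      by (rule d(2)) (use * ** c regularD[OF s] regular_mono[OF s] in auto)
    then show "sum (t (s v)) U - sum (t (s w)) U \<le> d * c * \<delta>" by (simp add: mult.assoc)
  next
    fix v assume v: "v \<in> cone Q B"
    show "t (s v) \<in> cone Q B" by (intro regularD[OF s] regularD[OF t] v)
    show "mass_le P (t (s v)) v"
      using mass_le_trans regularD[OF s v] regularD[OF t regularD(1)[OF s v]] by blast
  qed (use c d in simp)
qed

section \<open>Spreading mass downwards\<close>

lemma layered_sum:
  fixes h :: "'p \<Rightarrow> nat"
  assumes "\<And>y. y \<in> C \<Longrightarrow> h y \<le> N"
  shows "(\<Sum>y\<in>C. real (h y) * v y) = (\<Sum>k<N. sum v {y \<in> C. k < h y})"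
proof -
  have "(\<Sum>k<N. sum v {y \<in> C. k < h y}) = (\<Sum>k<N. \<Sum>y\<in>C. if k < h y then v y else 0)"
    by (simp add: sum.inter_filter fin)
  also have "\<dots> = (\<Sum>y\<in>C. \<Sum>k<N. if k < h y then v y else 0)" by (rule sum.swap)
  also have "\<dots> = (\<Sum>y\<in>C. real (h y) * v y)"
  proof (rule sum.cong[OF refl])
    fix y assume "y \<in> C"
    have "(\<Sum>k<N. if k < h y then v y else 0) = (\<Sum>k\<in>{k\<in>{..<N}. k < h y}. v y)"
      by (rule sum.inter_filter[symmetric]) simp
    also have "{k\<in>{..<N}. k < h y} = {..<h y}" using assms[OF \<open>y \<in> C\<close>] by auto
    finally show "(\<Sum>k<N. if k < h y then v y else 0) = real (h y) * v y" by simp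
  qed
  finally show ?thesis ..
qed

text \<open>A monotone integer weight is a sum of indicators of upper sets, so weighted sums inherit
  the bounds known for upper sets. With \<delta> = 0 this is monotonicity.\<close>

lemma layered_sum_diff:
  fixes h :: "'p \<Rightarrow> nat"
  assumes N: "\<And>y. y \<in> C \<Longrightarrow> h y \<le> N"
    and mono: "\<And>x y. \<lbrakk>x \<in> C; y \<in> C; le P x y\<rbrakk> \<Longrightarrow> h x \<le> h y"
    and d: "\<And>U. upper_set P U \<Longrightarrow> sum v U - sum w U \<le> \<delta>"
  shows "(\<Sum>y\<in>C. real (h y) * v y) - (\<Sum>y\<in>C. real (h y) * w y) \<le> real N * \<delta>"
proof -
  have "upper_set P {y \<in> C. k < h y}" for k
    using mono by (fastforce simp: upper_set_def)
  then have "(\<Sum>k<N. sum v {y \<in> C. k < h y} - sum w {y \<in> C. k < h y}) \<le> (\<Sum>k<N. \<delta>)"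
    by (intro sum_mono d)
  then show ?thesis by (simp add: layered_sum[OF N] sum_subtractf)
qed

text \<open>Mass in \<^term>\<open>up x\<close> is moved to every point strictly below it outside \<^term>\<open>up x\<close>.
  It is duplicated rather than divided, which is what makes the map monotone.\<close>

definition spread :: "'p \<Rightarrow> ('p \<Rightarrow> real) \<Rightarrow> 'p \<Rightarrow> real" where
  "spread x v z = (if le P x z then 0 else v z + sum v (up z \<inter> up x))"

text \<open>The coefficient of \<open>v y\<close> in the mass that \<open>spread x v\<close> gives
  to \<open>U\<close>. It is a natural number so that it can be cut into layers.\<close>

definition spread_weight :: "'p \<Rightarrow> 'p set \<Rightarrow> 'p \<Rightarrow> nat" where
  "spread_weight x U y =
     (if le P x y then card {z \<in> U. \<not> le P x z \<and> le P z y} else if y \<in> U then 1 else 0)"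

lemma sum_spread:
  assumes "upper_set P U" "x \<in> C"
  shows "sum (spread x v) U = (\<Sum>y\<in>C. real (spread_weight x U y) * v y)"
proof -
  have UC: "U \<subseteq> C" "finite U" using assms upper_subset upper_finite by auto
  have "sum (spread x v) U =
      (\<Sum>z\<in>U. (if le P x z then 0 else v z)) + (\<Sum>z\<in>U. if le P x z then 0 else sum v (up z \<inter> up x))"
    by (simp add: spread_def if_distrib flip: sum.distrib cong: if_cong)
  also have "(\<Sum>z\<in>U. (if le P x z then 0 else v z)) =
      (\<Sum>y\<in>C. (if y \<in> U \<and> \<not> le P x y then v y else 0))"
    by (rule sum.mono_neutral_cong_left) (use UC fin in auto)
  also have "(\<Sum>z\<in>U. if le P x z then 0 else sum v (up z \<inter> up x)) =
      (\<Sum>z\<in>U. \<Sum>y\<in>C. if \<not> le P x z \<and> le P z y \<and> le P x y then v y else 0)"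
  proof (rule sum.cong[OF refl])
    fix z
    have "(\<Sum>y\<in>C. if le P z y \<and> le P x y then v y else 0) = sum v {y \<in> C. le P z y \<and> le P x y}"
      by (simp add: sum.inter_filter fin)
    also have "{y \<in> C. le P z y \<and> le P x y} = up z \<inter> up x" by (auto simp: up_def)
    finally show "(if le P x z then 0 else sum v (up z \<inter> up x)) =
      (\<Sum>y\<in>C. if \<not> le P x z \<and> le P z y \<and> le P x y then v y else 0)" by simp
  qed
  also have "\<dots> = (\<Sum>y\<in>C. \<Sum>z\<in>U. if \<not> le P x z \<and> le P z y \<and> le P x y then v y else 0)"
    by (rule sum.swap)
  also have "\<dots> = (\<Sum>y\<in>C. if le P x y then real (card {z \<in> U. \<not> le P x z \<and> le P z y}) * v y else 0)"
  proof (rule sum.cong[OF refl])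
    fix y
    have "(\<Sum>z\<in>U. if \<not> le P x z \<and> le P z y then v y else 0) =
        (\<Sum>z\<in>{z\<in>U. \<not> le P x z \<and> le P z y}. v y)"
      by (rule sum.inter_filter[symmetric]) (rule UC)
    then show "(\<Sum>z\<in>U. if \<not> le P x z \<and> le P z y \<and> le P x y then v y else 0) =
        (if le P x y then real (card {z \<in> U. \<not> le P x z \<and> le P z y}) * v y else 0)" by simp
  qed
  finally show ?thesis
    unfolding sum.distrib[symmetric]
    by (rule trans, intro sum.cong refl) (simp add: spread_weight_def)
qed

lemma spread_weight_le:
  assumes "upper_set P U"
  shows "spread_weight x U y \<le> Suc (card C)"
proof -
  have "card {z \<in> U. \<not> le P x z \<and> le P z y} \<le> card C"
    by (rule card_mono[OF fin]) (use assms upper_subset in auto)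
  then show ?thesis by (simp add: spread_weight_def)
qed

text \<open>The critical case is the step from a point \<open>y\<close> of \<open>U\<close> outside
  \<open>up x\<close> to a point inside. There \<open>y\<close> is itself one of the points counted
  for \<open>y'\<close>, so the weight stays at least 1; dividing the mass among the points would
  break this.\<close>

lemma spread_weight_mono:
  assumes U: "upper_set P U" and x: "x \<in> C" and y: "y \<in> C" "y' \<in> C" "le P y y'"
  shows "spread_weight x U y \<le> spread_weight x U y'"
proof -
  have fU: "finite U" using U upper_finite by simp
  show ?thesis
  proof (cases "le P x y'")
    case True
    have sub: "{z \<in> U. \<not> le P x z \<and> le P z y} \<subseteq> {z \<in> U. \<not> le P x z \<and> le P z y'}"
      using po_trans[OF po _ y(3)] y upper_subset[OF U] by blast
    have "card {z \<in> U. \<not> le P x z \<and> le P z y} \<le> card {z \<in> U. \<not> le P x z \<and> le P z y'}"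
      by (rule card_mono[OF _ sub]) (use fU in auto)
    moreover have "1 \<le> card {z \<in> U. \<not> le P x z \<and> le P z y'}" if "y \<in> U" "\<not> le P x y"
      using fU that y(3) by (fastforce simp: Suc_le_eq card_gt_0_iff)
    ultimately show ?thesis using True by (simp add: spread_weight_def)
  next
    case False
    then have "\<not> le P x y" using po_trans[OF po _ y(3) x y(1,2)] by blast
    moreover have "y \<in> U \<Longrightarrow> y' \<in> U" using U y by (auto simp: upper_set_def)
    ultimately show ?thesis using False by (simp add: spread_weight_def)
  qed
qed

lemma spread_diff:
  assumes "x \<in> C" "upper_set P U"
    and "\<And>U. upper_set P U \<Longrightarrow> sum v U - sum w U \<le> \<delta>"
  shows "sum (spread x v) U - sum (spread x w) U \<le> real (Suc (card C)) * \<delta>"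
  unfolding sum_spread[OF assms(2,1)]
  by (rule layered_sum_diff) (use assms spread_weight_le spread_weight_mono in auto)

lemma spread_mono:
  assumes "x \<in> C" "mass_le P w v"
  shows "mass_le P (spread x w) (spread x v)"
  unfolding mass_le_def
proof (intro allI impI)
  fix U assume "upper_set P U"
  then have "sum (spread x w) U - sum (spread x v) U \<le> real (Suc (card C)) * 0"
    using assms by (intro spread_diff) (auto simp: mass_le_def)
  then show "sum (spread x w) U \<le> sum (spread x v) U" by simp
qed

lemma spread_upper:
  assumes v: "v \<in> cone Q B" and x: "x \<in> C" and U: "upper_set P U"
  shows "sum (spread x v) U \<le> sum v U + real (card C) * sum v (up x)"
proof -
  have UC: "U \<subseteq> C" using upper_subset[OF U] .
  have t: "0 \<le> sum v (up x)" by (rule cone_sum_nonneg[OF v up_subset])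
  have "sum (spread x v) U \<le> (\<Sum>z\<in>U. v z + sum v (up x))"
  proof (rule sum_mono)
    fix z assume "z \<in> U"
    then have "0 \<le> v z" using v UC by (auto simp: cone_def)
    moreover have "sum v (up z \<inter> up x) \<le> sum v (up x)"
      by (rule cone_sum_mono[OF v]) (auto simp: up_def)
    ultimately show "spread x v z \<le> v z + sum v (up x)" using t by (simp add: spread_def)
  qed
  also have "\<dots> = sum v U + real (card U) * sum v (up x)" by (simp add: sum.distrib)
  also have "\<dots> \<le> sum v U + real (card C) * sum v (up x)"
    using card_mono[OF fin UC] t by (intro add_left_mono mult_right_mono) auto
  finally show ?thesis .
qed

lemma spread_lower:
  assumes v: "v \<in> cone Q B" and x: "x \<in> C" and U: "upper_set P U"
  shows "sum v U - sum v (up x) \<le> sum (spread x v) U"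
proof -
  have UC: "U \<subseteq> C" and fU: "finite U" using upper_subset[OF U] upper_finite[OF U] .
  have pos: "0 \<le> sum v (up z \<inter> up x)" for z
    by (rule cone_sum_nonneg[OF v]) (auto simp: up_def)
  have "sum v U = sum v (U - up x) + sum v (U \<inter> up x)"
    by (metis Diff_Diff_Int Diff_subset fU sum.subset_diff inf.commute add.commute)
  moreover have "sum v (U \<inter> up x) \<le> sum v (up x)" by (rule cone_sum_mono[OF v]) (auto simp: up_def)
  moreover have "sum v (U - up x) \<le> sum (spread x v) (U - up x)"
    by (intro sum_mono) (use UC pos in \<open>auto simp: spread_def up_def\<close>)
  moreover have "sum (spread x v) (U - up x) \<le> sum (spread x v) U"
    by (intro sum_mono2 fU)
      (use UC v pos in \<open>auto simp: spread_def cone_def\<close>)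
  ultimately show ?thesis by linarith
qed

lemma spread_cone:
  assumes v: "v \<in> cone Q B" and x: "x \<in> C" and Q: "upper_set P (C - Q)" and B: "0 \<le> B"
  shows "spread x v \<in> cone (Q - up x) (real (Suc (card C)) * B)"
proof -
  have up: "0 \<le> sum v (up z \<inter> up x)" for z
    by (rule cone_sum_nonneg[OF v]) (auto simp: up_def)
  have "sum (spread x v) C \<le> sum v C + real (card C) * sum v (up x)"
    by (rule spread_upper[OF v x upper_carrier])
  also have "\<dots> \<le> B + real (card C) * B"
    using cone_sum_le[OF v] up_subset by (intro add_mono mult_left_mono) auto
  finally have "sum (spread x v) C \<le> real (Suc (card C)) * B" by (simp add: algebra_simps)
  moreover have "spread x v z = 0" if z: "z \<in> C" "z \<notin> Q - up x" for z
  proof (cases "le P x z")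
    case False
    then have "z \<in> C - Q" using z by (auto simp: up_def)
    then have "v y = 0" if "y \<in> up z" for y
      using v that upper_up_subset[OF Q, of z] by (auto simp: cone_def)
    then show ?thesis using False z up_self[of z] by (simp add: spread_def)
  qed (simp add: spread_def)
  moreover have "0 \<le> spread x v z" if "z \<in> C" for z
    using v that up by (auto simp: spread_def cone_def)
  ultimately show ?thesis by (auto simp: cone_def)
qed

text \<open>The map interpolates between \<open>v\<close>, used when \<open>up x\<close> is heavy,
  and \<open>A v\<close>, which is supported off \<open>up x\<close>, used when \<open>up x\<close>
  is light. Monotonicity needs \<open>A v\<close> below \<open>v\<close> wherever \<open>A v\<close>
  is used with positive weight; there \<open>up x\<close> has little mass, so the excess created by
  spreading is at most the amount \<epsilon>' that \<open>R\<close> takes away.\<close>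

lemma kill_up_set:
  assumes Q: "Q \<subseteq> C" "upper_set P (C - Q)" and x: "x \<in> Q" and B: "0 \<le> B" and \<epsilon>: "0 < \<epsilon>"
    and R: "regular (Q - up x) (real (Suc (card C)) * B) R"
    and Rclose: "close (Q - up x) (real (Suc (card C)) * B) (\<epsilon> / 2) R"
    and Rdrops: "drops (Q - up x) (real (Suc (card C)) * B) \<epsilon>' R" "0 < \<epsilon>'"
  shows "\<exists>s \<epsilon>0. 0 < \<epsilon>0 \<and> regular Q B s \<and> close Q B \<epsilon> s \<and>
    (\<forall>v\<in>cone Q B. sum v (up x) \<le> \<epsilon>0 \<longrightarrow> (\<forall>z\<in>up x. s v z = 0))"
proof -
  define n where "n = real (Suc (card C))"
  let ?K = "cone (Q - up x) (n * B)"
  \<comment> \<open>\<open>lam\<close> is 0 up to mass \<open>\<epsilon>0\<close> of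
    \<open>up x\<close> and reaches 1 at twice that mass. The first bound keeps the spreading excess
    below \<epsilon>'; the second keeps the mass lost from \<open>up x\<close> below \<epsilon>/2,
    the other half being lost by \<open>R\<close>.\<close>
  define \<epsilon>0 where "\<epsilon>0 = min (\<epsilon>' / (2 * n)) (\<epsilon> / 4)"
  define A where "A v = R (spread x v)" for v
  define lam where "lam v = max 0 (min 1 ((sum v (up x) - \<epsilon>0) / \<epsilon>0))" for v :: "'p \<Rightarrow> real"
  define s where "s v z = (1 - lam v) * A v z + lam v * v z" for v z
  have xC: "x \<in> C" using x Q by auto
  have n: "1 \<le> n" by (simp add: n_def)
  have \<epsilon>0: "0 < \<epsilon>0" using n \<epsilon> Rdrops(2) by (simp add: \<epsilon>0_def)
  have lam01: "0 \<le> lam v" "lam v \<le> 1" for v by (auto simp: lam_def)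
  have lam_less: "sum v (up x) < 2 * \<epsilon>0" if "lam v < 1" for v
  proof -
    have "(sum v (up x) - \<epsilon>0) / \<epsilon>0 < 1" using that by (auto simp: lam_def)
    then show ?thesis using \<epsilon>0 by (simp add: divide_less_eq)
  qed
  have sum_s: "sum (s v) U = (1 - lam v) * sum (A v) U + lam v * sum v U" for v U
    by (simp add: s_def sum.distrib sum_distrib_left)
  have spread_in: "spread x v \<in> ?K" if "v \<in> cone Q B" for v
    using spread_cone[OF that xC Q(2) B] by (simp add: n_def)
  have A_in: "A v \<in> ?K" if "v \<in> cone Q B" for v
    using regularD(1)[OF R spread_in[OF that, unfolded n_def]] by (simp add: A_def n_def)
  have A_nonneg: "0 \<le> sum (A v) U" if "v \<in> cone Q B" "upper_set P U" for v U
    using cone_sum_nonneg[OF A_in[OF that(1)] upper_subset[OF that(2)]] .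
  have A_le: "sum (A v) U \<le> sum v U" if v: "v \<in> cone Q B" and U: "upper_set P U" and l: "lam v < 1" for v U
  proof -
    have t: "0 \<le> sum v (up x)" by (rule cone_sum_nonneg[OF v up_subset])
    have "sum (A v) U \<le> max 0 (sum (spread x v) U - \<epsilon>')"
      using Rdrops(1) spread_in[OF v] U by (simp add: drops_def A_def n_def)
    moreover have "sum (spread x v) U \<le> sum v U + (n - 1) * sum v (up x)"
      using spread_upper[OF v xC U] by (simp add: n_def)
    moreover have "(n - 1) * sum v (up x) \<le> \<epsilon>'"
    proof -
      have "(n - 1) * sum v (up x) \<le> n * (2 * \<epsilon>0)"
        using lam_less[OF l] t n by (intro mult_mono) auto
      also have "\<dots> \<le> n * (2 * (\<epsilon>' / (2 * n)))"
        using n by (intro mult_left_mono) (auto simp: \<epsilon>0_def)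
      also have "\<dots> = \<epsilon>'" using n by simp
      finally show ?thesis .
    qed
    moreover have "0 \<le> sum v U" by (rule cone_sum_nonneg[OF v upper_subset[OF U]])
    ultimately show ?thesis by linarith
  qed
  have s_le: "mass_le P (s v) v" if v: "v \<in> cone Q B" for v
    unfolding mass_le_def
  proof (intro allI impI)
    fix U assume U: "upper_set P U"
    show "sum (s v) U \<le> sum v U"
    proof (cases "lam v < 1")
      case True
      have "(1 - lam v) * sum (A v) U \<le> (1 - lam v) * sum v U"
        using A_le[OF v U True] True by (intro mult_left_mono) auto
      then show ?thesis by (simp add: sum_s algebra_simps)
    next
      case False
      then have "lam v = 1" using lam01(2)[of v] by simp
      then show ?thesis by (simp add: sum_s)
    qed
  qed
  have s_nonneg: "0 \<le> s v z" if "v \<in> cone Q B" "z \<in> C" for v z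
    using A_in[OF that(1)] that lam01[of v] by (auto simp: s_def cone_def)
  have s_in: "s v \<in> cone Q B" if "v \<in> cone Q B" for v
    by (rule cone_downward[OF that _ s_le[OF that] Q(2)]) (rule s_nonneg[OF that])
  have A_mono: "mass_le P (A w) (A v)" if "v \<in> cone Q B" "w \<in> cone Q B" "mass_le P w v" for v w
    unfolding A_def
    by (rule regular_mono[OF R])
      (use spread_mono[OF xC that(3)] spread_in that in \<open>auto simp: n_def\<close>)
  have lam_mono: "lam w \<le> lam v" if "mass_le P w v" for v w
    using mass_leD[OF that upper_up[OF xC]] \<epsilon>0
    unfolding lam_def by (intro max.mono min.mono divide_right_mono) auto
  have s_mono: "mass_le P (s w) (s v)" if v: "v \<in> cone Q B" and w: "w \<in> cone Q B" and wv: "mass_le P w v" for v w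
  proof (cases "lam v < 1")
    case False
    then have "lam v = 1" using lam01(2)[of v] by simp
    then have "s v = v" by (simp add: s_def fun_eq_iff)
    then show ?thesis using mass_le_trans[OF s_le[OF w] wv] by simp
  next
    case True
    show ?thesis
      unfolding mass_le_def
    proof (intro allI impI)
      fix U assume U: "upper_set P U"
      \<comment> \<open>Replace \<open>w\<close> by \<open>v\<close> with the weights unchanged,
        then raise the weight from \<open>lam w\<close> to \<open>lam v\<close>; the latter
        increases the mass because \<open>A v\<close> lies below \<open>v\<close>.\<close>
      have "sum (s w) U \<le> (1 - lam w) * sum (A v) U + lam w * sum v U"
        unfolding sum_s using mass_leD[OF A_mono[OF v w wv] U] mass_leD[OF wv U] lam01[of w]
        by (intro add_mono mult_left_mono) auto
      moreover have "0 \<le> (lam v - lam w) * (sum v U - sum (A v) U)"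
        using A_le[OF v U True] lam_mono[OF wv] by simp
      ultimately show "sum (s w) U \<le> sum (s v) U" by (simp add: sum_s algebra_simps)
    qed
  qed
  obtain c where c: "0 \<le> c"
    "\<And>v w \<delta> U. \<lbrakk>v \<in> ?K; w \<in> ?K; mass_le P w v;
       \<And>U. upper_set P U \<Longrightarrow> sum v U - sum w U \<le> \<delta>; upper_set P U\<rbrakk> \<Longrightarrow> sum (R v) U - sum (R w) U \<le> c * \<delta>"
    unfolding n_def by (rule regular_lipschitz[OF R]) blast
  \<comment> \<open>The three summands of the constant come from \<open>A\<close>, from the
    identity, and from the slope \<open>1 / \<epsilon>0\<close> of \<open>lam\<close> times the mass
    bound \<open>B\<close>.\<close>
  have "regular Q B s"
  proof (rule regularI[where c = "c * n + 1 + B / \<epsilon>0"])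
    show "0 \<le> c * n + 1 + B / \<epsilon>0" using c n B \<epsilon>0 by simp
    fix v w \<delta> U
    assume v: "v \<in> cone Q B" and w: "w \<in> cone Q B" and wv: "mass_le P w v" and d0: "0 \<le> \<delta>"
      and d: "\<And>U. upper_set P U \<Longrightarrow> sum v U - sum w U \<le> \<delta>" and U: "upper_set P U"
    have "sum (A v) U - sum (A w) U \<le> c * (n * \<delta>)"
      unfolding A_def
      by (rule c(2)) (use spread_in v w spread_mono[OF xC wv] spread_diff[OF xC _ d] U in \<open>auto simp: n_def\<close>)
    moreover have "0 \<le> c * (n * \<delta>)" using c n d0 by simp
    ultimately have 1: "(1 - lam v) * (sum (A v) U - sum (A w) U) \<le> 1 * (c * (n * \<delta>))"
      using lam01[of v] mass_leD[OF A_mono[OF v w wv] U] by (intro mult_mono) auto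
    have 2: "lam v * (sum v U - sum w U) \<le> 1 * \<delta>"
      using lam01[of v] d[OF U] mass_leD[OF wv U] by (intro mult_mono) auto
    have "lam v - lam w \<le> \<delta> / \<epsilon>0"
    proof -
      have "(sum v (up x) - \<epsilon>0) / \<epsilon>0 - (sum w (up x) - \<epsilon>0) / \<epsilon>0 \<le> \<delta> / \<epsilon>0"
        using d[OF upper_up[OF xC]] \<epsilon>0 by (simp add: diff_divide_distrib[symmetric] divide_right_mono)
      moreover have "0 \<le> \<delta> / \<epsilon>0" using d0 \<epsilon>0 by simp
      ultimately show ?thesis unfolding lam_def by linarith
    qed
    moreover have "sum w U - sum (A w) U \<le> B"
      using cone_sum_le[OF w upper_subset[OF U]] A_nonneg[OF w U] by linarith
    ultimately have 3: "(lam v - lam w) * (sum w U - sum (A w) U) \<le> (\<delta> / \<epsilon>0) * B"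
    proof -
      have "(lam v - lam w) * (sum w U - sum (A w) U) \<le> (lam v - lam w) * B"
        using lam_mono[OF wv] \<open>sum w U - sum (A w) U \<le> B\<close> by (intro mult_left_mono) auto
      also have "\<dots> \<le> (\<delta> / \<epsilon>0) * B"
        using \<open>lam v - lam w \<le> \<delta> / \<epsilon>0\<close> B by (intro mult_right_mono)
      finally show ?thesis .
    qed
    have "sum (s v) U - sum (s w) U = (1 - lam v) * (sum (A v) U - sum (A w) U)
        + lam v * (sum v U - sum w U) + (lam v - lam w) * (sum w U - sum (A w) U)"
      by (simp add: sum_s algebra_simps)
    then show "sum (s v) U - sum (s w) U \<le> (c * n + 1 + B / \<epsilon>0) * \<delta>"
      using 1 2 3 by (simp add: algebra_simps)
  qed (use s_in s_le s_mono in auto)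
  moreover have "close Q B \<epsilon> s"
    unfolding close_def
  proof (intro ballI allI impI)
    fix v U assume v: "v \<in> cone Q B" and U: "upper_set P U"
    show "sum v U - \<epsilon> \<le> sum (s v) U"
    proof (cases "lam v < 1")
      case True
      have "sum (spread x v) U - \<epsilon> / 2 \<le> sum (A v) U"
        using Rclose spread_in[OF v] U by (simp add: close_def A_def n_def)
      moreover have "sum v U - sum v (up x) \<le> sum (spread x v) U" by (rule spread_lower[OF v xC U])
      moreover have "2 * \<epsilon>0 \<le> \<epsilon> / 2" by (simp add: \<epsilon>0_def)
      ultimately have "sum v U - \<epsilon> \<le> sum (A v) U" using lam_less[OF True] by linarith
      then have "(1 - lam v) * (sum v U - \<epsilon>) \<le> (1 - lam v) * sum (A v) U"
        using True by (intro mult_left_mono) auto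
      moreover have "0 \<le> lam v * \<epsilon>" using lam01 \<epsilon> by simp
      ultimately show ?thesis by (simp add: sum_s algebra_simps)
    next
      case False
      then have "lam v = 1" using lam01(2)[of v] by simp
      then show ?thesis using \<epsilon> by (simp add: sum_s)
    qed
  qed
  moreover have "s v z = 0" if "v \<in> cone Q B" "sum v (up x) \<le> \<epsilon>0" "z \<in> up x" for v z
  proof -
    have "(sum v (up x) - \<epsilon>0) / \<epsilon>0 \<le> 0" using that \<epsilon>0 by (simp add: divide_le_0_iff)
    then have "lam v = 0" by (auto simp: lam_def)
    moreover have "A v z = 0" using A_in[OF that(1)] that(3) up_subset by (auto simp: cone_def)
    ultimately show ?thesis by (simp add: s_def)
  qed
  ultimately show ?thesis using \<epsilon>0 by blast
qed

text \<open>Induction on the support. For each \<open>x\<close> the hypothesis for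
  \<open>Q - up x\<close> provides a map that empties \<open>up x\<close> when it is light.
  Composing these maps over all \<open>x\<close> in \<open>Q\<close> empties every light upper set,
  and scaling by a factor below 1 then lowers the heavy ones.\<close>

lemma exists_dropping:
  assumes "Q \<subseteq> C" "upper_set P (C - Q)" "0 \<le> B" "0 < \<epsilon>"
  shows "\<exists>s \<epsilon>'. 0 < \<epsilon>' \<and> regular Q B s \<and> close Q B \<epsilon> s \<and> drops Q B \<epsilon>' s"
  using finite_subset[OF assms(1) fin] assms
proof (induction Q arbitrary: B \<epsilon> rule: finite_psubset_induct)
  case (psubset Q)
  note Q = psubset.prems(1,2) and B = psubset.prems(3)
  have kill: "\<exists>s \<epsilon>0. 0 < \<epsilon>0 \<and> regular Q B s \<and> close Q B \<delta> s \<and>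
    (\<forall>v\<in>cone Q B. sum v (up x) \<le> \<epsilon>0 \<longrightarrow> (\<forall>z\<in>up x. s v z = 0))" if x: "x \<in> Q" and d: "0 < \<delta>" for x \<delta>
  proof -
    have xC: "x \<in> C" using x Q by auto
    have eq: "C - (Q - up x) = (C - Q) \<union> up x" by (auto simp: up_def)
    have "\<exists>s \<epsilon>'. 0 < \<epsilon>' \<and> regular (Q - up x) (real (Suc (card C)) * B) s \<and>
        close (Q - up x) (real (Suc (card C)) * B) (\<delta> / 2) s \<and> drops (Q - up x) (real (Suc (card C)) * B) \<epsilon>' s"
      by (rule psubset.IH) (use x Q B d up_self[OF xC] upper_Un[OF Q(2) upper_up[OF xC]] in \<open>auto simp: eq\<close>)
    then show ?thesis using kill_up_set[OF Q x B d] by blast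
  qed
  have "\<exists>s \<epsilon>0. 0 < \<epsilon>0 \<and> regular Q B s \<and> close Q B \<delta> s \<and>
    (\<forall>v\<in>cone Q B. \<forall>x\<in>X. sum v (up x) \<le> \<epsilon>0 \<longrightarrow> (\<forall>z\<in>up x. s v z = 0))"
    if "X \<subseteq> Q" "0 < \<delta>" for X \<delta>
    using finite_subset[OF that(1) psubset.hyps] that
  proof (induction X arbitrary: \<delta>)
    case empty
    then show ?case using regular_id[of Q B] by (intro exI[of _ "\<lambda>v. v"] exI[of _ 1]) (auto simp: close_def)
  next
    case (insert x X)
    obtain s \<epsilon>1 where s: "0 < \<epsilon>1" "regular Q B s" "close Q B (\<delta> / 2) s"
      "\<And>v y z. \<lbrakk>v \<in> cone Q B; y \<in> X; sum v (up y) \<le> \<epsilon>1; z \<in> up y\<rbrakk> \<Longrightarrow> s v z = 0"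
      using insert.IH[of "\<delta> / 2"] insert.prems by auto
    obtain t \<epsilon>2 where t: "0 < \<epsilon>2" "regular Q B t" "close Q B (\<delta> / 2) t"
      "\<And>v z. \<lbrakk>v \<in> cone Q B; sum v (up x) \<le> \<epsilon>2; z \<in> up x\<rbrakk> \<Longrightarrow> t v z = 0"
      using kill[of x "\<delta> / 2"] insert.prems by auto
    have reg: "regular Q B (\<lambda>v. t (s v))" by (rule regular_comp[OF s(2) t(2)])
    have close: "close Q B \<delta> (\<lambda>v. t (s v))"
      unfolding close_def
    proof (intro ballI allI impI)
      fix v U assume v: "v \<in> cone Q B" and U: "upper_set P U"
      have "sum v U - \<delta> / 2 \<le> sum (s v) U" using s(3) v U by (simp add: close_def)
      moreover have "sum (s v) U - \<delta> / 2 \<le> sum (t (s v)) U"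
        using t(3) regularD(1)[OF s(2) v] U by (simp add: close_def)
      ultimately show "sum v U - \<delta> \<le> sum (t (s v)) U" by linarith
    qed
    have "t (s v) z = 0"
      if v: "v \<in> cone Q B" and y: "y \<in> insert x X" and yv: "sum v (up y) \<le> min \<epsilon>1 \<epsilon>2" and z: "z \<in> up y" for v y z
    proof (cases "y = x")
      case True
      have "sum (s v) (up x) \<le> sum v (up x)"
        using mass_leD[OF regularD(2)[OF s(2) v] upper_up] insert.prems Q by auto
      then show ?thesis using t(4)[OF regularD(1)[OF s(2) v]] yv z True by auto
    next
      case False
      then have "y \<in> X" "y \<in> C" using y insert.prems Q by auto
      have sv: "s v \<in> cone Q B" by (rule regularD[OF s(2) v])
      then have tsv: "t (s v) \<in> cone Q B" by (rule regularD[OF t(2)])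
      \<comment> \<open>\<open>t\<close> only lowers the masses of upper sets, so what
        \<open>s\<close> has emptied stays empty.\<close>
      have "sum (t (s v)) (up y) \<le> sum (s v) (up y)"
        by (rule mass_leD[OF regularD(2)[OF t(2) sv] upper_up[OF \<open>y \<in> C\<close>]])
      also have "sum (s v) (up y) = 0"
        using s(4)[OF v \<open>y \<in> X\<close>] yv by (intro sum.neutral) auto
      finally have "sum (t (s v)) (up y) = 0" using cone_sum_nonneg[OF tsv up_subset[of y]] by simp
      then show ?thesis
        using sum_nonneg_eq_0_iff[of "up y" "t (s v)"] tsv z up_subset[of y] by (auto simp: cone_def)
    qed
    then show ?case
      using reg close s(1) t(1) by (intro exI[of _ "\<lambda>v. t (s v)"] exI[of _ "min \<epsilon>1 \<epsilon>2"]) auto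
  qed
  from this[of Q "\<epsilon> / 2"] psubset.prems(4) obtain s \<epsilon>0 where s: "0 < \<epsilon>0" "regular Q B s" "close Q B (\<epsilon> / 2) s"
      "\<And>v y z. \<lbrakk>v \<in> cone Q B; y \<in> Q; sum v (up y) \<le> \<epsilon>0; z \<in> up y\<rbrakk> \<Longrightarrow> s v z = 0"
    by auto
  \<comment> \<open>Scaling by \<open>1 - \<kappa>\<close> costs at most
    \<open>\<kappa> * B\<close>, which is kept below \<epsilon>/2, and lowers every mass above
    \<open>\<epsilon>0\<close> by at least \<open>\<kappa> * \<epsilon>0\<close>. Adding 1 to
    \<open>B\<close> avoids division by zero.\<close>
  define \<kappa> where "\<kappa> = min (1/2) (\<epsilon> / (2 * (B + 1)))"
  define r where "r v z = (1 - \<kappa>) * s v z" for v z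
  have \<kappa>: "0 < \<kappa>" "\<kappa> \<le> 1/2" "\<kappa> * B \<le> \<epsilon> / 2"
  proof -
    show "0 < \<kappa>" using psubset.prems(3,4) by (auto simp: \<kappa>_def)
    show "\<kappa> \<le> 1/2" unfolding \<kappa>_def by (rule min.cobounded1)
    have "\<kappa> * B \<le> \<epsilon> / (2 * (B + 1)) * (B + 1)"
      using psubset.prems(3,4) by (intro mult_mono) (auto simp: \<kappa>_def)
    also have "\<dots> = \<epsilon> / 2" using psubset.prems(3) by (simp add: field_simps)
    finally show "\<kappa> * B \<le> \<epsilon> / 2" .
  qed
  have sum_r: "sum (r v) U = (1 - \<kappa>) * sum (s v) U" for v U
    by (simp add: r_def sum_distrib_left)
  have r_s: "mass_le P (r v) (s v)" if "v \<in> cone Q B" for v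
    unfolding mass_le_def sum_r
  proof (intro allI impI)
    fix U assume "upper_set P U"
    then have "0 \<le> sum (s v) U" by (intro cone_sum_nonneg[OF regularD(1)[OF s(2) that]] upper_subset)
    then show "(1 - \<kappa>) * sum (s v) U \<le> sum (s v) U" using \<kappa> by (simp add: algebra_simps)
  qed
  obtain c where c: "0 \<le> c"
    "\<And>v w \<delta> U. \<lbrakk>v \<in> cone Q B; w \<in> cone Q B; mass_le P w v;
       \<And>U. upper_set P U \<Longrightarrow> sum v U - sum w U \<le> \<delta>; upper_set P U\<rbrakk> \<Longrightarrow> sum (s v) U - sum (s w) U \<le> c * \<delta>"
    by (rule regular_lipschitz[OF s(2)]) blast
  have "regular Q B r"
  proof (rule regularI[OF _ _ _ c(1)])
    fix v assume v: "v \<in> cone Q B"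
    show "mass_le P (r v) v" by (rule mass_le_trans[OF r_s[OF v] regularD(2)[OF s(2) v]])
    show "r v \<in> cone Q B"
    proof (rule cone_downward[OF regularD(1)[OF s(2) v] _ r_s[OF v] Q(2)])
      show "0 \<le> r v z" if "z \<in> C" for z
        using regularD(1)[OF s(2) v] that \<kappa> by (auto simp: r_def cone_def)
    qed
  next
    fix v w assume v: "v \<in> cone Q B" and w: "w \<in> cone Q B" and wv: "mass_le P w v"
    show "mass_le P (r w) (r v)"
      unfolding mass_le_def sum_r using regular_mono[OF s(2) v w wv] \<kappa>
      by (auto simp: mass_le_def intro!: mult_left_mono)
    fix \<delta> U assume "0 \<le> \<delta>" "\<And>U. upper_set P U \<Longrightarrow> sum v U - sum w U \<le> \<delta>" and U: "upper_set P U"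
    then have "sum (s v) U - sum (s w) U \<le> c * \<delta>" using c(2)[OF v w wv] by blast
    moreover have "(1 - \<kappa>) * (sum (s v) U - sum (s w) U) \<le> 1 * (sum (s v) U - sum (s w) U)"
      using \<kappa> mass_leD[OF regular_mono[OF s(2) v w wv] U] by (intro mult_right_mono) auto
    ultimately show "sum (r v) U - sum (r w) U \<le> c * \<delta>" by (simp add: sum_r algebra_simps)
  qed
  moreover have "close Q B \<epsilon> r"
    unfolding close_def sum_r
  proof (intro ballI allI impI)
    fix v U assume v: "v \<in> cone Q B" and U: "upper_set P U"
    have "\<kappa> * sum (s v) U \<le> \<kappa> * B"
      using cone_sum_le[OF regularD(1)[OF s(2) v] upper_subset[OF U]] \<kappa> by (intro mult_left_mono) auto
    moreover have "sum v U - \<epsilon> / 2 \<le> sum (s v) U" using s(3) v U by (simp add: close_def)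
    ultimately show "sum v U - \<epsilon> \<le> (1 - \<kappa>) * sum (s v) U" using \<kappa>(3) by (simp add: algebra_simps)
  qed
  moreover have "drops Q B (\<kappa> * \<epsilon>0) r"
    unfolding drops_def sum_r
  proof (intro ballI allI impI)
    fix v U assume v: "v \<in> cone Q B" and U: "upper_set P U"
    show "(1 - \<kappa>) * sum (s v) U \<le> max 0 (sum v U - \<kappa> * \<epsilon>0)"
    proof (cases "sum v U \<le> \<epsilon>0")
      case True
      \<comment> \<open>A light upper set contains the up-set of each of its points, so all these
        up-sets are light and have been emptied.\<close>
      have "s v z = 0" if z: "z \<in> U" for z
      proof (cases "z \<in> Q")
        case True
        have "sum v (up z) \<le> sum v U"
          by (rule cone_sum_mono[OF v upper_up_subset[OF U z] upper_subset[OF U]])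
        then show ?thesis
          using s(4)[OF v True _ up_self] \<open>sum v U \<le> \<epsilon>0\<close> z upper_subset[OF U] by auto
      next
        case False
        then show ?thesis using regularD(1)[OF s(2) v] z upper_subset[OF U] by (auto simp: cone_def)
      qed
      then show ?thesis by simp
    next
      case False
      have "(1 - \<kappa>) * sum (s v) U \<le> (1 - \<kappa>) * sum v U"
        using mass_leD[OF regularD(2)[OF s(2) v] U] \<kappa> by (intro mult_left_mono) auto
      moreover have "\<kappa> * \<epsilon>0 \<le> \<kappa> * sum v U" using False \<kappa> by (intro mult_left_mono) auto
      ultimately show ?thesis by (simp add: algebra_simps)
    qed
  qed
  moreover have "0 < \<kappa> * \<epsilon>0" using \<kappa> s(1) by simp
  ultimately show ?case by blast
qed

end


section \<open>From maps on cones to separated Scott-continuous maps\<close>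

context fin_poset
begin

lemma carrier_cone: "v \<in> carrier (valuations P) \<Longrightarrow> v \<in> cone C 1"
  by (simp add: valuations_carrier cone_def)

lemma restrict_sum: "upper_set P U \<Longrightarrow> sum (restrict v C) U = sum v U"
  using upper_subset[of U] by (intro sum.cong) auto

lemma restrict_mass_le [simp]:
  "mass_le P (restrict v C) w \<longleftrightarrow> mass_le P v w" "mass_le P w (restrict v C) \<longleftrightarrow> mass_le P w v"
  by (simp_all add: mass_le_def restrict_sum del: restrict_apply)

lemma restrict_cone_carrier: "v \<in> cone C 1 \<Longrightarrow> restrict v C \<in> carrier (valuations P)"
  by (simp add: valuations_carrier cone_def restrict_sum upper_carrier)

text \<open>Some member of the directed set is uniformly close to the supremum on upper sets, and
  the Lipschitz bound carries this closeness over to the images.\<close>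

lemma regular_scott:
  assumes s: "regular C 1 s"
  shows "scott_continuous (valuations P) (valuations P) (\<lambda>v. restrict (s v) C)"
  unfolding scott_continuous_def
proof (intro conjI allI impI)
  show "(\<lambda>v. restrict (s v) C) \<in> carrier (valuations P) \<rightarrow> carrier (valuations P)"
    using restrict_cone_carrier regularD(1)[OF s] carrier_cone by blast
  show "isotone (valuations P) (valuations P) (\<lambda>v. restrict (s v) C)"
    by (rule poset_isotoneI[OF valuations_po valuations_po])
      (use regular_mono[OF s] carrier_cone in simp)
  fix X q
  assume X: "X \<subseteq> carrier (valuations P)" "directed (le (valuations P)) X" "is_lub (valuations P) q X"
  obtain c where c: "0 \<le> c"
    "\<And>v w \<delta> U. \<lbrakk>v \<in> cone C 1; w \<in> cone C 1; mass_le P w v;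
       \<And>U. upper_set P U \<Longrightarrow> sum v U - sum w U \<le> \<delta>; upper_set P U\<rbrakk> \<Longrightarrow> sum (s v) U - sum (s w) U \<le> c * \<delta>"
    by (rule regular_lipschitz[OF s]) blast
  have qC: "q \<in> cone C 1" by (rule carrier_cone[OF is_lub_carrier[OF X(3)]])
  have XC: "v \<in> cone C 1" if "v \<in> X" for v using X(1) that carrier_cone by blast
  have Xq: "mass_le P v q" if "v \<in> X" for v using is_lub_upper[OF X(3) that X(1)] by simp
  show "is_lub (valuations P) (restrict (s q) C) ((\<lambda>v. restrict (s v) C) ` X)"
  proof (rule is_lubI)
    fix u assume u: "u \<in> carrier (valuations P)"
      "\<And>x. x \<in> (\<lambda>v. restrict (s v) C) ` X \<Longrightarrow> le (valuations P) x u"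
    have "sum (s q) U \<le> sum u U" if U: "upper_set P U" for U
    proof (rule field_le_epsilon)
      fix e :: real assume e: "0 < e"
      have "0 < e / (c + 1)" using e c by simp
      then obtain v where v: "v \<in> X" "\<And>U. upper_set P U \<Longrightarrow> sum q U - e / (c + 1) < sum v U"
        using valuations_lub_approx[OF X(1) _ X(3)] X(2) by auto
      have "sum q U - sum v U \<le> e / (c + 1)" if "upper_set P U" for U
        using v(2)[OF that] by linarith
      then have "sum (s q) U - sum (s v) U \<le> c * (e / (c + 1))"
        by (intro c(2) qC XC Xq v(1) U)
      also have "\<dots> \<le> e" using c e by (simp add: field_simps)
      finally have "sum (s q) U \<le> sum (s v) U + e" by simp
      moreover have "sum (s v) U \<le> sum u U" using u(2)[of "restrict (s v) C"] v(1) U mass_leD by auto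
      ultimately show "sum (s q) U \<le> sum u U + e" by linarith
    qed
    then show "le (valuations P) (restrict (s q) C) u"
      unfolding valuations_le restrict_mass_le by (simp add: mass_le_def)
  qed (use restrict_cone_carrier regularD(1)[OF s] regular_mono[OF s] qC XC Xq in auto)
qed

text \<open>Rounding all point masses down to multiples of \<open>1 / N\<close> takes at most
  \<open>card C / N\<close>, hence at most \<epsilon>, from each upper set, so the rounded function
  fits between the image and \<open>v\<close>.\<close>

lemma drops_separated:
  assumes s: "drops C 1 \<epsilon> s" "0 < \<epsilon>"
  shows "finitely_separated (valuations P) (\<lambda>v. restrict (s v) C)"
proof -
  obtain N where N: "0 < N" "real (card C) / \<epsilon> < real N"
    using reals_Archimedean2[of "max 0 (real (card C) / \<epsilon>)"] by (metis max_less_iff_conj of_nat_0_less_iff)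
  define grid where "grid = (\<lambda>f. restrict (\<lambda>x. real (f x) / real N) C) ` (C \<rightarrow>\<^sub>E {..N})"
  have "finite grid" unfolding grid_def using fin by (intro finite_imageI finite_PiE) auto
  moreover have "\<exists>m\<in>grid \<inter> carrier (valuations P). mass_le P (s v) m \<and> mass_le P m v"
    if v: "v \<in> carrier (valuations P)" for v
  proof -
    define f where "f = restrict (\<lambda>x. nat \<lfloor>v x * real N\<rfloor>) C"
    define m where "m = restrict (\<lambda>x. real (f x) / real N) C"
    have v01: "0 \<le> v x" "v x \<le> 1" if "x \<in> C" for x
    proof -
      show "0 \<le> v x" using v that by (simp add: valuations_carrier)
      have "v x \<le> sum v C" using v that fin by (intro member_le_sum) (auto simp: valuations_carrier)
      then show "v x \<le> 1" using v by (simp add: valuations_carrier)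
    qed
    have f: "real (f x) \<le> v x * real N" "v x * real N < real (f x) + 1" if "x \<in> C" for x
      using v01(1)[OF that] that by (simp_all add: f_def)
    have m: "0 \<le> m x" "m x \<le> v x" "v x \<le> m x + 1 / real N" if "x \<in> C" for x
      using f[OF that] that N by (auto simp: m_def field_simps)
    have "f x \<le> N" if "x \<in> C" for x
    proof -
      have "v x * real N \<le> 1 * real N" using v01[OF that] by (intro mult_right_mono) auto
      then show ?thesis using f(1)[OF that] by linarith
    qed
    then have "m \<in> grid" unfolding grid_def m_def
      by (intro imageI) (auto simp: f_def)
    moreover have mv: "mass_le P m v"
      unfolding mass_le_def using m(2) upper_subset by (blast intro: sum_mono)
    moreover have "m \<in> carrier (valuations P)"
      using m(1) mass_leD[OF mv upper_carrier] v by (simp add: valuations_carrier m_def)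
    moreover have "mass_le P (s v) m"
      unfolding mass_le_def
    proof (intro allI impI)
      fix U assume U: "upper_set P U"
      have UC: "U \<subseteq> C" by (rule upper_subset[OF U])
      have "sum v U \<le> (\<Sum>x\<in>U. m x + 1 / real N)" using m(3) UC by (intro sum_mono) auto
      also have "\<dots> = sum m U + real (card U) / real N" by (simp add: sum.distrib)
      also have "real (card U) / real N \<le> \<epsilon>"
      proof -
        have "real (card U) \<le> real (card C)" using card_mono[OF fin UC] by simp
        also have "\<dots> \<le> \<epsilon> * real N" using N s(2) by (simp add: field_simps)
        finally show ?thesis using N by (simp add: field_simps)
      qed
      finally have "sum v U - \<epsilon> \<le> sum m U" by simp
      moreover have "0 \<le> sum m U" using m(1) UC by (intro sum_nonneg) auto
      moreover have "sum (s v) U \<le> max 0 (sum v U - \<epsilon>)"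
        using s(1) carrier_cone[OF v] U by (simp add: drops_def)
      ultimately show "sum (s v) U \<le> sum m U" by linarith
    qed
    ultimately show ?thesis by blast
  qed
  ultimately show ?thesis
    unfolding finitely_separated_def
    by (intro exI[of _ "grid \<inter> carrier (valuations P)"]) auto
qed

end

section \<open>Finite-valuation approximable dcpos are FS-domains\<close>

text \<open>The limit is a parameter because two kinds of sequences occur: one rising to the
  identity, and for each of its members another one rising to that member.\<close>

definition ascending :: "'a gorder \<Rightarrow> (nat \<Rightarrow> 'a \<Rightarrow> 'a) \<Rightarrow> ('a \<Rightarrow> 'a) \<Rightarrow> bool" where
  "ascending D f g \<longleftrightarrow> scott_continuous D D g \<and> (\<forall>k. scott_continuous D D (f k)) \<and>
     (\<forall>k. pointwise_le D (f k) (f (Suc k))) \<and> (\<forall>x\<in>carrier D. is_lub D (g x) (range (\<lambda>k. f k x)))"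

context fin_poset
begin

text \<open>Each map is chosen closer to the identity than the amount by which its predecessor
  drops, which makes the sequence ascend; the additional bound \<open>1 / Suc k\<close> makes its
  supremum the identity.\<close>

lemma exists_separated_ascending:
  "\<exists>s. ascending (valuations P) s id \<and> (\<forall>k. finitely_separated (valuations P) (s k))"
proof -
  let ?V = "valuations P"
  define good where "good k r \<longleftrightarrow> (case r of (s, \<epsilon>) \<Rightarrow> 0 < \<epsilon> \<and> regular C 1 s \<and>
      close C 1 (1 / real (Suc k)) s \<and> drops C 1 \<epsilon> s)"
    for k :: nat and r :: "(('p \<Rightarrow> real) \<Rightarrow> 'p \<Rightarrow> real) \<times> real"
  have ex: "\<exists>r'. good k r' \<and> close C 1 \<epsilon> (fst r')" if d: "0 < \<epsilon>" for k \<epsilon>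
  proof -
    obtain s \<epsilon>' where s: "0 < \<epsilon>'" "regular C 1 s" "close C 1 (min \<epsilon> (1 / real (Suc k))) s" "drops C 1 \<epsilon>' s"
      using exists_dropping[of C 1 "min \<epsilon> (1 / real (Suc k))"] d upper_empty by auto
    have "close C 1 \<epsilon> s" "close C 1 (1 / real (Suc k)) s"
      using s(3) unfolding close_def by (smt (verit))+
    then show ?thesis using s by (intro exI[of _ "(s, \<epsilon>')"]) (auto simp: good_def)
  qed
  have "\<exists>r. \<forall>k. good k (r k) \<and> close C 1 (snd (r k)) (fst (r (Suc k)))"
  proof (rule dependent_nat_choice)
    show "\<exists>r. good 0 r" using ex[of 1 0] by auto
    fix r k assume "good k r"
    then have "0 < snd r" by (auto simp: good_def split: prod.splits)
    then show "\<exists>r'. good (Suc k) r' \<and> close C 1 (snd r) (fst r')" by (rule ex)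
  qed
  then obtain r where r: "\<And>k. good k (r k)" "\<And>k. close C 1 (snd (r k)) (fst (r (Suc k)))" by blast
  have g: "0 < snd (r k)" "regular C 1 (fst (r k))" "close C 1 (1 / real (Suc k)) (fst (r k))"
    "drops C 1 (snd (r k)) (fst (r k))" for k
    using r(1)[of k] by (auto simp: good_def split: prod.splits)
  define s where "s k v = restrict (fst (r k) v) C" for k v
  have "pointwise_le ?V (s k) (s (Suc k))" for k
    unfolding pointwise_le_def
  proof
    fix v assume v: "v \<in> carrier ?V"
    have "sum (fst (r k) v) U \<le> sum (fst (r (Suc k)) v) U" if U: "upper_set P U" for U
    proof -
      have "sum (fst (r k) v) U \<le> max 0 (sum v U - snd (r k))"
        using g(4)[of k] carrier_cone[OF v] U by (simp add: drops_def)
      moreover have "sum v U - snd (r k) \<le> sum (fst (r (Suc k)) v) U"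
        using r(2)[of k] carrier_cone[OF v] U by (simp add: close_def)
      moreover have "0 \<le> sum (fst (r (Suc k)) v) U"
        by (rule cone_sum_nonneg[OF regularD(1)[OF g(2) carrier_cone[OF v]] upper_subset[OF U]])
      ultimately show ?thesis by linarith
    qed
    then show "le ?V (s k v) (s (Suc k) v)"
      unfolding s_def valuations_le restrict_mass_le by (simp add: mass_le_def)
  qed
  moreover have scott: "scott_continuous ?V ?V (s k)" for k
    unfolding s_def by (rule regular_scott[OF g(2)])
  moreover have "is_lub ?V (id v) (range (\<lambda>k. s k v))" if v: "v \<in> carrier ?V" for v
  proof (rule is_lubI)
    fix u assume u: "u \<in> carrier ?V" "\<And>x. x \<in> range (\<lambda>k. s k v) \<Longrightarrow> le ?V x u"
    have "sum v U \<le> sum u U" if U: "upper_set P U" for U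
    proof (rule field_le_epsilon)
      fix e :: real assume "0 < e"
      then obtain k where k: "1 / real (Suc k) < e" by (metis nat_approx_posE)
      have "sum v U - 1 / real (Suc k) \<le> sum (fst (r k) v) U"
        using g(3)[of k] carrier_cone[OF v] U by (simp add: close_def)
      moreover have "sum (fst (r k) v) U \<le> sum u U" using u(2)[of "s k v"] U mass_leD[of P "fst (r k) v" u U] by (simp add: s_def)
      ultimately show "sum v U \<le> sum u U + e" using k by linarith
    qed
    then show "le ?V (id v) u" by (simp add: mass_le_def)
  qed (use v scott_carrier[OF scott v] regularD(2)[OF g(2) carrier_cone[OF v]] in \<open>auto simp: s_def\<close>)
  moreover have "finitely_separated ?V (s k)" for k
    unfolding s_def by (rule drops_separated[OF g(4,1)])
  ultimately show ?thesis
    using scott_id[OF valuations_po] by (intro exI[of _ s]) (auto simp: ascending_def)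
qed

end

section \<open>Separated maps, the way-below relation and bases\<close>

lemma separated_le:
  assumes "partial_order D" "finitely_separated D f" "x \<in> carrier D" "f x \<in> carrier D"
  shows "le D (f x) x"
proof -
  obtain m where "m \<in> carrier D" "le D (f x) m" "le D m x"
    using assms(2,3) unfolding finitely_separated_def by blast
  then show ?thesis using po_trans[OF assms(1)] assms by blast
qed

text \<open>Pigeonhole: as \<open>M\<close> is finite, a single \<open>m\<close> separates cofinally
  many \<open>e\<close> in \<open>E\<close>. From \<open>f e\<close> below \<open>m\<close>
  cofinally it follows that \<open>f s\<close> is below \<open>m\<close>, and \<open>m\<close> is
  below some \<open>e\<close>.\<close>

lemma separated_way_below:
  assumes po: "partial_order D" and f: "scott_continuous D D f" "finitely_separated D f" and x: "x \<in> carrier D"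
  shows "way_below D (f x) x"
  unfolding way_below_def
proof (intro allI impI)
  fix E s assume E: "E \<subseteq> carrier D" "directed (le D) E" "is_lub D s E" "le D x s"
  obtain M where M: "finite M" "M \<subseteq> carrier D" "\<And>x. x \<in> carrier D \<Longrightarrow> \<exists>m\<in>M. le D (f x) m \<and> le D m x"
    using f(2) unfolding finitely_separated_def by blast
  have "\<exists>m\<in>M. \<forall>e0\<in>E. \<exists>e\<in>E. le D e0 e \<and> le D (f e) m \<and> le D m e"
  proof (rule ccontr)
    assume "\<not> ?thesis"
    then have "\<exists>e0\<in>E. \<forall>e\<in>E. le D e0 e \<longrightarrow> \<not> (le D (f e) m \<and> le D m e)" if "m \<in> M" for m
      using that by blast
    then have "\<exists>e\<in>E. \<forall>m\<in>M. \<not> (le D (f e) m \<and> le D m e)"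
      by (rule directed_choose[OF po E(2,1) M(1)])
    then show False using M(3) E(1) by blast
  qed
  then obtain m where m: "m \<in> M" "\<And>e0. e0 \<in> E \<Longrightarrow> \<exists>e\<in>E. le D e0 e \<and> le D (f e) m \<and> le D m e" by blast
  have mD: "m \<in> carrier D" using m(1) M(2) by blast
  have sD: "s \<in> carrier D" by (rule is_lub_carrier[OF E(3)])
  have "le D (f s) m"
  proof (rule is_lub_least[OF scott_lub[OF f(1) E(1,2,3)] mD])
    fix y assume "y \<in> f ` E"
    then obtain e0 where e0: "e0 \<in> E" "y = f e0" by blast
    obtain e where e: "e \<in> E" "le D e0 e" "le D (f e) m" using m(2)[OF e0(1)] by blast
    have "e0 \<in> carrier D" "e \<in> carrier D" using e0 e E(1) by auto
    then show "le D y m"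
      using po_trans[OF po scott_mono[OF f(1) _ _ e(2)] e(3)] scott_carrier[OF f(1)] mD e0(2) by simp
  qed
  then have fxm: "le D (f x) m"
    using po_trans[OF po scott_mono[OF f(1) x sD E(4)]] scott_carrier[OF f(1)] x sD mD by blast
  obtain e0 where "e0 \<in> E" using E(2) by (auto simp: directed_def)
  then obtain e where e: "e \<in> E" "le D m e" using m(2) by blast
  then have "le D (f x) e"
    using po_trans[OF po fxm e(2)] scott_carrier[OF f(1) x] mD E(1) by blast
  then show "\<exists>e\<in>E. le D (f x) e" using e(1) by blast
qed

text \<open>The basis consists of the points \<open>f m\<close> with \<open>m\<close> a separator of
  \<open>f\<close>. If \<open>m\<close> lies between \<open>f x\<close> and \<open>x\<close>, then
  \<open>f m\<close> is way below \<open>x\<close> and above \<open>f (f x)\<close>.\<close>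

lemma separated_family_based:
  assumes po: "partial_order D" and F: "countable F" "directed (pointwise_le D) F"
    and sc: "\<And>f. f \<in> F \<Longrightarrow> scott_continuous D D f" "\<And>f. f \<in> F \<Longrightarrow> finitely_separated D f"
    and sup: "pointwise_sup_id D F"
  shows "countably_based D"
proof -
  obtain M where M: "\<And>f. f \<in> F \<Longrightarrow> finite (M f) \<and> M f \<subseteq> carrier D \<and>
      (\<forall>x\<in>carrier D. \<exists>m\<in>M f. le D (f x) m \<and> le D m x)"
    using sc(2) unfolding finitely_separated_def by metis
  define B where "B = (\<Union>f\<in>F. f ` M f)"
  have BD: "B \<subseteq> carrier D" unfolding B_def using M scott_carrier[OF sc(1)] by blast
  have cB: "countable B" unfolding B_def using F(1) M by (auto intro!: countable_UN intro: countable_finite)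
  have near: "\<exists>b\<in>B. way_below D b x \<and> le D (f (f x)) b" if f: "f \<in> F" and x: "x \<in> carrier D" for f x
  proof -
    obtain m where m: "m \<in> M f" "le D (f x) m" "le D m x" using M[OF f] x by blast
    have mD: "m \<in> carrier D" using m M[OF f] by blast
    have "way_below D (f m) x"
      by (rule way_below_trans_le[OF po separated_way_below[OF po sc(1)[OF f] sc(2)[OF f] mD] m(3) mD x])
    moreover have "le D (f (f x)) (f m)"
      by (rule scott_mono[OF sc(1)[OF f] scott_carrier[OF sc(1)[OF f] x] mD m(2)])
    ultimately show ?thesis using f m(1) unfolding B_def by blast
  qed
  have mono2: "le D (f (f x)) (g (g x))"
    if fg: "f \<in> F" "g \<in> F" "pointwise_le D f g" and x: "x \<in> carrier D" for f g x
  proof -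
    note fc = scott_carrier[OF sc(1)[OF fg(1)]] and gc = scott_carrier[OF sc(1)[OF fg(2)]]
    have "le D (f x) (g x)" using fg(3) x by (simp add: pointwise_le_def)
    then have "le D (f (f x)) (f (g x))" by (rule scott_mono[OF sc(1)[OF fg(1)] fc[OF x] gc[OF x]])
    moreover have "le D (f (g x)) (g (g x))"
      using fg(3) gc[OF x] by (simp add: pointwise_le_def)
    ultimately show ?thesis by (rule po_trans[OF po]) (intro fc gc x)+
  qed
  have dir2: "directed (le D) ((\<lambda>f. f (f x)) ` F)" if x: "x \<in> carrier D" for x
    unfolding directed_def
  proof (intro conjI ballI)
    show "(\<lambda>f. f (f x)) ` F \<noteq> {}" using F(2) by (auto simp: directed_def)
    fix a b assume "a \<in> (\<lambda>f. f (f x)) ` F" "b \<in> (\<lambda>f. f (f x)) ` F"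
    then obtain f g where fg: "f \<in> F" "g \<in> F" "a = f (f x)" "b = g (g x)" by blast
    obtain h where h: "h \<in> F" "pointwise_le D f h" "pointwise_le D g h"
      using directedD[OF F(2) fg(1,2)] by blast
    then show "\<exists>z\<in>(\<lambda>f. f (f x)) ` F. le D a z \<and> le D b z"
      using mono2[OF _ _ _ x] fg by blast
  qed
  have car2: "(\<lambda>f. f (f x)) ` F \<subseteq> carrier D" if "x \<in> carrier D" for x
    using scott_carrier[OF sc(1)] that by blast
  \<comment> \<open>Basis elements are only known to lie above the values of the squares, so the
    squares too must have supremum \<open>x\<close>.\<close>
  have lub2: "is_lub D x ((\<lambda>f. f (f x)) ` F)" if x: "x \<in> carrier D" for x
  proof (rule is_lubI[OF x _ car2[OF x]])
    fix y assume "y \<in> (\<lambda>f. f (f x)) ` F"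
    then obtain f where f: "f \<in> F" "y = f (f x)" by blast
    have fx: "f x \<in> carrier D" by (rule scott_carrier[OF sc(1)[OF f(1)] x])
    show "le D y x"
      using po_trans[OF po separated_le[OF po sc(2)[OF f(1)] fx] separated_le[OF po sc(2)[OF f(1)] x fx]]
        scott_carrier[OF sc(1)[OF f(1)] fx] fx x f(2) by blast
  next
    fix u assume u: "u \<in> carrier D" "\<And>y. y \<in> (\<lambda>f. f (f x)) ` F \<Longrightarrow> le D y u"
    show "le D x u"
    proof (rule is_lub_least[OF sup[unfolded pointwise_sup_id_def, rule_format, OF x] u(1)])
      fix y assume "y \<in> (\<lambda>f. f x) ` F"
      then obtain f where f: "f \<in> F" "y = f x" by blast
      have fx: "f x \<in> carrier D" by (rule scott_carrier[OF sc(1)[OF f(1)] x])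
      have lubx: "is_lub D x ((\<lambda>g. g x) ` F)" using sup x by (simp add: pointwise_sup_id_def)
      have dirx: "directed (le D) ((\<lambda>g. g x) ` F)"
        using F(2) x unfolding directed_def pointwise_le_def by blast
      have carx: "(\<lambda>g. g x) ` F \<subseteq> carrier D" using scott_carrier[OF sc(1)] x by blast
      have "le D (f x) u"
      proof (rule is_lub_least[OF scott_lub[OF sc(1)[OF f(1)] carx dirx lubx] u(1)])
        fix z assume "z \<in> f ` (\<lambda>g. g x) ` F"
        then obtain g where g: "g \<in> F" "z = f (g x)" by blast
        obtain h where h: "h \<in> F" "pointwise_le D f h" "pointwise_le D g h"
          using directedD[OF F(2) f(1) g(1)] by blast
        have gx: "g x \<in> carrier D" and hx: "h x \<in> carrier D"
          using scott_carrier[OF sc(1)] g(1) h(1) x by auto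
        have fgx: "f (g x) \<in> carrier D" "h (g x) \<in> carrier D" "h (h x) \<in> carrier D"
          by (intro scott_carrier[OF sc(1)[OF f(1)] gx] scott_carrier[OF sc(1)[OF h(1)] gx]
              scott_carrier[OF sc(1)[OF h(1)] hx])+
        have "le D (f (g x)) (h (g x))" using h(2) gx by (simp add: pointwise_le_def)
        moreover have "le D (h (g x)) (h (h x))"
          using scott_mono[OF sc(1)[OF h(1)] gx hx] h(3) x by (simp add: pointwise_le_def)
        ultimately have "le D (f (g x)) (h (h x))" by (rule po_trans[OF po]) (rule fgx)+
        moreover have "le D (h (h x)) u" using u(2) h(1) by blast
        ultimately show "le D z u" unfolding g(2) by (rule po_trans[OF po]) (rule fgx u(1))+
      qed
      then show "le D y u" using f by simp
    qed
  qed
  have "directed (le D) {b \<in> B. way_below D b x} \<and> is_lub D x {b \<in> B. way_below D b x}"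
    if x: "x \<in> carrier D" for x
  proof
    show "directed (le D) {b \<in> B. way_below D b x}"
      unfolding directed_def
    proof (intro conjI ballI)
      show "{b \<in> B. way_below D b x} \<noteq> {}" using near[OF _ x] F(2) by (auto simp: directed_def)
      fix a b assume ab: "a \<in> {b \<in> B. way_below D b x}" "b \<in> {b \<in> B. way_below D b x}"
      have *: "\<exists>y\<in>(\<lambda>f. f (f x)) ` F. le D c y" if "way_below D c x" for c
        using that[unfolded way_below_def, rule_format, OF car2[OF x] dir2[OF x] lub2[OF x] po_refl[OF po x]] .
      obtain y1 y2 where y: "y1 \<in> (\<lambda>f. f (f x)) ` F" "le D a y1" "y2 \<in> (\<lambda>f. f (f x)) ` F" "le D b y2"
        using *[of a] *[of b] ab by blast
      obtain f where f: "f \<in> F" "le D y1 (f (f x))" "le D y2 (f (f x))"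
        using directedD[OF dir2[OF x] y(1,3)] by blast
      obtain c where c: "c \<in> B" "way_below D c x" "le D (f (f x)) c" using near[OF f(1) x] by blast
      have "f (f x) \<in> carrier D" "y1 \<in> carrier D" "y2 \<in> carrier D" "c \<in> carrier D" "a \<in> carrier D" "b \<in> carrier D"
        using car2[OF x] f(1) y c BD ab by blast+
      note car = this
      have "le D a (f (f x))" by (rule po_trans[OF po y(2) f(2)]) (rule car)+
      then have "le D a c" by (rule po_trans[OF po _ c(3)]) (rule car)+
      moreover have "le D b (f (f x))" by (rule po_trans[OF po y(4) f(3)]) (rule car)+
      then have "le D b c" by (rule po_trans[OF po _ c(3)]) (rule car)+
      ultimately have "le D a c" "le D b c" by auto
      then show "\<exists>z\<in>{b \<in> B. way_below D b x}. le D a z \<and> le D b z" using c by blast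
    qed
    show "is_lub D x {b \<in> B. way_below D b x}"
    proof (rule is_lubI[OF x])
      fix u assume u: "u \<in> carrier D" "\<And>y. y \<in> {b \<in> B. way_below D b x} \<Longrightarrow> le D y u"
      show "le D x u"
      proof (rule is_lub_least[OF lub2[OF x] u(1)])
        fix y assume "y \<in> (\<lambda>f. f (f x)) ` F"
        then obtain f where f: "f \<in> F" "y = f (f x)" by blast
        then obtain b where b: "b \<in> B" "way_below D b x" "le D y b" using near[OF f(1) x] by blast
        have "le D b u" using u(2) b by blast
        then show "le D y u"
          by (rule po_trans[OF po b(3)]) (use u(1) b(1) BD car2[OF x] f in auto)
      qed
    qed (use way_below_le[OF po _ x] BD in auto)
  qed
  then show ?thesis using cB BD unfolding countably_based_def is_basis_def by blast
qed


section \<open>Ascending sequences and their iterates\<close>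

lemma ascending_mono:
  assumes po: "partial_order D" and f: "ascending D f g" and x: "x \<in> carrier D" and "i \<le> j"
  shows "le D (f i x) (f j x)"
  using \<open>i \<le> j\<close>
proof (induction j rule: dec_induct)
  case base
  then show ?case using f x by (intro po_refl[OF po]) (auto simp: ascending_def intro: scott_carrier)
next
  case (step j)
  have c: "f k x \<in> carrier D" for k using f x scott_carrier[of D D "f k"] by (simp add: ascending_def)
  have "le D (f j x) (f (Suc j) x)" using f x by (simp add: ascending_def pointwise_le_def)
  then show ?case using po_trans[OF po step.IH _ c c c] by blast
qed

lemma ascending_carrier:
  assumes "ascending D f g" "x \<in> carrier D"
  shows "f k x \<in> carrier D" "g x \<in> carrier D" "range (\<lambda>k. f k x) \<subseteq> carrier D"
proof -
  show c: "f k x \<in> carrier D" for k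
    using assms scott_carrier[of D D "f k"] by (simp add: ascending_def)
  show "g x \<in> carrier D" using assms scott_carrier[of D D g] by (simp add: ascending_def)
  show "range (\<lambda>k. f k x) \<subseteq> carrier D" using c by blast
qed

lemma ascending_directed:
  assumes po: "partial_order D" and f: "ascending D f g" and x: "x \<in> carrier D"
  shows "directed (le D) (range (\<lambda>k. f k x))"
  unfolding directed_def
proof (intro conjI ballI)
  fix a b assume "a \<in> range (\<lambda>k. f k x)" "b \<in> range (\<lambda>k. f k x)"
  then obtain i j where "a = f i x" "b = f j x" by blast
  then show "\<exists>z\<in>range (\<lambda>k. f k x). le D a z \<and> le D b z"
    using ascending_mono[OF po f x, of i "max i j"] ascending_mono[OF po f x, of j "max i j"] by auto
qed simp

lemma ascending_le:
  "\<lbrakk>ascending D f g; x \<in> carrier D\<rbrakk> \<Longrightarrow> le D (f k x) (g x)"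
  using is_lub_upper[of D "g x" "range (\<lambda>k. f k x)"] ascending_carrier(3)[of D f g x]
  by (auto simp: ascending_def)

text \<open>Every mixed term \<open>f i (f' j x)\<close> lies below a diagonal term, so the diagonal
  has the iterated supremum.\<close>

lemma ascending_comp:
  assumes po: "partial_order D" and f: "ascending D f g" and f': "ascending D f' g'"
  shows "ascending D (\<lambda>k. f k \<circ> f' k) (g \<circ> g')"
  unfolding ascending_def
proof (intro conjI allI ballI)
  show "scott_continuous D D (g \<circ> g')" "scott_continuous D D (f k \<circ> f' k)" for k
    using f f' by (auto simp: ascending_def intro: scott_comp)
  have step: "le D (f i (f' j x)) (f k (f' k x))" if x: "x \<in> carrier D" and "i \<le> k" "j \<le> k" for i j k x
  proof -
    have c: "f' l x \<in> carrier D" "f m (f' l x) \<in> carrier D" for l m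
      using ascending_carrier(1)[OF f'] ascending_carrier(1)[OF f] x by auto
    have "le D (f i (f' j x)) (f k (f' j x))" by (rule ascending_mono[OF po f c(1) that(2)])
    moreover have "le D (f k (f' j x)) (f k (f' k x))"
      using f ascending_mono[OF po f' x that(3)] c scott_mono[of D D "f k"] by (auto simp: ascending_def)
    ultimately show ?thesis by (rule po_trans[OF po]) (rule c)+
  qed
  show "pointwise_le D (f k \<circ> f' k) (f (Suc k) \<circ> f' (Suc k))" for k
    using step by (auto simp: pointwise_le_def)
  fix x assume x: "x \<in> carrier D"
  have g'x: "g' x \<in> carrier D" by (rule ascending_carrier[OF f' x])
  show "is_lub D ((g \<circ> g') x) (range (\<lambda>k. (f k \<circ> f' k) x))"
  proof (rule is_lubI)
    show "(g \<circ> g') x \<in> carrier D" using ascending_carrier(2)[OF f g'x] by simp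
    show "range (\<lambda>k. (f k \<circ> f' k) x) \<subseteq> carrier D"
      using ascending_carrier(1)[OF f] ascending_carrier(1)[OF f' x] by auto
    fix y assume "y \<in> range (\<lambda>k. (f k \<circ> f' k) x)"
    then obtain k where k: "y = f k (f' k x)" by auto
    have f'x: "f' k x \<in> carrier D" by (rule ascending_carrier[OF f' x])
    have "le D (f k (f' k x)) (f k (g' x))"
      using f scott_mono[of D D "f k", OF _ f'x g'x ascending_le[OF f' x]] by (auto simp: ascending_def)
    then show "le D y ((g \<circ> g') x)"
      using po_trans[OF po _ ascending_le[OF f g'x]] k ascending_carrier[OF f f'x] ascending_carrier[OF f g'x] by simp
  next
    fix u assume u: "u \<in> carrier D" "\<And>y. y \<in> range (\<lambda>k. (f k \<circ> f' k) x) \<Longrightarrow> le D y u"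
    have "le D (f j (g' x)) u" for j
    proof (rule is_lub_least[OF scott_lub[of D D "f j" "range (\<lambda>k. f' k x)"] u(1)])
      show "is_lub D (g' x) (range (\<lambda>k. f' k x))" "scott_continuous D D (f j)"
        using f f' x by (auto simp: ascending_def)
      fix y assume "y \<in> f j ` range (\<lambda>k. f' k x)"
      then obtain k where k: "y = f j (f' k x)" by blast
      have "le D y (f (max j k) (f' (max j k) x))" unfolding k by (rule step[OF x]) auto
      moreover have "le D (f (max j k) (f' (max j k) x)) u" by (rule u(2)) auto
      ultimately show "le D y u"
        by (rule po_trans[OF po])
          (use u(1) k ascending_carrier(1)[OF f] ascending_carrier(1)[OF f' x] in auto)
    qed (use ascending_carrier(3)[OF f' x] ascending_directed[OF po f' x] in auto)
    then show "le D ((g \<circ> g') x) u"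
      using f g'x u(1) by (auto simp: ascending_def intro: is_lub_least)
  qed
qed

lemma ascending_way_below:
  assumes po: "partial_order D" and f: "ascending D f g" and x: "x \<in> carrier D"
    and y: "way_below D y z" "le D z (g x)" "y \<in> carrier D"
  shows "\<forall>\<^sub>F k in sequentially. le D y (f k x)"
proof -
  obtain k where k: "le D y (f k x)"
    using y(1)[unfolded way_below_def, rule_format, OF ascending_carrier(3)[OF f x] ascending_directed[OF po f x] _ y(2)]
      f x by (auto simp: ascending_def)
  have "le D y (f j x)" if "k \<le> j" for j
    using po_trans[OF po k ascending_mono[OF po f x that] y(3)] ascending_carrier(1)[OF f x] by blast
  then show ?thesis by (auto simp: eventually_sequentially)
qed

text \<open>Each of the three applications pays for one move. The first replaces \<open>x\<close> by
  a point \<open>y\<close> of the finite set \<open>M\<close>. Then \<open>f y\<close> is way below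
  \<open>y\<close>, hence below \<open>a n y\<close> for large \<open>n\<close>; and
  \<open>f (f y)\<close> is way below \<open>f y\<close>, hence below \<open>A n k y\<close> for
  large \<open>k\<close>. Finiteness of \<open>M\<close> makes \<open>n\<close> and \<open>k\<close>
  independent of \<open>x\<close>.\<close>

lemma separated_cube_below:
  assumes po: "partial_order D" and f: "scott_continuous D D f" "finitely_separated D f"
    and a: "ascending D a id" and A: "\<And>n. ascending D (A n) (a n)"
  shows "\<forall>\<^sub>F n in sequentially. \<forall>\<^sub>F k in sequentially. pointwise_le D (f \<circ> f \<circ> f) (A n k)"
proof -
  obtain M where M: "finite M" "M \<subseteq> carrier D" "\<And>x. x \<in> carrier D \<Longrightarrow> \<exists>m\<in>M. le D (f x) m \<and> le D m x"
    using f(2) unfolding finitely_separated_def by blast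
  have fc: "f x \<in> carrier D" if "x \<in> carrier D" for x using scott_carrier[OF f(1) that] .
  have "\<forall>\<^sub>F n in sequentially. \<forall>y\<in>M. le D (f y) (a n y)"
  proof (rule eventually_ball_finite[OF M(1)], rule ballI)
    fix y assume "y \<in> M"
    then have y: "y \<in> carrier D" using M(2) by blast
    show "\<forall>\<^sub>F n in sequentially. le D (f y) (a n y)"
      by (rule ascending_way_below[OF po a y separated_way_below[OF po f y]]) (use y fc po_refl[OF po] in auto)
  qed
  then show ?thesis
  proof (rule eventually_mono)
    fix n assume n: "\<forall>y\<in>M. le D (f y) (a n y)"
    have "\<forall>\<^sub>F k in sequentially. \<forall>y\<in>M. le D (f (f y)) (A n k y)"
    proof (rule eventually_ball_finite[OF M(1)], rule ballI)
      fix y assume yM: "y \<in> M"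
      then have y: "y \<in> carrier D" using M(2) by blast
      show "\<forall>\<^sub>F k in sequentially. le D (f (f y)) (A n k y)"
        by (rule ascending_way_below[OF po A y separated_way_below[OF po f fc[OF y]]]) (use y yM n fc in auto)
    qed
    then show "\<forall>\<^sub>F k in sequentially. pointwise_le D (f \<circ> f \<circ> f) (A n k)"
    proof (rule eventually_mono)
      fix k assume k: "\<forall>y\<in>M. le D (f (f y)) (A n k y)"
      show "pointwise_le D (f \<circ> f \<circ> f) (A n k)"
        unfolding pointwise_le_def
      proof
        fix x assume x: "x \<in> carrier D"
        obtain y where y: "y \<in> M" "le D (f x) y" "le D y x" using M(3)[OF x] by blast
        have yD: "y \<in> carrier D" using y M(2) by blast
        have "le D (f (f (f x))) (f (f y))"
          by (intro scott_mono[OF f(1)] fc x yD y)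
        moreover have "le D (A n k y) (A n k x)"
          using A[of n] scott_mono[of D D "A n k", OF _ yD x y(3)] by (auto simp: ascending_def)
        moreover have "le D (f (f y)) (A n k y)" using k y(1) by blast
        moreover have c: "f (f (f x)) \<in> carrier D" "f (f y) \<in> carrier D"
          "A n k y \<in> carrier D" "A n k x \<in> carrier D"
          using x yD by (simp_all add: fc ascending_carrier(1)[OF A])
        ultimately have "le D (f (f (f x))) (A n k x)"
          using po_trans[OF po _ _ c(2,3,4)] po_trans[OF po _ _ c(1,2,4)] by simp
        then show "le D ((f \<circ> f \<circ> f) x) (A n k x)" by simp
      qed
    qed
  qed
qed

text \<open>The maps \<open>A n k\<close> themselves need not be directed, but their threefold iterates are: they are
  approximated way below by \<open>A n k\<close>.\<close>

lemma separated_cubes: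
  fixes A :: "nat \<Rightarrow> nat \<Rightarrow> 'a \<Rightarrow> 'a"
  assumes D: "dcpo D" and a: "ascending D a id" and A: "\<And>n. ascending D (A n) (a n)"
    and sep: "\<And>n k. finitely_separated D (A n k)"
  shows "fs_domain D" "countably_based D"
proof -
  have po: "partial_order D" by (rule dcpo_po[OF D])
  define cube where "cube f = f \<circ> f \<circ> f" for f :: "'a \<Rightarrow> 'a"
  define F where "F = range (\<lambda>(n, k). cube (A n k))"
  have a3: "ascending D (\<lambda>n. cube (a n)) id"
    using ascending_comp[OF po ascending_comp[OF po a a] a] by (simp add: cube_def)
  have A3: "ascending D (\<lambda>k. cube (A n k)) (cube (a n))" for n
    unfolding cube_def by (rule ascending_comp[OF po ascending_comp[OF po A A] A])
  have sc: "scott_continuous D D (A n k)" for n k using A by (auto simp: ascending_def)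
  have dir: "directed (pointwise_le D) F"
    unfolding directed_def
  proof (intro conjI ballI)
    fix f g assume "f \<in> F" "g \<in> F"
    then obtain n k n' k' where fg: "f = cube (A n k)" "g = cube (A n' k')" by (auto simp: F_def)
    have "\<forall>\<^sub>F m in sequentially. (\<forall>\<^sub>F j in sequentially. pointwise_le D f (cube (A m j))) \<and>
        (\<forall>\<^sub>F j in sequentially. pointwise_le D g (cube (A m j)))"
      unfolding fg using separated_cube_below[OF po sc sep a3 A3] by (intro eventually_conj) (auto simp: cube_def)
    then obtain m where "\<forall>\<^sub>F j in sequentially. pointwise_le D f (cube (A m j))"
        "\<forall>\<^sub>F j in sequentially. pointwise_le D g (cube (A m j))"
      using eventually_happens'[OF sequentially_bot] by blast
    then have "\<forall>\<^sub>F j in sequentially. pointwise_le D f (cube (A m j)) \<and> pointwise_le D g (cube (A m j))"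
      by (rule eventually_conj)
    then obtain j where "pointwise_le D f (cube (A m j))" "pointwise_le D g (cube (A m j))"
      using eventually_happens'[OF sequentially_bot] by blast
    then show "\<exists>h\<in>F. pointwise_le D f h \<and> pointwise_le D g h" unfolding F_def by auto
  qed (simp add: F_def)
  have scF: "scott_continuous D D f" if "f \<in> F" for f
    using that A3 by (auto simp: F_def ascending_def)
  have sepF: "finitely_separated D f" if fF: "f \<in> F" for f
  proof -
    obtain n k where f: "f = cube (A n k)" using fF by (auto simp: F_def)
    let ?h = "A n k"
    have hc: "?h x \<in> carrier D" if "x \<in> carrier D" for x using scott_carrier[OF sc that] .
    have hle: "le D (?h x) x" if "x \<in> carrier D" for x by (rule separated_le[OF po sep that hc[OF that]])
    obtain M where M: "finite M" "M \<subseteq> carrier D" "\<And>x. x \<in> carrier D \<Longrightarrow> \<exists>m\<in>M. le D (?h x) m \<and> le D m x"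
      using sep[of n k] unfolding finitely_separated_def by blast
    have "\<exists>m\<in>M. le D (f x) m \<and> le D m x" if x: "x \<in> carrier D" for x
    proof -
      have c: "?h x \<in> carrier D" "?h (?h x) \<in> carrier D" "f x \<in> carrier D"
        using x by (simp_all add: hc f cube_def)
      have "le D (f x) (?h (?h x))" using hle[OF c(2)] by (simp add: f cube_def)
      then have fx: "le D (f x) (?h x)" by (rule po_trans[OF po _ hle[OF c(1)]]) (rule c)+
      obtain m where m: "m \<in> M" "le D (?h x) m" "le D m x" using M(3)[OF x] by blast
      have "m \<in> carrier D" using m(1) M(2) by blast
      then have "le D (f x) m" by (intro po_trans[OF po fx m(2)] c)
      then show ?thesis using m by blast
    qed
    then show ?thesis unfolding finitely_separated_def using M(1,2) by blast
  qed
  have sup: "pointwise_sup_id D F"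
    unfolding pointwise_sup_id_def
  proof
    fix x assume x: "x \<in> carrier D"
    show "is_lub D x ((\<lambda>f. f x) ` F)"
    proof (rule is_lubI[OF x])
      show "(\<lambda>f. f x) ` F \<subseteq> carrier D" using scott_carrier[OF scF] x by blast
      show "le D y x" if "y \<in> (\<lambda>f. f x) ` F" for y
        using that separated_le[OF po sepF x] scott_carrier[OF scF x] by auto
      fix u assume u: "u \<in> carrier D" "\<And>y. y \<in> (\<lambda>f. f x) ` F \<Longrightarrow> le D y u"
      have "le D (cube (a n) x) u" for n
      proof (rule is_lub_least[OF _ u(1)])
        show "is_lub D (cube (a n) x) (range (\<lambda>k. cube (A n k) x))"
          using A3[of n] x by (simp add: ascending_def)
        fix y assume "y \<in> range (\<lambda>k. cube (A n k) x)"
        then obtain k where "y = cube (A n k) x" by blast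
        moreover have "cube (A n k) \<in> F" unfolding F_def by (rule range_eqI[of _ _ "(n, k)"]) simp
        ultimately have "y \<in> (\<lambda>f. f x) ` F" by (rule image_eqI)
        then show "le D y u" by (rule u(2))
      qed
      moreover have "is_lub D x (range (\<lambda>n. cube (a n) x))" using a3 x by (simp add: ascending_def)
      ultimately show "le D x u" using is_lub_least[OF _ u(1), of x "range (\<lambda>n. cube (a n) x)"] by blast
    qed
  qed
  show "fs_domain D" unfolding fs_domain_def using D dir scF sepF sup by blast
  have "countable F" unfolding F_def by simp
  then show "countably_based D" using separated_family_based[OF po _ dir scF sepF sup] by blast
qed

lemma fva_fs:
  fixes D :: "'a gorder"
  assumes "fva D"
  shows "fs_domain D" "pointed D" "countably_based D"
proof -
  have D: "dcpo D" using assms by (simp add: fva_def)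
  have po: "partial_order D" by (rule dcpo_po[OF D])
  obtain P :: "nat \<Rightarrow> nat gorder" and p e where
    P: "\<And>n. finite_poset (P n)"
    and p: "\<And>n. scott_continuous D (valuations (P n)) (p n)"
    and e: "\<And>n. scott_continuous (valuations (P n)) D (e n)"
    and inc: "\<And>n. pointwise_le D (e n \<circ> p n) (e (Suc n) \<circ> p (Suc n))"
    and below: "\<And>n. pointwise_le D (e n \<circ> p n) id"
    and sup: "pointwise_sup_id D (range (\<lambda>n. e n \<circ> p n))"
    using assms unfolding fva_def by blast
  have fp: "fin_poset (P n)" for n by unfold_locales (rule P)
  have pc: "p n x \<in> carrier (valuations (P n))" if "x \<in> carrier D" for n x using scott_carrier[OF p that] .
  have ec: "e n v \<in> carrier D" if "v \<in> carrier (valuations (P n))" for n v using scott_carrier[OF e that] .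
  define a where "a n = e n \<circ> p n" for n
  have a: "ascending D a id"
    using sup scott_comp[OF p e] scott_id[OF po] inc
    by (simp add: ascending_def a_def pointwise_sup_id_def image_image)
  obtain s where s: "\<And>n. ascending (valuations (P n)) (s n) id"
      "\<And>n k. finitely_separated (valuations (P n)) (s n k)"
    using fin_poset.exists_separated_ascending[OF fp] by metis
  have vpo: "partial_order (valuations (P n))" for n by (rule fin_poset.valuations_po[OF fp])
  \<comment> \<open>Separated approximations of the identity of \<open>valuations (P n)\<close>,
    conjugated by \<open>p n\<close> and \<open>e n\<close>, rise to \<open>a n\<close> as
    \<open>k\<close> grows because \<open>e n\<close> preserves directed suprema.\<close>
  define A where "A n k = e n \<circ> (s n k \<circ> p n)" for n k
  have A: "ascending D (A n) (a n)" for n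
    unfolding ascending_def
  proof (intro conjI allI ballI)
    show "scott_continuous D D (a n)" using a by (simp add: ascending_def)
    show "scott_continuous D D (A n k)" for k
      unfolding A_def using s(1)[of n] scott_comp[OF scott_comp[OF p] e] by (auto simp: ascending_def)
    show "pointwise_le D (A n k) (A n (Suc k))" for k
      unfolding pointwise_le_def
    proof
      fix x assume "x \<in> carrier D"
      then have px: "p n x \<in> carrier (valuations (P n))" by (rule pc)
      show "le D (A n k x) (A n (Suc k) x)"
        unfolding A_def comp_apply
        by (intro scott_mono[OF e] ascending_carrier(1)[OF s(1) px] ascending_mono[OF vpo s(1) px]) simp
    qed
    fix x assume x: "x \<in> carrier D"
    have "is_lub D (e n (p n x)) (e n ` range (\<lambda>k. s n k (p n x)))"
      by (rule scott_lub[OF e ascending_carrier(3)[OF s(1) pc[OF x]] ascending_directed[OF vpo s(1) pc[OF x]]])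
        (use s(1)[of n] pc[OF x] in \<open>auto simp: ascending_def\<close>)
    then show "is_lub D (a n x) (range (\<lambda>k. A n k x))" by (simp add: a_def A_def image_image)
  qed
  \<comment> \<open>The separators are transported by \<open>e n\<close>: one below
    \<open>p n x\<close> is sent below \<open>e n (p n x)\<close>, hence below
    \<open>x\<close>.\<close>
  have sepA: "finitely_separated D (A n k)" for n k
  proof -
    obtain M where M: "finite M" "M \<subseteq> carrier (valuations (P n))"
        "\<And>v. v \<in> carrier (valuations (P n)) \<Longrightarrow>
          \<exists>m\<in>M. le (valuations (P n)) (s n k v) m \<and> le (valuations (P n)) m v"
      using s(2)[of n k] unfolding finitely_separated_def by blast
    have "\<exists>m\<in>e n ` M. le D (A n k x) m \<and> le D m x" if x: "x \<in> carrier D" for x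
    proof -
      obtain m where m: "m \<in> M" "le (valuations (P n)) (s n k (p n x)) m" "le (valuations (P n)) m (p n x)"
        using M(3)[OF pc[OF x]] by blast
      have mc: "m \<in> carrier (valuations (P n))" using m(1) M(2) by blast
      have "le D (A n k x) (e n m)"
        using scott_mono[OF e ascending_carrier(1)[OF s(1) pc[OF x]] mc m(2)] by (simp add: A_def)
      moreover have "le D (e n m) x"
        using po_trans[OF po scott_mono[OF e mc pc[OF x] m(3)] _ ec[OF mc] ec[OF pc[OF x]] x]
          below[of n] x by (simp add: pointwise_le_def)
      ultimately show ?thesis using m(1) by blast
    qed
    then show ?thesis
      unfolding finitely_separated_def using M(1,2) ec by (intro exI[of _ "e n ` M"]) auto
  qed
  show "fs_domain D" "countably_based D"
    by (rule separated_cubes[OF D a A sepA])+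
  show "pointed D"
  proof -
    define z where "z = restrict (\<lambda>_. 0 :: real) (carrier (P 0))"
    have z: "z \<in> carrier (valuations (P 0))" by (simp add: valuations_carrier z_def)
    have "le D (e 0 z) x" if x: "x \<in> carrier D" for x
    proof -
      have "mass_le (P 0) z (p 0 x)"
        unfolding mass_le_def
      proof (intro allI impI)
        fix U assume U: "upper_set (P 0) U"
        have "sum z U = 0" using U by (intro sum.neutral) (auto simp: z_def upper_set_def)
        then show "sum z U \<le> sum (p 0 x) U"
          using fin_poset.upper_mass_bounds(1)[OF fp pc[OF x] U] by simp
      qed
      then have "le D (e 0 z) (e 0 (p 0 x))" using scott_mono[OF e z pc[OF x]] by simp
      then show ?thesis
        using po_trans[OF po _ _ ec[OF z] ec[OF pc[OF x]] x] below[of 0] x by (simp add: pointwise_le_def)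
    qed
    then show ?thesis unfolding pointed_def least_def using ec[OF z] by blast
  qed
qed


section \<open>Bounded complete domains\<close>

text \<open>The basis elements that are way below \<open>x\<close> in two steps are still directed
  with supremum \<open>x\<close>. Hence \<open>a\<close> lies below one of them, and its
  intermediate element interpolates.\<close>

lemma basis_interpolation:
  assumes po: "partial_order D" and B: "is_basis D B"
    and ax: "a \<in> carrier D" "x \<in> carrier D" "way_below D a x"
  shows "\<exists>b\<in>B. way_below D a b \<and> way_below D b x"
proof -
  have BD: "B \<subseteq> carrier D" using B by (simp add: is_basis_def)
  have dirB: "directed (le D) {b \<in> B. way_below D b y}" and lubB: "is_lub D y {b \<in> B. way_below D b y}"
    if "y \<in> carrier D" for y using B that by (auto simp: is_basis_def)
  define E where "E = {y \<in> B. \<exists>b\<in>B. way_below D y b \<and> way_below D b x}"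
  have ED: "E \<subseteq> carrier D" using BD by (auto simp: E_def)
  have dirE: "directed (le D) E"
    unfolding directed_def
  proof (intro conjI ballI)
    obtain b where b: "b \<in> B" "way_below D b x" using dirB[OF ax(2)] by (auto simp: directed_def)
    then obtain y where "y \<in> B" "way_below D y b" using dirB[of b] BD by (auto simp: directed_def)
    then show "E \<noteq> {}" using b by (auto simp: E_def)
    fix y z assume "y \<in> E" "z \<in> E"
    then obtain b c where bc: "y \<in> B" "z \<in> B" "b \<in> B" "c \<in> B" "way_below D y b" "way_below D b x"
      "way_below D z c" "way_below D c x" by (auto simp: E_def)
    then obtain d where d: "d \<in> B" "way_below D d x" "le D b d" "le D c d"
      using directedD[OF dirB[OF ax(2)], of b c] by auto
    have car: "b \<in> carrier D" "c \<in> carrier D" "d \<in> carrier D" using bc d BD by auto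
    have "way_below D y d" "way_below D z d"
      using way_below_trans_le[OF po bc(5) d(3)] way_below_trans_le[OF po bc(7) d(4)] car by auto
    then obtain w where "w \<in> B" "way_below D w d" "le D y w" "le D z w"
      using directedD[OF dirB[OF car(3)], of y z] bc by auto
    then show "\<exists>w\<in>E. le D y w \<and> le D z w" using d by (auto simp: E_def)
  qed
  have lubE: "is_lub D x E"
  proof (rule is_lubI[OF ax(2) _ ED])
    fix y assume "y \<in> E"
    then obtain b where b: "y \<in> B" "b \<in> B" "way_below D y b" "way_below D b x" by (auto simp: E_def)
    then have car: "y \<in> carrier D" "b \<in> carrier D" using BD by auto
    show "le D y x"
      using po_trans[OF po way_below_le[OF po b(3) car(2)] way_below_le[OF po b(4) ax(2)]] car ax by simp
  next
    fix u assume u: "u \<in> carrier D" "\<And>y. y \<in> E \<Longrightarrow> le D y u"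
    show "le D x u"
    proof (rule is_lub_least[OF lubB[OF ax(2)] u(1)])
      fix b assume "b \<in> {b \<in> B. way_below D b x}"
      then have b: "b \<in> B" "way_below D b x" by auto
      show "le D b u"
        by (rule is_lub_least[OF lubB _ u(2)]) (use b BD u(1) in \<open>auto simp: E_def\<close>)
    qed
  qed
  obtain y where y: "y \<in> E" "le D a y"
    using ax(3)[unfolded way_below_def, rule_format, OF ED dirE lubE po_refl[OF po ax(2)]] by blast
  then obtain b where b: "y \<in> B" "b \<in> B" "way_below D y b" "way_below D b x" by (auto simp: E_def)
  then have "way_below D a b" using le_way_below_trans[OF po y(2) b(3) ax(1)] BD by auto
  then show ?thesis using b by blast
qed

text \<open>Interpolation makes the set of points that \<open>a\<close> is way below inaccessible by
  directed suprema; this yields the continuity of \<open>proj\<close>.\<close>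

lemma way_below_lub:
  assumes po: "partial_order D" and B: "is_basis D B"
    and X: "X \<subseteq> carrier D" "directed (le D) X" "is_lub D s X" and a: "a \<in> carrier D" "way_below D a s"
  shows "\<exists>x\<in>X. way_below D a x"
proof -
  have s: "s \<in> carrier D" by (rule is_lub_carrier[OF X(3)])
  obtain b where b: "b \<in> B" "way_below D a b" "way_below D b s"
    using basis_interpolation[OF po B a(1) s a(2)] by blast
  have bD: "b \<in> carrier D" using b(1) B by (auto simp: is_basis_def)
  obtain x where "x \<in> X" "le D b x"
    using b(3)[unfolded way_below_def, rule_format, OF X po_refl[OF po s]] by blast
  then show ?thesis using way_below_trans_le[OF po b(2) _ bD] X(1) by blast
qed

section \<open>Factoring approximations of a bc-domain through valuations\<close>

locale bc_based =
  fixes D :: "'a gorder" and b :: "nat \<Rightarrow> 'a"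
  assumes D: "dcpo D" and ne: "carrier D \<noteq> {}" and basis: "is_basis D (range b)"
    and bc: "\<And>X. \<lbrakk>X \<subseteq> carrier D; Upper D X \<noteq> {}\<rbrakk> \<Longrightarrow> \<exists>s. is_lub D s X"
begin

lemma D_po: "partial_order D"
  by (rule dcpo_po[OF D])

lemma b_carrier: "b i \<in> carrier D"
  using basis by (auto simp: is_basis_def)

definition bounded :: "nat set \<Rightarrow> bool" where
  "bounded J \<longleftrightarrow> (\<exists>u\<in>carrier D. \<forall>i\<in>J. le D (b i) u)"

definition join :: "nat set \<Rightarrow> 'a" where
  "join J = (SOME s. is_lub D s (b ` J))"

definition below :: "nat \<Rightarrow> 'a \<Rightarrow> nat set" where
  "below n x = {i. i < n \<and> way_below D (b i) x}"

lemma join_lub: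
  assumes "bounded J"
  shows "is_lub D (join J) (b ` J)"
proof -
  have "Upper D (b ` J) \<noteq> {}" using assms by (auto simp: bounded_def Upper_def)
  then have "\<exists>s. is_lub D s (b ` J)" using bc[of "b ` J"] b_carrier by blast
  then show ?thesis unfolding join_def by (rule someI_ex)
qed

lemma join_carrier: "bounded J \<Longrightarrow> join J \<in> carrier D"
  using join_lub is_lub_carrier by fast

lemma join_upper: "\<lbrakk>bounded J; i \<in> J\<rbrakk> \<Longrightarrow> le D (b i) (join J)"
  using is_lub_upper[OF join_lub] b_carrier by blast

lemma join_least: "\<lbrakk>bounded J; u \<in> carrier D; \<And>i. i \<in> J \<Longrightarrow> le D (b i) u\<rbrakk> \<Longrightarrow> le D (join J) u"
  by (rule is_lub_least[OF join_lub]) auto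

lemma bounded_subset: "\<lbrakk>bounded K; J \<subseteq> K\<rbrakk> \<Longrightarrow> bounded J"
  by (auto simp: bounded_def)

lemma join_mono: "\<lbrakk>bounded K; J \<subseteq> K\<rbrakk> \<Longrightarrow> le D (join J) (join K)"
  by (rule join_least) (use join_upper join_carrier bounded_subset in auto)

lemma bounded_below: "x \<in> carrier D \<Longrightarrow> bounded (below n x)"
  using way_below_le[OF D_po] by (auto simp: bounded_def below_def)

text \<open>Finite sets of indices are coded as numbers because \<open>fva\<close> takes its posets
  on natural numbers.\<close>

definition poset :: "nat \<Rightarrow> nat gorder" where
  "poset n = \<lparr>carrier = set_encode ` {J. J \<subseteq> {..<n} \<and> bounded J}, eq = (=),
     le = (\<lambda>k l. set_decode k \<subseteq> set_decode l)\<rparr>"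

definition over :: "nat \<Rightarrow> nat \<Rightarrow> nat set" where
  "over n i = {k \<in> carrier (poset n). i \<in> set_decode k}"

lemma poset_le [simp]: "le (poset n) k l \<longleftrightarrow> set_decode k \<subseteq> set_decode l"
  by (simp add: poset_def)

lemma poset_carrier: "k \<in> carrier (poset n) \<longleftrightarrow> set_decode k \<subseteq> {..<n} \<and> bounded (set_decode k)"
proof
  assume "k \<in> carrier (poset n)"
  then obtain J where "k = set_encode J" "J \<subseteq> {..<n}" "bounded J" by (auto simp: poset_def)
  then show "set_decode k \<subseteq> {..<n} \<and> bounded (set_decode k)"
    by (simp add: set_encode_inverse[OF finite_subset[of J "{..<n}"]])
next
  assume "set_decode k \<subseteq> {..<n} \<and> bounded (set_decode k)"
  then show "k \<in> carrier (poset n)"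
    by (auto simp: poset_def intro!: image_eqI[of _ _ "set_decode k"])
qed

lemma finite_poset_poset: "finite_poset (poset n)"
  unfolding finite_poset_def
proof
  show "partial_order (poset n)"
  proof (rule partial_orderI)
    fix k l assume "le (poset n) k l" "le (poset n) l k"
    then have "set_decode k = set_decode l" by auto
    then show "k = l" by (metis set_decode_inverse)
  qed (auto simp: poset_def)
  show "finite (carrier (poset n))" by (simp add: poset_def)
qed

sublocale fin_poset "poset n" for n
  by unfold_locales (rule finite_poset_poset)

lemma upper_over: "upper_set (poset n) (over n i)"
  by (auto simp: upper_set_def over_def)

definition code :: "nat \<Rightarrow> 'a \<Rightarrow> nat" where
  "code n x = set_encode (below n x)"

lemma decode_code: "set_decode (code n x) = below n x"
  unfolding code_def by (rule set_encode_inverse) (simp add: below_def)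

lemma code_carrier: "x \<in> carrier D \<Longrightarrow> code n x \<in> carrier (poset n)"
  unfolding poset_carrier decode_code using bounded_below by (auto simp: below_def)

definition proj :: "nat \<Rightarrow> 'a \<Rightarrow> nat \<Rightarrow> real" where
  "proj n x = restrict (\<lambda>k. if k = code n x then 1 else 0) (carrier (poset n))"

text \<open>The strict inequality makes membership of an index an open condition on
  \<open>v\<close>, as continuity of \<open>embed\<close> requires.\<close>

definition heavy :: "nat \<Rightarrow> (nat \<Rightarrow> real) \<Rightarrow> nat set" where
  "heavy n v = {i. i < n \<and> 1 - 1 / real (Suc n) < sum v (over n i)}"

definition embed :: "nat \<Rightarrow> (nat \<Rightarrow> real) \<Rightarrow> 'a" where
  "embed n v = join (heavy n v)"

lemma sum_proj:
  assumes "U \<subseteq> carrier (poset n)"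
  shows "sum (proj n x) U = (if code n x \<in> U then 1 else 0)"
proof -
  have "sum (proj n x) U = (\<Sum>k\<in>U. if k = code n x then 1 else 0)"
    using assms by (intro sum.cong) (auto simp: proj_def)
  then show ?thesis using finite_subset[OF assms fin] by simp
qed

lemma proj_carrier: "x \<in> carrier D \<Longrightarrow> proj n x \<in> carrier (valuations (poset n))"
  unfolding valuations_carrier by (simp add: sum_proj) (simp add: proj_def)

lemma heavy_proj:
  assumes "x \<in> carrier D"
  shows "heavy n (proj n x) = below n x"
proof -
  have "sum (proj n x) (over n i) = (if i \<in> below n x then 1 else 0)" for i
    using code_carrier[OF assms, of n] by (subst sum_proj) (auto simp: over_def decode_code)
  then show ?thesis by (auto simp: heavy_def below_def)
qed

text \<open>The threshold is chosen so that fewer than \<open>Suc n\<close> events, each of mass above it, always meet.\<close>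

lemma bounded_heavy:
  assumes v: "v \<in> carrier (valuations (poset n))"
  shows "bounded (heavy n v)"
proof (cases "heavy n v = {}")
  case True
  then show ?thesis using ne by (auto simp: bounded_def)
next
  case False
  let ?C = "carrier (poset n)" and ?J = "heavy n v"
  have J: "finite ?J" "card ?J \<le> n"
    using card_mono[of "{..<n}" ?J] finite_subset[of ?J "{..<n}"] by (auto simp: heavy_def)
  have v0: "0 \<le> v k" if "k \<in> ?C" for k using v that by (simp add: valuations_carrier)
  have "\<exists>k\<in>?C. ?J \<subseteq> set_decode k"
  proof (rule ccontr)
    assume no: "\<not> ?thesis"
    \<comment> \<open>Union bound: if every \<open>k\<close> misses some \<open>i\<close> in
      \<open>?J\<close>, the total mass is at most the sum over \<open>?J\<close> of the masses
      outside \<open>over n i\<close>. There are at most \<open>n\<close> of these, each at most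
      \<open>1 / Suc n\<close>, so the total stays below the threshold that a single heavy index
      exceeds.\<close>
    have "sum v ?C \<le> (\<Sum>k\<in>?C. \<Sum>i\<in>?J. if i \<in> set_decode k then 0 else v k)"
    proof (rule sum_mono)
      fix k assume k: "k \<in> ?C"
      then obtain i where i: "i \<in> ?J" "i \<notin> set_decode k" using no by blast
      then have "v k = (if i \<in> set_decode k then 0 else v k)" by simp
      also have "\<dots> \<le> (\<Sum>i\<in>?J. if i \<in> set_decode k then 0 else v k)"
        by (rule member_le_sum[OF i(1)]) (use v0[OF k] J in auto)
      finally show "v k \<le> (\<Sum>i\<in>?J. if i \<in> set_decode k then 0 else v k)" .
    qed
    also have "\<dots> = (\<Sum>i\<in>?J. \<Sum>k\<in>?C. if i \<in> set_decode k then 0 else v k)" by (rule sum.swap)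
    also have "\<dots> = (\<Sum>i\<in>?J. sum v ?C - sum v (over n i))"
    proof (rule sum.cong[OF refl])
      fix i
      have "sum v ?C = (\<Sum>k\<in>?C. if i \<in> set_decode k then 0 else v k) + (\<Sum>k\<in>?C. if i \<in> set_decode k then v k else 0)"
        unfolding sum.distrib[symmetric] by (intro sum.cong) auto
      also have "(\<Sum>k\<in>?C. if i \<in> set_decode k then v k else 0) = sum v (over n i)"
        unfolding over_def by (rule sum.inter_filter[symmetric]) (rule fin)
      finally show "(\<Sum>k\<in>?C. if i \<in> set_decode k then 0 else v k) = sum v ?C - sum v (over n i)" by simp
    qed
    also have "\<dots> \<le> (\<Sum>i\<in>?J. 1 / real (Suc n))"
      using v by (intro sum_mono) (auto simp: heavy_def valuations_carrier)
    also have "\<dots> \<le> real n * (1 / real (Suc n))" using J(2) by (simp add: divide_right_mono)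
    also have "\<dots> = 1 - 1 / real (Suc n)" by (simp add: field_simps)
    finally have "sum v ?C \<le> 1 - 1 / real (Suc n)" .
    moreover obtain i where "i \<in> ?J" using False by blast
    moreover have "sum v (over n i) \<le> sum v ?C"
      by (rule sum_mono2[OF fin]) (use v0 in \<open>auto simp: over_def\<close>)
    ultimately show False by (simp add: heavy_def)
  qed
  then obtain k where k: "bounded (set_decode k)" "?J \<subseteq> set_decode k" by (auto simp: poset_carrier)
  then show ?thesis by (auto simp: bounded_def)
qed

lemma embed_scott: "scott_continuous (valuations (poset n)) D (embed n)"
proof (rule scott_attainedI[OF valuations_po D_po])
  have mono: "heavy n v \<subseteq> heavy n w" if "mass_le (poset n) v w" for v w
  proof
    fix i assume "i \<in> heavy n v"
    then show "i \<in> heavy n w" using mass_leD[OF that upper_over[of n i]] by (simp add: heavy_def)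
  qed
  show "embed n v \<in> carrier D" if "v \<in> carrier (valuations (poset n))" for v
    unfolding embed_def by (intro join_carrier bounded_heavy that)
  show "le D (embed n v) (embed n w)"
    if "w \<in> carrier (valuations (poset n))" "le (valuations (poset n)) v w" for v w
    unfolding embed_def using that by (intro join_mono bounded_heavy mono) auto
  fix X q
  assume X: "X \<subseteq> carrier (valuations (poset n))" "directed (le (valuations (poset n))) X"
    "is_lub (valuations (poset n)) q X"
  have "\<exists>v\<in>X. \<forall>i\<in>heavy n q. i \<in> heavy n v"
  proof (rule directed_choose[OF valuations_po X(2,1)])
    show "finite (heavy n q)" by (simp add: heavy_def)
    fix i assume i: "i \<in> heavy n q"
    \<comment> \<open>The margin by which \<open>i\<close> is heavy at \<open>q\<close>; a member of
      \<open>X\<close> that is closer to \<open>q\<close> than this has \<open>i\<close> heavy as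
      well.\<close>
    define \<delta> where "\<delta> = sum q (over n i) - (1 - 1 / real (Suc n))"
    have "0 < \<delta>" using i by (simp add: heavy_def \<delta>_def)
    then obtain v where v: "v \<in> X" "\<And>U. upper_set (poset n) U \<Longrightarrow> sum q U - \<delta> < sum v U"
      using valuations_lub_approx[OF X(1) _ X(3)] X(2) by auto
    have "1 - 1 / real (Suc n) < sum v (over n i)" using v(2)[OF upper_over[of n i]] by (simp add: \<delta>_def)
    then have "i \<in> heavy n v" using i by (simp add: heavy_def)
    then show "\<exists>v\<in>X. \<forall>w\<in>X. le (valuations (poset n)) v w \<longrightarrow> i \<in> heavy n w"
      using v(1) mono by auto
  qed
  then obtain v where "v \<in> X" "heavy n q \<subseteq> heavy n v" by blast
  moreover have "heavy n v \<subseteq> heavy n q" if "v \<in> X" for v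
    using is_lub_upper[OF X(3) that X(1)] by (intro mono) simp
  ultimately show "\<exists>v\<in>X. embed n q = embed n v" unfolding embed_def by (metis subset_antisym)
qed

lemma below_mono: "\<lbrakk>x \<in> carrier D; y \<in> carrier D; le D x y\<rbrakk> \<Longrightarrow> below n x \<subseteq> below n y"
  using way_below_trans_le[OF D_po] by (auto simp: below_def)

lemma proj_scott: "scott_continuous D (valuations (poset n)) (proj n)"
proof (rule scott_attainedI[OF D_po valuations_po])
  show "proj n x \<in> carrier (valuations (poset n))" if "x \<in> carrier D" for x by (rule proj_carrier[OF that])
  show "le (valuations (poset n)) (proj n x) (proj n y)"
    if xy: "x \<in> carrier D" "y \<in> carrier D" "le D x y" for x y
    unfolding valuations_le mass_le_def
  proof (intro allI impI)
    fix U assume U: "upper_set (poset n) U"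
    have "code n x \<in> U \<Longrightarrow> code n y \<in> U"
      using U code_carrier[OF xy(2)] below_mono[OF xy] by (auto simp: upper_set_def decode_code)
    then show "sum (proj n x) U \<le> sum (proj n y) U" using upper_subset[OF U] by (simp add: sum_proj)
  qed
  fix X s assume X: "X \<subseteq> carrier D" "directed (le D) X" "is_lub D s X"
  have "\<exists>x\<in>X. \<forall>i\<in>below n s. i \<in> below n x"
  proof (rule directed_choose[OF D_po X(2,1)])
    show "finite (below n s)" by (simp add: below_def)
    fix i assume i: "i \<in> below n s"
    then obtain x where x: "x \<in> X" "way_below D (b i) x"
      using way_below_lub[OF D_po basis X b_carrier] by (auto simp: below_def)
    then have "i \<in> below n x" using i by (simp add: below_def)
    then show "\<exists>x\<in>X. \<forall>y\<in>X. le D x y \<longrightarrow> i \<in> below n y"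
      using x(1) X(1) below_mono by blast
  qed
  then obtain x where x: "x \<in> X" "below n s \<subseteq> below n x" by blast
  have "below n x \<subseteq> below n s"
    using below_mono[OF _ is_lub_carrier[OF X(3)] is_lub_upper[OF X(3) x(1) X(1)]] x(1) X(1) by blast
  then have "below n s = below n x" using x by blast
  then show "\<exists>x\<in>X. proj n s = proj n x" using x(1) by (auto simp: proj_def code_def)
qed

lemma embed_proj: "x \<in> carrier D \<Longrightarrow> (embed n \<circ> proj n) x = join (below n x)"
  by (simp add: embed_def heavy_proj)

lemma embed_proj_mono: "m \<le> n \<Longrightarrow> pointwise_le D (embed m \<circ> proj m) (embed n \<circ> proj n)"
  unfolding pointwise_le_def using bounded_below
  by (auto simp: embed_proj simp del: comp_apply intro!: join_mono) (auto simp: below_def)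

lemma embed_proj_le: "pointwise_le D (embed n \<circ> proj n) id"
  unfolding pointwise_le_def
proof
  fix x assume x: "x \<in> carrier D"
  have "le D (join (below n x)) x"
    by (rule join_least[OF bounded_below[OF x] x]) (use way_below_le[OF D_po _ x] in \<open>auto simp: below_def\<close>)
  then show "le D ((embed n \<circ> proj n) x) (id x)" using embed_proj[OF x] by simp
qed

lemma embed_proj_sup: "pointwise_sup_id D (range (\<lambda>n. embed n \<circ> proj n))"
  unfolding pointwise_sup_id_def
proof
  fix x assume x: "x \<in> carrier D"
  have eq: "(\<lambda>f. f x) ` range (\<lambda>n. embed n \<circ> proj n) = range (\<lambda>n. join (below n x))"
    by (simp add: image_image embed_proj[OF x, unfolded comp_apply])
  show "is_lub D x ((\<lambda>f. f x) ` range (\<lambda>n. embed n \<circ> proj n))"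
    unfolding eq
  proof (rule is_lubI[OF x])
    show "le D y x" if "y \<in> range (\<lambda>n. join (below n x))" for y
      using that embed_proj_le[unfolded pointwise_le_def, rule_format, OF x] embed_proj[OF x] by auto
    show "range (\<lambda>n. join (below n x)) \<subseteq> carrier D" using join_carrier[OF bounded_below[OF x]] by auto
    fix u assume u: "u \<in> carrier D" "\<And>y. y \<in> range (\<lambda>n. join (below n x)) \<Longrightarrow> le D y u"
    have "is_lub D x {c \<in> range b. way_below D c x}" using basis x by (simp add: is_basis_def)
    then show "le D x u"
    proof (rule is_lub_least[OF _ u(1)])
      fix c assume "c \<in> {c \<in> range b. way_below D c x}"
      then obtain i where i: "c = b i" "i \<in> below (Suc i) x" by (auto simp: below_def)
      have "le D (b i) (join (below (Suc i) x))" by (rule join_upper[OF bounded_below[OF x] i(2)])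
      then show "le D c u"
        unfolding i(1) by (rule po_trans[OF D_po _ u(2)]) (use b_carrier join_carrier[OF bounded_below[OF x]] u(1) in auto)
    qed
  qed
qed

lemma bc_fva: "fva D"
  unfolding fva_def
proof (intro conjI D exI)
  show "\<forall>n. finite_poset (poset n) \<and> scott_continuous D (valuations (poset n)) (proj n) \<and>
      scott_continuous (valuations (poset n)) D (embed n)"
    using finite_poset_poset proj_scott embed_scott by blast
  show "\<forall>n. pointwise_le D (embed n \<circ> proj n) (embed (Suc n) \<circ> proj (Suc n)) \<and>
      pointwise_le D (embed n \<circ> proj n) id"
    using embed_proj_mono embed_proj_le by simp
qed (rule embed_proj_sup)

text \<open>The value at \<open>x\<close> depends only on a subset of the first \<open>n\<close>
  indices, so the maps have finite image. This excludes from \<open>omega_BC\<close> everything that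
  is not an RB-domain.\<close>

lemma bc_rb: "rb_domain D"
  unfolding rb_domain_def
proof (intro conjI D exI)
  show "directed (pointwise_le D) (range (\<lambda>n. embed n \<circ> proj n))"
    unfolding directed_def
  proof (intro conjI ballI)
    fix f g assume "f \<in> range (\<lambda>n. embed n \<circ> proj n)" "g \<in> range (\<lambda>n. embed n \<circ> proj n)"
    then obtain i j where "f = embed i \<circ> proj i" "g = embed j \<circ> proj j" by blast
    then show "\<exists>h\<in>range (\<lambda>n. embed n \<circ> proj n). pointwise_le D f h \<and> pointwise_le D g h"
      using embed_proj_mono[of i "max i j"] embed_proj_mono[of j "max i j"] by auto
  qed simp
  have "finite ((embed n \<circ> proj n) ` carrier D)" for n
  proof (rule finite_subset)
    show "(embed n \<circ> proj n) ` carrier D \<subseteq> join ` Pow {..<n}"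
      using embed_proj by (auto simp: below_def)
  qed simp
  then show "\<forall>f\<in>range (\<lambda>n. embed n \<circ> proj n). scott_continuous D D f \<and> pointwise_le D f id \<and>
      finite (f ` carrier D)"
    using scott_comp[OF proj_scott embed_scott] embed_proj_le by auto
qed (rule embed_proj_sup)

end

lemma omega_BC_fva_rb:
  assumes "D \<in> omega_BC"
  shows "fva D" "rb_domain D"
proof -
  have D: "dcpo D" "pointed D" and bc: "\<And>X. \<lbrakk>X \<subseteq> carrier D; Upper D X \<noteq> {}\<rbrakk> \<Longrightarrow> \<exists>s. is_lub D s X"
    using assms by (auto simp: omega_BC_def bc_domain_def continuous_dcpo_def)
  obtain B where B: "countable B" "is_basis D B"
    using assms by (auto simp: omega_BC_def countably_based_def)
  obtain x where x: "x \<in> carrier D" using D(2) by (auto simp: pointed_def least_def)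
  then have "directed (le D) {b \<in> B. way_below D b x}" using B(2) by (simp add: is_basis_def)
  then have "B \<noteq> {}" by (auto simp: directed_def)
  then have "range (from_nat_into B) = B" using B(1) by (rule range_from_nat_into)
  then interpret bc_based D "from_nat_into B"
    by unfold_locales (use D B bc x in auto)
  show "fva D" by (rule bc_fva)
  show "rb_domain D" by (rule bc_rb)
qed


section \<open>A five-element poset that is not a retract of valuations\<close>

lemma finite_poset_domain:
  assumes po: "partial_order D" and fin: "finite (carrier D)"
  shows "rb_domain D" "fs_domain D" "countably_based D"
proof -
  have sup: "pointwise_sup_id D {id}"
    by (auto simp: pointwise_sup_id_def intro!: is_lub_greatest po_refl[OF po])
  have dir: "directed (pointwise_le D) {id}"
    by (auto simp: directed_def pointwise_le_def po_refl[OF po])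
  have sep: "finitely_separated D id"
    unfolding finitely_separated_def using fin po_refl[OF po] by (intro exI[of _ "carrier D"]) auto
  show "rb_domain D"
    unfolding rb_domain_def using finite_dcpo[OF assms] sup dir scott_id[OF po] fin
    by (intro conjI exI[of _ "{id}"]) (auto simp: pointwise_le_def po_refl[OF po])
  show "fs_domain D"
    unfolding fs_domain_def using finite_dcpo[OF assms] sup dir scott_id[OF po] sep
    by (intro conjI exI[of _ "{id}"]) auto
  have wb: "way_below D x x" if x: "x \<in> carrier D" for x
    unfolding way_below_def
  proof (intro allI impI)
    fix E s assume E: "E \<subseteq> carrier D" "directed (le D) E" "is_lub D s E" "le D x s"
    have "s \<in> E"
      by (rule directed_finite_lub_mem[OF po E(2,1) finite_subset[OF E(1) fin] E(3)])
    then show "\<exists>e\<in>E. le D x e" using E(4) by blast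
  qed
  have "is_basis D (carrier D)"
    unfolding is_basis_def
  proof (intro conjI ballI subset_refl)
    fix x assume x: "x \<in> carrier D"
    show "directed (le D) {b \<in> carrier D. way_below D b x}"
      unfolding directed_def using wb[OF x] x way_below_le[OF po _ x] by blast
    show "is_lub D x {b \<in> carrier D. way_below D b x}"
      by (rule is_lub_greatest) (use wb[OF x] x way_below_le[OF po _ x] in auto)
  qed
  then show "countably_based D" unfolding countably_based_def using countable_finite[OF fin] by blast
qed

text \<open>Points of the plane as functions, so that the example lives on the type used in the
  theorem and carries the componentwise order.\<close>

definition pt :: "real \<Rightarrow> real \<Rightarrow> nat \<Rightarrow> real" where
  "pt a b n = (if n = 0 then a else if n = 1 then b else 0)"

lemma pt_le [simp]: "pt a b \<le> pt c d \<longleftrightarrow> a \<le> c \<and> b \<le> d"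
  by (auto simp: pt_def le_fun_def dest: spec[of _ 0] spec[of _ 1])

lemma pt_eq [simp]: "pt a b = pt c d \<longleftrightarrow> a = c \<and> b = d"
  by (auto simp: pt_def fun_eq_iff dest: spec[of _ 0] spec[of _ 1])

text \<open>In the plane the two atoms have the join \<open>pt 1 1\<close>; since it is left out,
  the two maximal points are their only common upper bounds.\<close>

definition five :: "(nat \<Rightarrow> real) gorder" where
  "five = \<lparr>carrier = {pt 0 0, pt 1 0, pt 0 1, pt 2 1, pt 1 2}, eq = (=), le = (\<le>)\<rparr>"

lemma five_po: "partial_order five"
  by (rule partial_orderI) (auto simp: five_def)

lemma five_omega: "five \<in> omega_RB_bot" "five \<in> omega_FS_bot"
proof -
  have "finite (carrier five)" by (simp add: five_def)
  note dom = finite_poset_domain[OF five_po this]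
  have "least five (pt 0 0) (carrier five)" by (auto simp: least_def five_def)
  then have "pointed five" by (auto simp: pointed_def)
  then show "five \<in> omega_RB_bot" "five \<in> omega_FS_bot"
    using dom by (simp_all add: omega_RB_bot_def omega_FS_bot_def)
qed

text \<open>\<open>q\<close> is the directed supremum of its multiples by factors below 1, and in a
  finite poset the image of the supremum is attained. The slack between \<open>r * q\<close> and
  \<open>q\<close> serves as a neighbourhood of \<open>q\<close>.\<close>

lemma (in fin_poset) scaled_scott:
  assumes e: "scott_continuous (valuations P) D e" and D: "partial_order D" "finite (carrier D)"
    and q: "q \<in> carrier (valuations P)"
  shows "\<exists>r. 0 \<le> r \<and> r < 1 \<and> e (\<lambda>x\<in>C. r * q x) = e q"
proof -
  let ?V = "valuations P"
  define sc where "sc r = (\<lambda>x\<in>C. r * q x)" for r :: real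
  define X where "X = sc ` {0..<1}"
  have sum_sc: "sum (sc r) U = r * sum q U" if "upper_set P U" for r U
    unfolding sum_distrib_left using upper_subset[OF that] by (intro sum.cong) (auto simp: sc_def)
  have sc_car: "sc r \<in> carrier ?V" if "0 \<le> r" "r \<le> 1" for r
  proof -
    have "r * sum q C \<le> 1" using mult_mono[of r 1 "sum q C" 1] upper_mass_bounds[OF q upper_carrier] that by simp
    then show ?thesis
      using q that sum_sc[OF upper_carrier, of r] by (simp add: valuations_carrier) (simp add: sc_def)
  qed
  have sc_mono: "mass_le P (sc r) (sc r')" if "r \<le> r'" for r r'
    unfolding mass_le_def
  proof (intro allI impI)
    fix U assume U: "upper_set P U"
    show "sum (sc r) U \<le> sum (sc r') U"
      unfolding sum_sc[OF U] using that upper_mass_bounds(1)[OF q U] by (rule mult_right_mono)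
  qed
  have sc1: "mass_le P (sc 1) q" "mass_le P q (sc 1)" by (simp_all add: mass_le_def sum_sc)
  have XV: "X \<subseteq> carrier ?V" using sc_car by (auto simp: X_def)
  have dir: "directed (le ?V) X"
    unfolding directed_def
  proof (intro conjI ballI)
    show "X \<noteq> {}" by (auto simp: X_def)
    fix v w assume "v \<in> X" "w \<in> X"
    then obtain r r' where r: "v = sc r" "w = sc r'" "r \<in> {0..<1}" "r' \<in> {0..<1}" by (auto simp: X_def)
    then have "sc (max r r') \<in> X" by (auto simp: X_def)
    then show "\<exists>z\<in>X. le ?V v z \<and> le ?V w z"
      using r sc_mono[of r "max r r'"] sc_mono[of r' "max r r'"] by (intro bexI[of _ "sc (max r r')"]) auto
  qed
  have lub: "is_lub ?V q X"
  proof (rule is_lubI[OF q _ XV])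
    fix v assume "v \<in> X"
    then obtain r where "v = sc r" "r \<le> 1" by (auto simp: X_def)
    then show "le ?V v q" using mass_le_trans[OF sc_mono sc1(1)] by simp
  next
    fix u assume u: "u \<in> carrier ?V" "\<And>v. v \<in> X \<Longrightarrow> le ?V v u"
    have "sum q U \<le> sum u U" if U: "upper_set P U" for U
    proof (rule field_le_epsilon)
      fix \<epsilon> :: real assume e: "0 < \<epsilon>"
      define r where "r = 1 - min 1 \<epsilon>"
      have r: "0 \<le> r" "r < 1" "1 - r \<le> \<epsilon>" using e by (auto simp: r_def)
      then have "sc r \<in> X" by (auto simp: X_def)
      then have "r * sum q U \<le> sum u U" using mass_leD[of P "sc r" u U] u(2) U sum_sc[OF U] by simp
      moreover have "(1 - r) * sum q U \<le> \<epsilon> * 1"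
        using r upper_mass_bounds[OF q U] e by (intro mult_mono) auto
      ultimately show "sum q U \<le> sum u U + \<epsilon>" by (simp add: algebra_simps)
    qed
    then show "le ?V q u" by (simp add: mass_le_def)
  qed
  have eX: "e ` X \<subseteq> carrier D" using scott_carrier[OF e] XV by blast
  have "e q \<in> e ` X"
    by (rule directed_finite_lub_mem[OF D(1) directed_scott_image[OF e dir XV] eX
          finite_subset[OF eX D(2)] scott_lub[OF e XV dir lub]])
  then show ?thesis by (auto simp: X_def sc_def)
qed

text \<open>The segment between the images of the two maximal points stays above the images of the two
  atoms, so the retraction maps it into the discrete set of maximal points.\<close>

lemma five_not_fva: "\<not> fva five"
proof
  assume "fva five"
  then obtain P :: "nat \<Rightarrow> nat gorder" and p e where
    P: "\<And>n. finite_poset (P n)"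
    and p: "\<And>n. scott_continuous five (valuations (P n)) (p n)"
    and e: "\<And>n. scott_continuous (valuations (P n)) five (e n)"
    and inc: "\<And>n. pointwise_le five (e n \<circ> p n) (e (Suc n) \<circ> p (Suc n))"
    and below: "\<And>n. pointwise_le five (e n \<circ> p n) id"
    and sup: "pointwise_sup_id five (range (\<lambda>n. e n \<circ> p n))"
    unfolding fva_def by blast
  have finc: "finite (carrier five)" by (simp add: five_def)
  have ec: "e n (p n x) \<in> carrier five" if "x \<in> carrier five" for n x
    by (rule scott_carrier[OF e scott_carrier[OF p that]])
  have mono: "e i (p i x) \<le> e j (p j x)" if "x \<in> carrier five" "i \<le> j" for i j x
    by (rule lift_Suc_mono_le[of "\<lambda>i. e i (p i x)"])
      (use inc that in \<open>auto simp: pointwise_le_def five_def\<close>)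
  have fixed: "\<forall>\<^sub>F n in sequentially. e n (p n x) = x" if x: "x \<in> carrier five" for x
  proof -
    let ?R = "range (\<lambda>n. e n (p n x))"
    have R: "?R \<subseteq> carrier five" using ec[OF x] by blast
    have "directed (le five) ?R"
      unfolding directed_def
    proof (intro conjI ballI)
      fix y z assume "y \<in> ?R" "z \<in> ?R"
      then obtain i j where "y = e i (p i x)" "z = e j (p j x)" by blast
      then show "\<exists>w\<in>?R. le five y w \<and> le five z w"
        using mono[OF x, of i "max i j"] mono[OF x, of j "max i j"]
        by (intro bexI[of _ "e (max i j) (p (max i j) x)"]) (auto simp: five_def)
    qed simp
    moreover have "is_lub five x ?R" using sup x by (simp add: pointwise_sup_id_def image_image)
    ultimately have "x \<in> ?R"
      by (rule directed_finite_lub_mem[OF five_po _ R finite_subset[OF R finc]])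
    then obtain n where n: "x = e n (p n x)" by (rule rangeE)
    have "e m (p m x) = x" if "n \<le> m" for m
    proof (rule antisym)
      show "e m (p m x) \<le> x" using below[of m] x by (auto simp: pointwise_le_def five_def)
      show "x \<le> e m (p m x)" by (subst n) (rule mono[OF x that])
    qed
    then show ?thesis by (auto simp: eventually_sequentially)
  qed
  have "\<forall>\<^sub>F n in sequentially. \<forall>x\<in>carrier five. e n (p n x) = x"
    by (rule eventually_ball_finite[OF finc]) (use fixed in blast)
  \<comment> \<open>The carrier is finite, so a single \<open>n\<close> already exhibits
    \<open>five\<close> as a retract of \<open>valuations (P n)\<close>.\<close>
  then obtain n where n: "\<And>x. x \<in> carrier five \<Longrightarrow> e n (p n x) = x"
    using eventually_happens'[OF sequentially_bot] by blast
  interpret fin_poset "P n" by unfold_locales (rule P)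
  let ?V = "valuations (P n)"
  define c d where "c = pt 2 1" and "d = pt 1 2"
  have cd: "c \<in> carrier five" "d \<in> carrier five" by (auto simp: c_def d_def five_def)
  have pc: "p n x \<in> carrier ?V" if "x \<in> carrier five" for x by (rule scott_carrier[OF p that])
  define w where "w t = (\<lambda>x\<in>C. (1 - t) * p n c x + t * p n d x)" for t :: real
  have sum_w: "sum (w t) U = (1 - t) * sum (p n c) U + t * sum (p n d) U" if "upper_set (P n) U" for t U
  proof -
    have "sum (w t) U = (\<Sum>x\<in>U. (1 - t) * p n c x + t * p n d x)"
      using upper_subset[OF that] by (intro sum.cong) (auto simp: w_def)
    then show ?thesis by (simp add: sum.distrib sum_distrib_left)
  qed
  have wV: "w t \<in> carrier ?V" if t: "t \<in> {0..1}" for t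
  proof -
    have "(1 - t) * sum (p n c) C + t * sum (p n d) C \<le> (1 - t) * 1 + t * 1"
      using t upper_mass_bounds(2)[OF pc upper_carrier] cd by (intro add_mono mult_left_mono) auto
    moreover have "0 \<le> w t x" if "x \<in> C" for x
      using t pc[OF cd(1)] pc[OF cd(2)] that by (simp add: w_def valuations_carrier)
    ultimately show ?thesis
      using sum_w[OF upper_carrier] by (simp add: valuations_carrier) (simp add: w_def)
  qed
  have above: "e n (w t) \<in> {c, d}" if t: "t \<in> {0..1}" for t
  proof -
    have ge: "x \<le> e n (w t)" if x: "x \<in> carrier five" "x \<le> c" "x \<le> d" for x
    proof -
      have "mass_le (P n) (p n x) (p n c)" "mass_le (P n) (p n x) (p n d)"
        using scott_mono[OF p x(1) cd(1)] scott_mono[OF p x(1) cd(2)] x by (auto simp: five_def)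
      have "mass_le (P n) (p n x) (w t)"
        unfolding mass_le_def
      proof (intro allI impI)
        fix U assume U: "upper_set (P n) U"
        have "(1 - t) * sum (p n x) U + t * sum (p n x) U \<le> sum (w t) U"
          unfolding sum_w[OF U]
          using t mass_leD[OF \<open>mass_le (P n) (p n x) (p n c)\<close> U] mass_leD[OF \<open>mass_le (P n) (p n x) (p n d)\<close> U]
          by (intro add_mono mult_left_mono) auto
        then show "sum (p n x) U \<le> sum (w t) U" by (simp add: algebra_simps)
      qed
      then have "le five (e n (p n x)) (e n (w t))" using scott_mono[OF e pc[OF x(1)] wV[OF t]] by simp
      then show ?thesis using n[OF x(1)] by (simp add: five_def)
    qed
    have "pt 1 0 \<le> e n (w t)" "pt 0 1 \<le> e n (w t)"
      by (rule ge; simp add: five_def c_def d_def)+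
    moreover have "e n (w t) \<in> carrier five" by (rule scott_carrier[OF e wV[OF t]])
    ultimately show ?thesis by (auto simp: five_def c_def d_def)
  qed
  have "\<forall>\<^sub>F t in at t0 within {0..1}. e n (w t0) = e n (w t)" if t0: "t0 \<in> {0..1}" for t0
  proof -
    obtain r where r: "0 \<le> r" "r < 1" "e n (\<lambda>x\<in>C. r * w t0 x) = e n (w t0)"
      using scaled_scott[OF e five_po finc wV[OF t0]] by blast
    \<comment> \<open>Chosen to give \<open>r * (1 - t0) \<le> 1 - t\<close> and
      \<open>r * t0 \<le> t\<close>, so that \<open>r * w t0\<close> lies below \<open>w t\<close>.
      At an end of the interval one condition holds anyway, and the default 1 imposes
      nothing.\<close>
    define \<delta> where "\<delta> = min (if t0 < 1 then (1 - r) * (1 - t0) else 1) (if 0 < t0 then (1 - r) * t0 else 1)"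
    have "0 < \<delta>" using r by (auto simp: \<delta>_def)
    moreover have "e n (w t0) = e n (w t)" if t: "t \<in> {0..1}" "dist t t0 < \<delta>" for t
    proof -
      have t1: "r * (1 - t0) \<le> 1 - t"
      proof (cases "t0 < 1")
        case True
        then have "\<delta> \<le> (1 - r) * (1 - t0)" by (simp add: \<delta>_def)
        then show ?thesis using t by (auto simp: dist_real_def algebra_simps)
      qed (use t t0 in simp)
      have t2: "r * t0 \<le> t"
      proof (cases "0 < t0")
        case True
        then have "\<delta> \<le> (1 - r) * t0" by (simp add: \<delta>_def)
        then show ?thesis using t by (auto simp: dist_real_def algebra_simps)
      qed (use t t0 in simp)
      let ?q = "\<lambda>x\<in>C. r * w t0 x"
      have sum_q: "sum ?q U = r * sum (w t0) U" if "upper_set (P n) U" for U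
        unfolding sum_distrib_left using upper_subset[OF that] by (intro sum.cong) auto
      have "mass_le (P n) ?q (w t)"
        unfolding mass_le_def
      proof (intro allI impI)
        fix U assume U: "upper_set (P n) U"
        have "r * sum (w t0) U = (r * (1 - t0)) * sum (p n c) U + (r * t0) * sum (p n d) U"
          by (simp add: sum_w[OF U] algebra_simps)
        also have "\<dots> \<le> (1 - t) * sum (p n c) U + t * sum (p n d) U"
          using t1 t2 upper_mass_bounds(1)[OF pc U] cd by (intro add_mono mult_right_mono) auto
        finally show "sum ?q U \<le> sum (w t) U" unfolding sum_q[OF U] sum_w[OF U] .
      qed
      moreover have "?q \<in> carrier ?V"
      proof -
        have "r * sum (w t0) C \<le> 1 * 1"
          using r upper_mass_bounds[OF wV[OF t0] upper_carrier] by (intro mult_mono) auto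
        then show ?thesis
          using wV[OF t0] r sum_q[OF upper_carrier] by (simp add: valuations_carrier)
      qed
      ultimately have "le five (e n ?q) (e n (w t))" using scott_mono[OF e _ wV[OF t(1)]] by simp
      \<comment> \<open>Both values lie in \<open>{c, d}\<close>, and \<open>c\<close> and
        \<open>d\<close> are incomparable, so ordered values are equal.\<close>
      then show ?thesis using r(3) above[OF t(1)] above[OF t0] by (auto simp: five_def c_def d_def)
    qed
    ultimately show ?thesis by (auto simp: eventually_at)
  qed
  then have "e n (w 0) = e n (w 1)"
    by (intro connected_local_const[OF connected_Icc, of 0 0 1]) auto
  moreover have "w 0 = p n c" "w 1 = p n d"
    using pc[OF cd(1)] pc[OF cd(2)] by (auto simp: w_def valuations_carrier extensional_def fun_eq_iff)
  ultimately have "c = d" using n cd by simp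
  then show False by (simp add: c_def d_def)
qed


section \<open>Step functions on a lattice ordered by a square cone\<close>

locale bounded_steps =
  fixes \<rho> :: "int \<Rightarrow> nat" and lo hi :: int and K :: nat
  assumes mono: "\<And>w w'. w \<le> w' \<Longrightarrow> \<rho> w \<le> \<rho> w'"
    and left: "\<And>w. w \<le> lo \<Longrightarrow> \<rho> w = \<rho> lo" and right: "\<And>w. hi \<le> w \<Longrightarrow> \<rho> w = \<rho> hi"
    and bound: "\<rho> hi \<le> K" and lohi: "lo \<le> hi"
begin

definition steps :: "int \<Rightarrow> int set" where
  "steps h = {w. \<rho> w < \<rho> (w + h)}"

definition double_steps :: "int \<Rightarrow> int set" where
  "double_steps h = {w. \<rho> (w - h) < \<rho> w \<and> \<rho> w < \<rho> (w + h)}"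

lemma steps_subset: "0 \<le> h \<Longrightarrow> steps h \<subseteq> {lo - h..<hi}"
proof
  fix w assume h: "0 \<le> h" and w: "w \<in> steps h"
  have "\<not> hi \<le> w" using w right[of w] right[of "w + h"] h by (auto simp: steps_def)
  moreover have "\<not> w + h \<le> lo" using w left[of w] left[of "w + h"] h by (auto simp: steps_def)
  ultimately show "w \<in> {lo - h..<hi}" by auto
qed

lemma finite_steps: "0 \<le> h \<Longrightarrow> finite (steps h)"
  using steps_subset finite_subset by blast

lemma card_steps_one: "card (steps 1) \<le> K"
proof -
  have tele: "(\<Sum>w\<in>{lo..<hi'}. \<rho> (w + 1) - \<rho> w) = \<rho> hi' - \<rho> lo" if "lo \<le> hi'" for hi'
    using that
  proof (induction hi' rule: int_ge_induct)
    case base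
    then show ?case by simp
  next
    case (step i)
    have "{lo..<i + 1} = insert i {lo..<i}" using step by auto
    then show ?case using step mono[of lo i] mono[of i "i + 1"] by simp
  qed
  have sub: "steps 1 \<subseteq> {lo..<hi}"
  proof
    fix w assume w: "w \<in> steps 1"
    then have "w \<in> {lo - 1..<hi}" using steps_subset[of 1] by auto
    moreover have "w \<noteq> lo - 1" using w left[of "lo - 1"] by (auto simp: steps_def)
    ultimately show "w \<in> {lo..<hi}" by auto
  qed
  have "card (steps 1) = (\<Sum>w\<in>steps 1. 1)" by simp
  also have "\<dots> \<le> (\<Sum>w\<in>steps 1. \<rho> (w + 1) - \<rho> w)" by (rule sum_mono) (auto simp: steps_def)
  also have "\<dots> \<le> (\<Sum>w\<in>{lo..<hi}. \<rho> (w + 1) - \<rho> w)" by (rule sum_mono2) (use sub in auto)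
  also have "\<dots> \<le> K" using tele[OF lohi] bound by simp
  finally show ?thesis .
qed

text \<open>A step of width \<open>2 * h\<close> is a step in its left or its right half, so
  \<open>steps (2 * h)\<close> is the union of \<open>steps h\<close> and a translate of it; up to
  translation their intersection is \<open>double_steps h\<close>.\<close>

lemma double_steps_card:
  assumes h: "0 \<le> h"
  shows "finite (double_steps h)" "card (double_steps h) + card (steps (2 * h)) = 2 * card (steps h)"
proof -
  define X where "X = {w. \<rho> (w + h) < \<rho> (w + 2 * h)}"
  have X: "X = (\<lambda>w. w - h) ` steps h" by (auto simp: X_def steps_def intro!: image_eqI[of _ _ "_ + h"] simp: algebra_simps)
  have d: "steps h \<inter> X = (\<lambda>w. w - h) ` double_steps h"
    by (auto simp: X_def steps_def double_steps_def intro!: image_eqI[of _ _ "_ + h"] simp: algebra_simps)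
  have u: "steps (2 * h) = steps h \<union> X"
  proof -
    have "\<rho> w < \<rho> (w + 2 * h) \<longleftrightarrow> \<rho> w < \<rho> (w + h) \<or> \<rho> (w + h) < \<rho> (w + 2 * h)" for w
      using mono[of w "w + h"] mono[of "w + h" "w + 2 * h"] h by linarith
    then show ?thesis by (auto simp: steps_def X_def)
  qed
  have inj: "inj_on (\<lambda>w. w - h) A" for A by (auto simp: inj_on_def)
  have fX: "finite X" unfolding X using finite_steps[OF h] by simp
  have "finite (steps h \<inter> X)" using fX by blast
  then show "finite (double_steps h)" unfolding d by (rule finite_imageD[OF _ inj])
  have "card X = card (steps h)" unfolding X by (rule card_image[OF inj])
  moreover have "card (steps h \<inter> X) = card (double_steps h)" unfolding d by (rule card_image[OF inj])
  moreover have "card (steps h) + card X = card (steps h \<union> X) + card (steps h \<inter> X)"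
    by (rule card_Un_Int[OF finite_steps[OF h] fX])
  ultimately show "card (double_steps h) + card (steps (2 * h)) = 2 * card (steps h)" unfolding u by simp
qed

text \<open>The densities \<open>card (steps (2 ^ k)) / 2 ^ k\<close> decrease with \<open>k\<close>, each time by the summand below.\<close>

lemma sum_double_steps: "(\<Sum>k<L. card (double_steps (2 ^ k)) / 2 ^ Suc k) \<le> real K"
proof -
  have "(\<Sum>k<L. card (double_steps (2 ^ k)) / 2 ^ Suc k) = card (steps 1) - card (steps (2 ^ L)) / 2 ^ L"
  proof (induction L)
    case (Suc L)
    have "real (card (double_steps (2 ^ L))) + card (steps (2 * 2 ^ L)) = 2 * card (steps (2 ^ L))"
      using double_steps_card(2)[of "2 ^ L"] by (metis of_nat_add of_nat_mult of_nat_numeral zero_le_numeral zero_le_power)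
    then have "card (double_steps (2 ^ L)) / 2 ^ Suc L = card (steps (2 ^ L)) / 2 ^ L - card (steps (2 ^ Suc L)) / 2 ^ Suc L"
      by (simp add: field_simps)
    then show ?case using Suc by simp
  qed simp
  moreover have "0 \<le> card (steps (2 ^ L)) / 2 ^ L" by simp
  ultimately show ?thesis using card_steps_one by linarith
qed

end

section \<open>Sums over translated boxes\<close>

definition box_sum :: "int \<Rightarrow> (int \<Rightarrow> int \<Rightarrow> int \<Rightarrow> real) \<Rightarrow> int \<Rightarrow> int \<Rightarrow> int \<Rightarrow> real" where
  "box_sum N g p q r = (\<Sum>i\<in>{0..<N}. \<Sum>j\<in>{0..<N}. \<Sum>k\<in>{0..<N}. g (i + p) (j + q) (k + r))"

text \<open>Moving an interval by one exchanges a single end term, at a cost of at most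
  2\<epsilon>.\<close>

lemma interval_shift:
  fixes g :: "int \<Rightarrow> real"
  assumes g: "\<And>i. \<bar>g i\<bar> \<le> \<epsilon>"
  shows "\<bar>(\<Sum>i\<in>{0..<N}. g (i + p)) - (\<Sum>i\<in>{0..<N}. g (i + q))\<bar> \<le> 2 * \<epsilon> * \<bar>p - q\<bar>"
proof -
  have \<epsilon>: "0 \<le> \<epsilon>" using g[of 0] by simp
  have tele: "(\<Sum>i\<in>{0..<M}. g (i + (p + 1))) - (\<Sum>i\<in>{0..<M}. g (i + p)) = g (M + p) - g p" if "0 \<le> M" for M p
    using that
  proof (induction M rule: int_ge_induct)
    case base
    then show ?case by simp
  next
    case (step i)
    have "{0..<i + 1} = insert i {0..<i}" using step by auto
    then show ?case using step by (simp add: algebra_simps)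
  qed
  have one: "\<bar>(\<Sum>i\<in>{0..<N}. g (i + (p + 1))) - (\<Sum>i\<in>{0..<N}. g (i + p))\<bar> \<le> 2 * \<epsilon>" for p
  proof (cases "0 \<le> N")
    case True
    then show ?thesis using tele[OF True, of p] g[of "N + p"] g[of p] by linarith
  qed (use \<epsilon> in simp)
  have up: "\<bar>(\<Sum>i\<in>{0..<N}. g (i + p)) - (\<Sum>i\<in>{0..<N}. g (i + q))\<bar> \<le> 2 * \<epsilon> * of_int (p - q)" if "q \<le> p" for p q
    using that
  proof (induction p rule: int_ge_induct)
    case base
    then show ?case by simp
  next
    case (step p)
    then show ?case using one[of p] by (simp add: algebra_simps)
  qed
  show ?thesis
  proof (cases "q \<le> p")
    case True
    then show ?thesis using up[OF True] by simp
  next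
    case False
    then show ?thesis using up[of p q] by (simp add: abs_minus_commute)
  qed
qed

lemma sum_abs_diff_le:
  fixes f g :: "int \<Rightarrow> real"
  assumes "\<And>i. i \<in> {0..<N} \<Longrightarrow> \<bar>f i - g i\<bar> \<le> c" "0 \<le> N"
  shows "\<bar>(\<Sum>i\<in>{0..<N}. f i) - (\<Sum>i\<in>{0..<N}. g i)\<bar> \<le> of_int N * c"
proof -
  have "\<bar>\<Sum>i\<in>{0..<N}. f i - g i\<bar> \<le> (\<Sum>i\<in>{0..<N}. c)"
    by (rule order_trans[OF sum_abs sum_mono]) (use assms in auto)
  then show ?thesis using assms(2) by (simp add: sum_subtractf)
qed

text \<open>A discrete form of the divergence theorem: translating a box alters only boundary
  layers, of about \<open>N^2\<close> points for each unit of translation.\<close>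

lemma box_sum_shift:
  assumes g: "\<And>i j k. \<bar>g i j k\<bar> \<le> \<epsilon>" and N: "0 \<le> N"
  shows "\<bar>box_sum N g p q r - box_sum N g p' q' r'\<bar> \<le>
    2 * \<epsilon> * of_int (\<bar>p - p'\<bar> + \<bar>q - q'\<bar> + \<bar>r - r'\<bar>) * of_int N ^ 2"
proof -
  have 1: "\<bar>box_sum N g p q r - box_sum N g p q r'\<bar> \<le> of_int N * (of_int N * (2 * \<epsilon> * of_int \<bar>r - r'\<bar>))"
    unfolding box_sum_def by (intro sum_abs_diff_le N interval_shift g)
  have 2: "\<bar>box_sum N g p q r' - box_sum N g p q' r'\<bar> \<le> of_int N * (of_int N * (2 * \<epsilon> * of_int \<bar>q - q'\<bar>))"
  proof -
    have swap: "box_sum N g p q r' = (\<Sum>i\<in>{0..<N}. \<Sum>k\<in>{0..<N}. \<Sum>j\<in>{0..<N}. g (i + p) (j + q) (k + r'))" for q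
      unfolding box_sum_def by (intro sum.cong refl sum.swap)
    show ?thesis unfolding swap by (intro sum_abs_diff_le N interval_shift[where g = "\<lambda>j. g _ j _"] g)
  qed
  have 3: "\<bar>box_sum N g p q' r' - box_sum N g p' q' r'\<bar> \<le> of_int N * (of_int N * (2 * \<epsilon> * of_int \<bar>p - p'\<bar>))"
  proof -
    have swap: "box_sum N g p q' r' = (\<Sum>j\<in>{0..<N}. \<Sum>k\<in>{0..<N}. \<Sum>i\<in>{0..<N}. g (i + p) (j + q') (k + r'))" for p
      unfolding box_sum_def by (rule trans[OF sum.swap], rule sum.cong[OF refl], rule sum.swap)
    show ?thesis unfolding swap by (intro sum_abs_diff_le N interval_shift[where g = "\<lambda>i. g i _ _"] g)
  qed
  have "\<bar>box_sum N g p q r - box_sum N g p' q' r'\<bar> \<le>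
      of_int N * (of_int N * (2 * \<epsilon> * of_int \<bar>r - r'\<bar>)) + of_int N * (of_int N * (2 * \<epsilon> * of_int \<bar>q - q'\<bar>))
      + of_int N * (of_int N * (2 * \<epsilon> * of_int \<bar>p - p'\<bar>))"
    using 1 2 3 by linarith
  also have "\<dots> = 2 * \<epsilon> * of_int (\<bar>p - p'\<bar> + \<bar>q - q'\<bar> + \<bar>r - r'\<bar>) * of_int N ^ 2"
    by (simp add: algebra_simps power2_eq_square)
  finally show ?thesis .
qed

text \<open>The lattice is \<open>\<int>\<^sup>3\<close> with basis \<open>r\<^sub>1, r\<^sub>2, s\<close>; the extremal rays of the cone are \<open>r\<^sub>1, r\<^sub>2\<close>,
  \<open>r\<^sub>3 = s - r\<^sub>1\<close> and \<open>r\<^sub>4 = s - r\<^sub>2\<close>, and the four functionals below bound its facets.\<close>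

definition lattice_le :: "int \<times> int \<times> int \<Rightarrow> int \<times> int \<times> int \<Rightarrow> bool" where
  "lattice_le = (\<lambda>(i, j, k) (i', j', k'). k \<le> k' \<and> i + k \<le> i' + k' \<and> j + k \<le> j' + k' \<and> i + j + k \<le> i' + j' + k')"

text \<open>\<open>\<alpha>\<close>, \<open>\<beta>\<close>, \<open>\<gamma>\<close>,
  \<open>\<delta>\<close> are the four facet functionals evaluated on \<open>f\<close>; in dimension
  three they satisfy one linear relation, \<open>modular\<close>. \<open>\<eta>\<close> is the mesh,
  \<open>\<epsilon>\<close> bounds the distance to an affine map, and \<open>R\<close> ranks the
  values. Cells of size at most \<open>N\<close> start in the cube of side \<open>N\<close>; the
  larger index ranges also contain their vertices and the points one step below and above these in
  the third direction.\<close>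

locale square_cone_steps =
  fixes N K :: nat and f :: "int \<Rightarrow> int \<Rightarrow> int \<Rightarrow> 'v"
    and \<alpha> \<beta> \<gamma> \<delta> :: "'v \<Rightarrow> real" and R :: "'v \<Rightarrow> nat"
    and \<eta> \<epsilon> a0 b0 c0 d0 :: real
  assumes modular: "\<And>i j k. \<lbrakk>i \<in> {- int N..2 * int N}; j \<in> {- int N..2 * int N}; k \<in> {- int N..3 * int N}\<rbrakk> \<Longrightarrow>
      \<alpha> (f i j k) + \<beta> (f i j k) = \<gamma> (f i j k) + \<delta> (f i j k)"
    and f_mono: "\<And>i j k i' j' k'. \<lbrakk>i \<in> {- int N..2 * int N}; j \<in> {- int N..2 * int N}; k \<in> {- int N..3 * int N};
      i' \<in> {- int N..2 * int N}; j' \<in> {- int N..2 * int N}; k' \<in> {- int N..3 * int N}; lattice_le (i, j, k) (i', j', k')\<rbrakk> \<Longrightarrow>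
      \<alpha> (f i j k) \<le> \<alpha> (f i' j' k') \<and> \<beta> (f i j k) \<le> \<beta> (f i' j' k') \<and>
      \<gamma> (f i j k) \<le> \<gamma> (f i' j' k') \<and> \<delta> (f i j k) \<le> \<delta> (f i' j' k') \<and>
      (f i j k = f i' j' k' \<or> R (f i j k) < R (f i' j' k'))"
    and R_bound: "\<And>v. R v \<le> K"
    and near: "\<And>i j k. \<lbrakk>i \<in> {- int N..2 * int N}; j \<in> {- int N..2 * int N}; k \<in> {- int N..3 * int N}\<rbrakk> \<Longrightarrow>
      \<bar>\<alpha> (f i j k) - (a0 + \<eta> * of_int (i + j + k))\<bar> \<le> \<epsilon> \<and> \<bar>\<beta> (f i j k) - (b0 + \<eta> * of_int k)\<bar> \<le> \<epsilon> \<and>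
      \<bar>\<gamma> (f i j k) - (c0 + \<eta> * of_int (j + k))\<bar> \<le> \<epsilon> \<and> \<bar>\<delta> (f i j k) - (d0 + \<eta> * of_int (i + k))\<bar> \<le> \<epsilon>"
    and range01: "\<And>i j k. \<lbrakk>i \<in> {- int N..2 * int N}; j \<in> {- int N..2 * int N}; k \<in> {- int N..3 * int N}\<rbrakk> \<Longrightarrow>
      0 \<le> \<alpha> (f i j k) \<and> \<alpha> (f i j k) \<le> 1 \<and> 0 \<le> \<beta> (f i j k) \<and> \<beta> (f i j k) \<le> 1"
begin

text \<open>Clipping makes the rank monotone on all integers and constant towards both ends, as
  \<open>bounded_steps\<close> demands.\<close>

definition column :: "int \<Rightarrow> int \<Rightarrow> int \<Rightarrow> nat" where
  "column i j w = R (f i j (max (- int N) (min (3 * int N) w)))"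

definition column_jumps :: "int \<Rightarrow> int \<Rightarrow> int \<Rightarrow> int set" where
  "column_jumps i j h = {w. column i j (w - h) < column i j w \<and> column i j w < column i j (w + h)}"

definition jumps :: "int \<Rightarrow> (int \<times> int \<times> int) set" where
  "jumps h = (SIGMA i:{- int N..<2 * int N}. SIGMA j:{- int N..<2 * int N}. column_jumps i j h)"

definition bad :: "int \<Rightarrow> (int \<times> int \<times> int) set" where
  "bad h = {(i, j, k) \<in> {0..<int N} \<times> {0..<int N} \<times> {0..<int N}.
     \<exists>v\<in>{f (i + h) j k, f i (j + h) k, f (i - h) j (k + h), f i (j - h) (k + h)}.
       v \<noteq> f i j k \<and> v \<noteq> f i j (k + h)}"

lemma column_steps:
  assumes "i \<in> {- int N..<2 * int N}" "j \<in> {- int N..<2 * int N}"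
  shows "bounded_steps (column i j) (- int N) (3 * int N) K"
proof
  fix w w' :: int assume w: "w \<le> w'"
  let ?c = "\<lambda>w. max (- int N) (min (3 * int N) w)"
  have "lattice_le (i, j, ?c w) (i, j, ?c w')" using w by (auto simp: lattice_le_def)
  then have "f i j (?c w) = f i j (?c w') \<or> R (f i j (?c w)) < R (f i j (?c w'))"
    using f_mono[of i j "?c w" i j "?c w'"] assms by auto
  then show "column i j w \<le> column i j w'" by (auto simp: column_def)
qed (auto simp: column_def R_bound)

lemma finite_column:
  assumes "i \<in> {- int N..<2 * int N}" "j \<in> {- int N..<2 * int N}" "0 \<le> h"
  shows "finite (column_jumps i j h)"
  using bounded_steps.double_steps_card(1)[OF column_steps[OF assms(1,2)] assms(3)]
  unfolding bounded_steps.double_steps_def[OF column_steps[OF assms(1,2)]] column_jumps_def .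

lemma finite_jumps: "0 \<le> h \<Longrightarrow> finite (jumps h)"
  unfolding jumps_def by (intro finite_SigmaI finite_column) auto

lemma sum_jumps: "(\<Sum>k<L. card (jumps (2 ^ k)) / 2 ^ Suc k) \<le> 9 * real N ^ 2 * real K"
proof -
  let ?I = "{- int N..<2 * int N}"
  have cj: "card (jumps h) = (\<Sum>i\<in>?I. \<Sum>j\<in>?I. card (column_jumps i j h))"
    if "0 \<le> h" for h
    unfolding jumps_def
    by (subst card_SigmaI, simp, intro ballI finite_SigmaI finite_column that, simp, assumption+,
        intro sum.cong refl card_SigmaI ballI finite_column that) auto
  have "(\<Sum>k<L. card (jumps (2 ^ k)) / 2 ^ Suc k) =
      (\<Sum>k<L. \<Sum>i\<in>?I. \<Sum>j\<in>?I. card (column_jumps i j (2 ^ k)) / 2 ^ Suc k)"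
    by (intro sum.cong refl) (simp add: cj sum_divide_distrib)
  also have "\<dots> = (\<Sum>i\<in>?I. \<Sum>k<L. \<Sum>j\<in>?I. card (column_jumps i j (2 ^ k)) / 2 ^ Suc k)"
    by (rule sum.swap)
  also have "\<dots> = (\<Sum>i\<in>?I. \<Sum>j\<in>?I. \<Sum>k<L. card (column_jumps i j (2 ^ k)) / 2 ^ Suc k)"
    by (intro sum.cong refl sum.swap)
  also have "\<dots> \<le> (\<Sum>i\<in>?I. \<Sum>j\<in>?I. real K)"
    using bounded_steps.sum_double_steps[OF column_steps]
    by (intro sum_mono) (simp add: bounded_steps.double_steps_def[OF column_steps] column_jumps_def)
  also have "\<dots> = 9 * real N ^ 2 * real K" by (simp add: power2_eq_square)
  finally show ?thesis .
qed

text \<open>A vertex with a third value forces two consecutive jumps in the column through it: one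
  step down the column the rank is at most that of the bottom of the cell, one step up at least that
  of its top, and the rank of the vertex lies strictly between. The four vertices account for the
  factor 4.\<close>

lemma card_bad:
  assumes h: "0 \<le> h" "h \<le> int N"
  shows "card (bad h) \<le> 4 * card (jumps h)"
proof -
  have step: "column i' j' (k' - h) < column i' j' k' \<and> column i' j' k' < column i' j' (k' + h)"
    if y: "i \<in> {0..<int N}" "j \<in> {0..<int N}" "k \<in> {0..<int N}"
      and w: "i' \<in> {- int N..2 * int N}" "j' \<in> {- int N..2 * int N}" "k' \<in> {k, k + h}"
      and ord: "lattice_le (i', j', k' - h) (i, j, k)" "lattice_le (i, j, k) (i', j', k')"
        "lattice_le (i', j', k') (i, j, k + h)" "lattice_le (i, j, k + h) (i', j', k' + h)"
      and ne: "f i' j' k' \<noteq> f i j k" "f i' j' k' \<noteq> f i j (k + h)"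
    for i j k i' j' k'
  proof -
    have r: "i \<in> {- int N..2 * int N}" "j \<in> {- int N..2 * int N}" "k \<in> {- int N..3 * int N}" "k + h \<in> {- int N..3 * int N}"
      "k' \<in> {- int N..3 * int N}" "k' - h \<in> {- int N..3 * int N}" "k' + h \<in> {- int N..3 * int N}" using y w h by auto
    have "R (f i' j' (k' - h)) \<le> R (f i j k)"
      using f_mono[OF w(1,2) r(6) r(1,2,3) ord(1)] by auto
    moreover have "R (f i j k) < R (f i' j' k')"
      using f_mono[OF r(1,2,3) w(1,2) r(5) ord(2)] ne by auto
    moreover have "R (f i' j' k') < R (f i j (k + h))"
      using f_mono[OF w(1,2) r(5) r(1,2,4) ord(3)] ne by auto
    moreover have "R (f i j (k + h)) \<le> R (f i' j' (k' + h))"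
      using f_mono[OF r(1,2,4) w(1,2) r(7) ord(4)] by auto
    ultimately show ?thesis using r by (simp add: column_def)
  qed
  let ?J = "jumps h"
  have sub: "bad h \<subseteq> ((\<lambda>(i, j, k). (i - h, j, k)) ` ?J \<union> (\<lambda>(i, j, k). (i, j - h, k)) ` ?J) \<union>
      ((\<lambda>(i, j, k). (i + h, j, k - h)) ` ?J \<union> (\<lambda>(i, j, k). (i, j + h, k - h)) ` ?J)" (is "_ \<subseteq> (?A \<union> ?B) \<union> (?C \<union> ?D)")
  proof
    fix y assume "y \<in> bad h"
    then obtain i j k v where y: "y = (i, j, k)" "i \<in> {0..<int N}" "j \<in> {0..<int N}" "k \<in> {0..<int N}"
      and v: "v \<in> {f (i + h) j k, f i (j + h) k, f (i - h) j (k + h), f i (j - h) (k + h)}"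
        "v \<noteq> f i j k" "v \<noteq> f i j (k + h)" by (auto simp: bad_def)
    from v(1) consider "v = f (i + h) j k" | "v = f i (j + h) k" | "v = f (i - h) j (k + h)" | "v = f i (j - h) (k + h)"
      by blast
    then show "y \<in> (?A \<union> ?B) \<union> (?C \<union> ?D)"
    proof cases
      case 1
      have "(i + h, j, k) \<in> ?J"
        using step[OF y(2-4), of "i + h" j k] y h v 1 by (auto simp: jumps_def column_jumps_def lattice_le_def)
      then have "y \<in> ?A" using y(1) by (intro image_eqI[of _ _ "(i + h, j, k)"]) auto
      then show ?thesis by blast
    next
      case 2
      have "(i, j + h, k) \<in> ?J"
        using step[OF y(2-4), of i "j + h" k] y h v 2 by (auto simp: jumps_def column_jumps_def lattice_le_def)
      then have "y \<in> ?B" using y(1) by (intro image_eqI[of _ _ "(i, j + h, k)"]) auto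
      then show ?thesis by blast
    next
      case 3
      have "(i - h, j, k + h) \<in> ?J"
        using step[OF y(2-4), of "i - h" j "k + h"] y h v 3 by (auto simp: jumps_def column_jumps_def lattice_le_def)
      then have "y \<in> ?C" using y(1) by (intro image_eqI[of _ _ "(i - h, j, k + h)"]) auto
      then show ?thesis by blast
    next
      case 4
      have "(i, j - h, k + h) \<in> ?J"
        using step[OF y(2-4), of i "j - h" "k + h"] y h v 4 by (auto simp: jumps_def column_jumps_def lattice_le_def)
      then have "y \<in> ?D" using y(1) by (intro image_eqI[of _ _ "(i, j - h, k + h)"]) auto
      then show ?thesis by blast
    qed
  qed
  have fJ: "finite ?J" by (rule finite_jumps[OF h(1)])
  have "card (bad h) \<le> card ((?A \<union> ?B) \<union> (?C \<union> ?D))" by (rule card_mono[OF _ sub]) (use fJ in auto)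
  also have "\<dots> \<le> (card ?A + card ?B) + (card ?C + card ?D)"
    by (intro order_trans[OF card_Un_le] add_mono card_Un_le)
  also have "\<dots> \<le> (card ?J + card ?J) + (card ?J + card ?J)"
    by (intro add_mono card_image_le fJ)
  finally show ?thesis by simp
qed

text \<open>Each term in the definition of \<open>flux\<close> is an increment along a ray \<open>r\<close> of a functional vanishing
  on \<open>r\<close>. For the identity map these vanish, whereas a single jump in a direction of the cone
  makes the flux at least twice the increment of \<open>\<alpha> + \<beta>\<close> along \<open>s\<close>, because the cone is not simplicial.\<close>

definition flux :: "'v \<Rightarrow> 'v \<Rightarrow> 'v \<Rightarrow> 'v \<Rightarrow> 'v \<Rightarrow> 'v \<Rightarrow> real" where
  "flux y0 y1 y2 y3 y4 ys =
     (\<alpha> y3 - \<alpha> y0) + (\<alpha> ys - \<alpha> y1) + (\<alpha> y4 - \<alpha> y0) + (\<alpha> ys - \<alpha> y2) +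
     (\<beta> y1 - \<beta> y0) + (\<beta> ys - \<beta> y3) + (\<beta> y2 - \<beta> y0) + (\<beta> ys - \<beta> y4) +
     (\<gamma> y1 - \<gamma> y0) + (\<gamma> ys - \<gamma> y3) + (\<gamma> y4 - \<gamma> y0) + (\<gamma> ys - \<gamma> y2) +
     (\<delta> y2 - \<delta> y0) + (\<delta> ys - \<delta> y4) + (\<delta> y3 - \<delta> y0) + (\<delta> ys - \<delta> y1)"

text \<open>Write A, B, C, D for the increments of the four functionals. Each of \<open>y1\<close>,
  \<open>y3\<close> contributes A + D or B + C, and each of \<open>y2\<close>, \<open>y4\<close>
  contributes A + C or B + D. Since A + B = C + D, every combination adds up to at least 2(A +
  B).\<close>

lemma flux_jump:
  assumes "y1 \<in> {y0, ys}" "y2 \<in> {y0, ys}" "y3 \<in> {y0, ys}" "y4 \<in> {y0, ys}"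
    and "\<alpha> y0 \<le> \<alpha> ys" "\<beta> y0 \<le> \<beta> ys" "\<gamma> y0 \<le> \<gamma> ys" "\<delta> y0 \<le> \<delta> ys"
    and "\<alpha> y0 + \<beta> y0 = \<gamma> y0 + \<delta> y0" "\<alpha> ys + \<beta> ys = \<gamma> ys + \<delta> ys"
  shows "2 * (\<alpha> ys + \<beta> ys - \<alpha> y0 - \<beta> y0) \<le> flux y0 y1 y2 y3 y4 ys"
  using assms unfolding flux_def by (elim insertE emptyE) auto

definition cell_flux :: "int \<Rightarrow> int \<Rightarrow> int \<Rightarrow> int \<Rightarrow> real" where
  "cell_flux h i j k = flux (f i j k) (f (i + h) j k) (f i (j + h) k) (f (i - h) j (k + h))
     (f i (j - h) (k + h)) (f i j (k + h))"

lemma cell_flux_lower: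
  assumes h: "0 \<le> h" "h \<le> int N" and y: "i \<in> {0..<int N}" "j \<in> {0..<int N}" "k \<in> {0..<int N}"
  shows "2 * (\<alpha> (f i j (k + h)) + \<beta> (f i j (k + h)) - \<alpha> (f i j k) - \<beta> (f i j k))
    - (if (i, j, k) \<in> bad h then 4 else 0) \<le> cell_flux h i j k"
proof -
  note r = y h
  have m1: "lattice_le (i, j, k) (i + h, j, k)" "lattice_le (i + h, j, k) (i, j, k + h)"
    and m2: "lattice_le (i, j, k) (i, j + h, k)" "lattice_le (i, j + h, k) (i, j, k + h)"
    and m3: "lattice_le (i, j, k) (i - h, j, k + h)" "lattice_le (i - h, j, k + h) (i, j, k + h)"
    and m4: "lattice_le (i, j, k) (i, j - h, k + h)" "lattice_le (i, j - h, k + h) (i, j, k + h)"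
    and ms: "lattice_le (i, j, k) (i, j, k + h)"
    using h by (auto simp: lattice_le_def)
  show ?thesis
  proof (cases "(i, j, k) \<in> bad h")
    \<comment> \<open>In a bad cell only monotonicity is left: the flux is nonnegative, and the
      increment of \<open>\<alpha> + \<beta>\<close> is at most 2, so the penalty 4
      suffices.\<close>
    case True
    have "0 \<le> cell_flux h i j k"
      using f_mono[OF _ _ _ _ _ _ m1(1)] f_mono[OF _ _ _ _ _ _ m1(2)]
        f_mono[OF _ _ _ _ _ _ m2(1)] f_mono[OF _ _ _ _ _ _ m2(2)]
        f_mono[OF _ _ _ _ _ _ m3(1)] f_mono[OF _ _ _ _ _ _ m3(2)]
        f_mono[OF _ _ _ _ _ _ m4(1)] f_mono[OF _ _ _ _ _ _ m4(2)] r
      by (simp add: cell_flux_def flux_def)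
    moreover have "\<alpha> (f i j (k + h)) \<le> 1" "\<beta> (f i j (k + h)) \<le> 1" "0 \<le> \<alpha> (f i j k)" "0 \<le> \<beta> (f i j k)"
      using range01[of i j "k + h"] range01[of i j k] r by auto
    ultimately show ?thesis using True by simp
  next
    case False
    then have "f (i + h) j k \<in> {f i j k, f i j (k + h)}" "f i (j + h) k \<in> {f i j k, f i j (k + h)}"
      "f (i - h) j (k + h) \<in> {f i j k, f i j (k + h)}" "f i (j - h) (k + h) \<in> {f i j k, f i j (k + h)}"
      using y by (auto simp: bad_def)
    moreover have "\<alpha> (f i j k) \<le> \<alpha> (f i j (k + h))" "\<beta> (f i j k) \<le> \<beta> (f i j (k + h))"
      "\<gamma> (f i j k) \<le> \<gamma> (f i j (k + h))" "\<delta> (f i j k) \<le> \<delta> (f i j (k + h))"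
      using f_mono[OF _ _ _ _ _ _ ms] r by auto
    moreover have "\<alpha> (f i j k) + \<beta> (f i j k) = \<gamma> (f i j k) + \<delta> (f i j k)"
      "\<alpha> (f i j (k + h)) + \<beta> (f i j (k + h)) = \<gamma> (f i j (k + h)) + \<delta> (f i j (k + h))"
      using modular[of i j k] modular[of i j "k + h"] r by auto
    ultimately have "2 * (\<alpha> (f i j (k + h)) + \<beta> (f i j (k + h)) - \<alpha> (f i j k) - \<beta> (f i j k)) \<le> cell_flux h i j k"
      unfolding cell_flux_def by (rule flux_jump)
    then show ?thesis using False by simp
  qed
qed

lemma eps_nonneg: "0 \<le> \<epsilon>"
  using near[of 0 0 0] by auto

text \<open>Sum the cell estimate over the cube. The affine part of \<open>f\<close> has no flux, so
  the total flux is a boundary term of order \<epsilon> h N^2, whereas the increments of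
  \<open>\<alpha> + \<beta>\<close> add up to order \<eta> h N^3. The bad cells have to make up for
  the difference.\<close>

lemma bad_lower:
  assumes h: "0 \<le> h" "h \<le> int N"
  shows "of_int h * real N ^ 2 * (\<eta> * real N - 18 * \<epsilon>) \<le> card (bad h)"
proof -
  \<comment> \<open>The estimate for translated boxes needs errors bounded everywhere; clipping
    ensures this and changes nothing in the range where \<open>near\<close> applies.\<close>
  define clip where "clip x = max (- \<epsilon>) (min \<epsilon> x)" for x :: real
  have clip: "\<bar>clip x\<bar> \<le> \<epsilon>" "\<bar>x\<bar> \<le> \<epsilon> \<Longrightarrow> clip x = x" for x using eps_nonneg by (auto simp: clip_def)
  define ga where "ga i j k = clip (\<alpha> (f i j k) - (a0 + \<eta> * of_int (i + j + k)))" for i j k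
  define gb where "gb i j k = clip (\<beta> (f i j k) - (b0 + \<eta> * of_int k))" for i j k
  define gc where "gc i j k = clip (\<gamma> (f i j k) - (c0 + \<eta> * of_int (j + k)))" for i j k
  define gd where "gd i j k = clip (\<delta> (f i j k) - (d0 + \<eta> * of_int (i + k)))" for i j k
  let ?I = "{0..<int N}"
  let ?H = "real_of_int h * real N ^ 2"
  let ?S = "box_sum (int N)"
  have val: "\<alpha> (f i j k) = a0 + \<eta> * of_int (i + j + k) + ga i j k"
     "\<beta> (f i j k) = b0 + \<eta> * of_int k + gb i j k"
     "\<gamma> (f i j k) = c0 + \<eta> * of_int (j + k) + gc i j k"
     "\<delta> (f i j k) = d0 + \<eta> * of_int (i + k) + gd i j k"
    if "i \<in> {- int N..2 * int N}" "j \<in> {- int N..2 * int N}" "k \<in> {- int N..3 * int N}" for i j k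
    using near[OF that] clip(2) by (simp_all add: ga_def gb_def gc_def gd_def)
  have flux_eq: "cell_flux h i j k =
     (ga (i - h) j (k + h) - ga i j k) + (ga i j (k + h) - ga (i + h) j k) +
     (ga i (j - h) (k + h) - ga i j k) + (ga i j (k + h) - ga i (j + h) k) +
     (gb (i + h) j k - gb i j k) + (gb i j (k + h) - gb (i - h) j (k + h)) +
     (gb i (j + h) k - gb i j k) + (gb i j (k + h) - gb i (j - h) (k + h)) +
     (gc (i + h) j k - gc i j k) + (gc i j (k + h) - gc (i - h) j (k + h)) +
     (gc i (j - h) (k + h) - gc i j k) + (gc i j (k + h) - gc i (j + h) k) +
     (gd i (j + h) k - gd i j k) + (gd i j (k + h) - gd i (j - h) (k + h)) +
     (gd (i - h) j (k + h) - gd i j k) + (gd i j (k + h) - gd (i + h) j k)"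
    if "i \<in> ?I" "j \<in> ?I" "k \<in> ?I" for i j k
    using that h val[of i j k] val[of "i + h" j k] val[of i "j + h" k] val[of "i - h" j "k + h"]
      val[of i "j - h" "k + h"] val[of i j "k + h"]
    by (simp add: cell_flux_def flux_def algebra_simps)
  have lin: "(\<alpha> (f i j (k + h)) + \<beta> (f i j (k + h)) - \<alpha> (f i j k) - \<beta> (f i j k)) =
      2 * \<eta> * of_int h + (ga i j (k + h) - ga i j k) + (gb i j (k + h) - gb i j k)"
    if "i \<in> ?I" "j \<in> ?I" "k \<in> ?I" for i j k
    using that h val[of i j k] val[of i j "k + h"] by (simp add: algebra_simps)
  have shift: "\<bar>?S g p q r - ?S g p' q' r'\<bar> \<le> 4 * \<epsilon> * ?H"
    if "g \<in> {ga, gb, gc, gd}" "\<bar>p - p'\<bar> + \<bar>q - q'\<bar> + \<bar>r - r'\<bar> \<le> 2 * h" for g p q r p' q' r'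
  proof -
    have "\<bar>g i j k\<bar> \<le> \<epsilon>" for i j k
      using that(1) clip(1) by (auto simp: ga_def gb_def gc_def gd_def)
    then have "\<bar>?S g p q r - ?S g p' q' r'\<bar> \<le>
        2 * \<epsilon> * of_int (\<bar>p - p'\<bar> + \<bar>q - q'\<bar> + \<bar>r - r'\<bar>) * of_int (int N) ^ 2"
      by (rule box_sum_shift) simp
    also have "\<dots> \<le> 2 * \<epsilon> * of_int (2 * h) * of_int (int N) ^ 2"
      using that(2) eps_nonneg by (intro mult_right_mono mult_left_mono) (auto simp del: of_int_add of_int_mult)
    finally show ?thesis by simp
  qed
  have tot: "(\<Sum>i\<in>?I. \<Sum>j\<in>?I. \<Sum>k\<in>?I. cell_flux h i j k) =
     (?S ga (-h) 0 h - ?S ga 0 0 0) + (?S ga 0 0 h - ?S ga h 0 0) +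
     (?S ga 0 (-h) h - ?S ga 0 0 0) + (?S ga 0 0 h - ?S ga 0 h 0) +
     (?S gb h 0 0 - ?S gb 0 0 0) + (?S gb 0 0 h - ?S gb (-h) 0 h) +
     (?S gb 0 h 0 - ?S gb 0 0 0) + (?S gb 0 0 h - ?S gb 0 (-h) h) +
     (?S gc h 0 0 - ?S gc 0 0 0) + (?S gc 0 0 h - ?S gc (-h) 0 h) +
     (?S gc 0 (-h) h - ?S gc 0 0 0) + (?S gc 0 0 h - ?S gc 0 h 0) +
     (?S gd 0 h 0 - ?S gd 0 0 0) + (?S gd 0 0 h - ?S gd 0 (-h) h) +
     (?S gd (-h) 0 h - ?S gd 0 0 0) + (?S gd 0 0 h - ?S gd h 0 0)"
    unfolding box_sum_def by (subst sum.cong[OF refl sum.cong[OF refl sum.cong[OF refl flux_eq]]])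
      (simp_all only: sum.distrib sum_subtractf add_0_right add_uminus_conv_diff)
  \<comment> \<open>Sixteen differences, each a translation by at most \<open>2 * h\<close> in
    total, at a cost of \<open>2 * \<epsilon> * N^2\<close> per unit.\<close>
  have upper: "(\<Sum>i\<in>?I. \<Sum>j\<in>?I. \<Sum>k\<in>?I. cell_flux h i j k) \<le> 16 * (4 * \<epsilon> * ?H)"
  proof -
    have "?S g p q r - ?S g p' q' r' \<le> 4 * \<epsilon> * ?H"
      if "g \<in> {ga, gb, gc, gd}" "\<bar>p - p'\<bar> + \<bar>q - q'\<bar> + \<bar>r - r'\<bar> \<le> 2 * h" for g p q r p' q' r'
      using shift[OF that] by linarith
    note s = this
    let ?E = "4 * \<epsilon> * ?H"
    show ?thesis unfolding tot
      by (rule order_trans[of _ "?E + ?E + ?E + ?E + ?E + ?E + ?E + ?E + ?E + ?E + ?E + ?E + ?E + ?E + ?E + ?E"],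
          (intro add_mono s; use h in simp)) simp
  qed
  have badsum: "(\<Sum>i\<in>?I. \<Sum>j\<in>?I. \<Sum>k\<in>?I. if (i, j, k) \<in> bad h then 4 else 0) = 4 * real (card (bad h))"
  proof -
    have sub: "bad h \<subseteq> ?I \<times> ?I \<times> ?I" by (auto simp: bad_def)
    have "(\<Sum>i\<in>?I. \<Sum>j\<in>?I. \<Sum>k\<in>?I. if (i, j, k) \<in> bad h then 4 else 0) =
        (\<Sum>y\<in>?I \<times> ?I \<times> ?I. if y \<in> bad h then 4 else (0::real))"
      by (simp add: sum.cartesian_product case_prod_beta)
    also have "\<dots> = (\<Sum>y\<in>bad h. 4)" using sub by (simp add: sum.If_cases Int_absorb1)
    finally show ?thesis by simp
  qed
  have "(\<Sum>i\<in>?I. \<Sum>j\<in>?I. \<Sum>k\<in>?I. 2 * (2 * \<eta> * of_int h + (ga i j (k + h) - ga i j k) + (gb i j (k + h) - gb i j k))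
      - (if (i, j, k) \<in> bad h then 4 else 0)) \<le> (\<Sum>i\<in>?I. \<Sum>j\<in>?I. \<Sum>k\<in>?I. cell_flux h i j k)"
    by (intro sum_mono) (use cell_flux_lower[OF h] lin in force)
  also have "(\<Sum>i\<in>?I. \<Sum>j\<in>?I. \<Sum>k\<in>?I. 2 * (2 * \<eta> * of_int h + (ga i j (k + h) - ga i j k) + (gb i j (k + h) - gb i j k))
      - (if (i, j, k) \<in> bad h then 4 else 0)) =
      (\<Sum>i\<in>?I. \<Sum>j\<in>?I. \<Sum>k\<in>?I. 4 * \<eta> * of_int h) + 2 * (?S ga 0 0 h - ?S ga 0 0 0) + 2 * (?S gb 0 0 h - ?S gb 0 0 0)
      - (\<Sum>i\<in>?I. \<Sum>j\<in>?I. \<Sum>k\<in>?I. if (i, j, k) \<in> bad h then 4 else 0)"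
    by (simp add: box_sum_def sum.distrib sum_subtractf algebra_simps flip: sum_distrib_left)
  also have "\<dots> = 4 * \<eta> * of_int h * real N ^ 3 + 2 * (?S ga 0 0 h - ?S ga 0 0 0) + 2 * (?S gb 0 0 h - ?S gb 0 0 0)
      - 4 * real (card (bad h))"
    unfolding badsum by (simp add: power3_eq_cube)
  finally have "4 * \<eta> * of_int h * real N ^ 3 + 2 * (?S ga 0 0 h - ?S ga 0 0 0) + 2 * (?S gb 0 0 h - ?S gb 0 0 0)
      - 4 * real (card (bad h)) \<le> 16 * (4 * \<epsilon> * ?H)" using upper by linarith
  moreover have "- (2 * \<epsilon> * ?H) \<le> ?S g 0 0 h - ?S g 0 0 0" if "g \<in> {ga, gb}" for g
  proof -
    have "\<bar>g i j k\<bar> \<le> \<epsilon>" for i j k using that clip(1) by (auto simp: ga_def gb_def)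
    then have "\<bar>?S g 0 0 h - ?S g 0 0 0\<bar> \<le> 2 * \<epsilon> * of_int (\<bar>0 - 0\<bar> + \<bar>0 - 0\<bar> + \<bar>h - 0\<bar>) * of_int (int N) ^ 2"
      by (rule box_sum_shift) simp
    then show ?thesis using h by simp
  qed
  from this[of ga] this[of gb] have "- (2 * \<epsilon> * ?H) \<le> ?S ga 0 0 h - ?S ga 0 0 0"
    "- (2 * \<epsilon> * ?H) \<le> ?S gb 0 0 h - ?S gb 0 0 0" by auto
  moreover have "16 * (4 * \<epsilon> * ?H) = 64 * (\<epsilon> * ?H)" "2 * \<epsilon> * ?H = 2 * (\<epsilon> * ?H)" by simp_all
  \<comment> \<open>The 72 consists of 64 from the flux and 8 from the two increments, each at least
    -2 and counted twice; dividing by 4 leaves 18.\<close>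
  ultimately have "4 * \<eta> * of_int h * real N ^ 3 - 72 * (\<epsilon> * ?H) \<le> 4 * real (card (bad h))" by argo
  then show ?thesis by (simp add: algebra_simps power3_eq_cube power2_eq_square)
qed

text \<open>The number of bad cells grows like the scale \<open>2 ^ k\<close>, so after weighting by
  its inverse all \<open>L\<close> scales contribute the same amount. Their total is bounded by the
  weighted count of double jumps, in which \<open>L\<close> does not occur.\<close>

lemma scales_bounded:
  assumes "2 ^ L \<le> N"
  shows "real L * (\<eta> * real N - 18 * \<epsilon>) \<le> 72 * real K"
proof -
  have N: "0 < N" using assms by (metis gr0I not_less zero_less_numeral zero_less_power)
  have "(\<Sum>k<L. real N ^ 2 * (\<eta> * real N - 18 * \<epsilon>) / 2) \<le> (\<Sum>k<L. 4 * (card (jumps (2 ^ k)) / 2 ^ Suc k))"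
  proof (rule sum_mono)
    fix k assume "k \<in> {..<L}"
    then have "(2::nat) ^ k \<le> 2 ^ L" by (intro power_increasing) auto
    then have k: "(2::int) ^ k \<le> int N" using assms by (metis of_nat_le_iff of_nat_numeral of_nat_power order_trans)
    have "2 ^ k * real N ^ 2 * (\<eta> * real N - 18 * \<epsilon>) \<le> card (bad (2 ^ k))"
      using bad_lower[OF _ k] by simp
    also have "\<dots> \<le> 4 * real (card (jumps (2 ^ k)))" using card_bad[OF _ k] by simp
    finally show "real N ^ 2 * (\<eta> * real N - 18 * \<epsilon>) / 2 \<le> 4 * (card (jumps (2 ^ k)) / 2 ^ Suc k)"
      by (simp add: field_simps)
  qed
  also have "\<dots> = 4 * (\<Sum>k<L. card (jumps (2 ^ k)) / 2 ^ Suc k)" by (rule sum_distrib_left[symmetric])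
  also have "\<dots> \<le> 4 * (9 * real N ^ 2 * real K)" by (intro mult_left_mono sum_jumps) simp
  finally have "real N ^ 2 * (real L * (\<eta> * real N - 18 * \<epsilon>)) \<le> real N ^ 2 * (72 * real K)"
    by (simp add: field_simps)
  then show ?thesis using N by (simp add: mult_le_cancel_left_pos)
qed

end


section \<open>Valuations that do not form an RB-domain\<close>

definition wedge :: "nat gorder" where
  "wedge = \<lparr>carrier = {0, 1, 2}, eq = (=), le = (\<lambda>x y. x = y \<or> y = 2)\<rparr>"

lemma wedge_carrier [simp]: "carrier wedge = {0, 1, 2}"
  by (simp add: wedge_def)

lemma finite_poset_wedge: "finite_poset wedge"
  unfolding finite_poset_def by (intro conjI partial_orderI) (auto simp: wedge_def)

interpretation wedge: fin_poset wedge
  by unfold_locales (rule finite_poset_wedge)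

lemma wedge_upper: "upper_set wedge U \<longleftrightarrow> U \<in> {{}, {2}, {0, 2}, {1, 2}, {0, 1, 2}}"
proof
  assume U: "upper_set wedge U"
  show "U \<in> {{}, {2}, {0, 2}, {1, 2}, {0, 1, 2}}"
  proof (cases "U = {}")
    case False
    then have "2 \<in> U" using U by (auto simp: upper_set_def wedge_def)
    moreover have "U \<subseteq> {0, 1, 2}" using U by (auto simp: upper_set_def)
    ultimately show ?thesis by blast
  qed simp
qed (auto simp: upper_set_def wedge_def)

lemma wedge_mass_le:
  "mass_le wedge v w \<longleftrightarrow> v 2 \<le> w 2 \<and> v 0 + v 1 + v 2 \<le> w 0 + w 1 + w 2 \<and>
     v 0 + v 2 \<le> w 0 + w 2 \<and> v 1 + v 2 \<le> w 1 + w 2"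
  unfolding mass_le_def wedge_upper by (auto simp: add.assoc)

text \<open>The coordinates belong to the rays of the cone: \<open>x\<close> and \<open>y\<close>
  move mass from 0 and from 1 up to 2, and \<open>z\<close> adds mass at 2. The remaining two rays
  add mass at 0 and at 1. The base point, with masses 1/4, is interior, which leaves room for the
  whole box.\<close>

definition simplex_point :: "real \<Rightarrow> real \<Rightarrow> real \<Rightarrow> nat \<Rightarrow> real" where
  "simplex_point x y z =
     (\<lambda>i\<in>{0, 1, 2}. if i = 0 then 1/4 - x else if i = 1 then 1/4 - y else 1/4 + x + y + z)"

lemma simplex_point_apply [simp]:
  "simplex_point x y z 0 = 1/4 - x" "simplex_point x y z (Suc 0) = 1/4 - y"
  "simplex_point x y z 2 = 1/4 + x + y + z"
  by (simp_all add: simplex_point_def)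

lemma simplex_point_carrier:
  assumes "x \<in> {-1/16..1/8}" "y \<in> {-1/16..1/8}" "z \<in> {-1/16..3/16}"
  shows "simplex_point x y z \<in> carrier (valuations wedge)"
  using assms unfolding valuations_carrier by (simp add: simplex_point_def)

section \<open>Uniform approximation of the identity on a box\<close>

lemma directed_maps_choose:
  assumes po: "partial_order D" and F: "directed (pointwise_le D) F"
    and car: "\<And>f x. \<lbrakk>f \<in> F; x \<in> T\<rbrakk> \<Longrightarrow> f x \<in> carrier D" and T: "finite T" "T \<subseteq> carrier D"
    and Q: "\<And>x. x \<in> T \<Longrightarrow> \<exists>f\<in>F. Q x (f x)"
    and up: "\<And>x u v. \<lbrakk>x \<in> T; Q x u; le D u v\<rbrakk> \<Longrightarrow> Q x v"
  shows "\<exists>f\<in>F. \<forall>x\<in>T. Q x (f x)"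
  using T(1) subset_refl[of T]
proof (induction rule: finite_subset_induct')
  case empty
  then show ?case using F by (auto simp: directed_def)
next
  case (insert x S)
  then obtain f where f: "f \<in> F" "\<forall>x\<in>S. Q x (f x)" by blast
  obtain g where g: "g \<in> F" "Q x (g x)" using Q insert by blast
  obtain h where h: "h \<in> F" "pointwise_le D f h" "pointwise_le D g h"
    using directedD[OF F f(1) g(1)] by blast
  have "Q y (h y)" if y: "y \<in> insert x S" for y
  proof -
    have yT: "y \<in> T" "y \<in> carrier D" using y insert T by auto
    then have "le D (f y) (h y)" "le D (g y) (h y)" using h by (auto simp: pointwise_le_def)
    then show ?thesis using up[OF yT(1)] y f(2) g(2) by blast
  qed
  then show ?case using h(1) by blast
qed

text \<open>An argument in the manner of Dini: directedness gives one map that is close to the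
  identity on a finite grid, and monotonicity extends this to any point of the box by rounding its
  coordinates down to the grid.\<close>

lemma wedge_deflation_near:
  assumes F: "directed (pointwise_le (valuations wedge)) F"
    and sc: "\<And>f. f \<in> F \<Longrightarrow> scott_continuous (valuations wedge) (valuations wedge) f"
    and sup: "pointwise_sup_id (valuations wedge) F"
  shows "\<exists>f\<in>F. \<forall>x\<in>{-1/16..1/8}. \<forall>y\<in>{-1/16..1/8}. \<forall>z\<in>{-1/16..3/16}. \<forall>U.
    upper_set wedge U \<longrightarrow> sum (simplex_point x y z) U - 1/576 \<le> sum (f (simplex_point x y z)) U"
proof -
  let ?V = "valuations wedge"
  \<comment> \<open>Rounding three coordinates down to multiples of 1/3456 costs at most 1/1152, as
    much as is allowed on the grid; together this is 1/576. The index bounds are 3456 times the ends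
    of the box.\<close>
  define T where "T = (\<lambda>(i, j, k). simplex_point (of_int i / 3456) (of_int j / 3456) (of_int k / 3456)) `
    ({-216..432} \<times> {-216..432} \<times> {-216..648})"
  have T: "finite T" "T \<subseteq> carrier ?V"
    unfolding T_def by (auto intro!: simplex_point_carrier)
  have car: "f v \<in> carrier ?V" if "f \<in> F" "v \<in> T" for f v
    using scott_carrier[OF sc[OF that(1)]] that(2) T(2) by blast
  have "\<exists>f\<in>F. \<forall>v\<in>T. \<forall>U. upper_set wedge U \<longrightarrow> sum v U - 1/1152 \<le> sum (f v) U"
  proof (rule directed_maps_choose[where D = ?V and T = T])
    fix v assume v: "v \<in> T"
    then have vV: "v \<in> carrier ?V" using T by blast
    have dir: "directed (mass_le wedge) ((\<lambda>f. f v) ` F)"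
      using F vV unfolding directed_def pointwise_le_def valuations_le by blast
    have lub: "is_lub ?V v ((\<lambda>f. f v) ` F)" using sup vV by (simp add: pointwise_sup_id_def)
    have "(\<lambda>f. f v) ` F \<subseteq> carrier ?V" using car v by blast
    then have "\<exists>u\<in>(\<lambda>f. f v) ` F. \<forall>U. upper_set wedge U \<longrightarrow> sum v U - 1/1152 < sum u U"
      by (rule wedge.valuations_lub_approx[OF _ dir lub]) simp
    then obtain f where "f \<in> F" "\<And>U. upper_set wedge U \<Longrightarrow> sum v U - 1/1152 < sum (f v) U" by blast
    then show "\<exists>f\<in>F. \<forall>U. upper_set wedge U \<longrightarrow> sum v U - 1/1152 \<le> sum (f v) U"
      by (blast intro: less_imp_le)
  next
    fix v u w :: "nat \<Rightarrow> real"
    assume "\<forall>U. upper_set wedge U \<longrightarrow> sum v U - 1/1152 \<le> sum u U" "le ?V u w"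
    then show "\<forall>U. upper_set wedge U \<longrightarrow> sum v U - 1/1152 \<le> sum w U"
      by (force simp: mass_le_def)
  qed (use wedge.valuations_po F car T in auto)
  then obtain f where f: "f \<in> F" "\<And>v U. \<lbrakk>v \<in> T; upper_set wedge U\<rbrakk> \<Longrightarrow> sum v U - 1/1152 \<le> sum (f v) U" by blast
  have "sum (simplex_point x y z) U - 1/576 \<le> sum (f (simplex_point x y z)) U"
    if xyz: "x \<in> {-1/16..1/8}" "y \<in> {-1/16..1/8}" "z \<in> {-1/16..3/16}" and U: "upper_set wedge U" for x y z U
  proof -
    define down where "down t = of_int \<lfloor>t * 3456\<rfloor> / (3456::real)" for t :: real
    have down: "down t \<le> t" "t - 1/3456 \<le> down t" for t
      unfolding down_def by linarith+
    let ?v = "simplex_point x y z" and ?w = "simplex_point (down x) (down y) (down z)"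
    have "?w \<in> T"
      unfolding T_def down_def using xyz
      by (intro image_eqI[of _ _ "(\<lfloor>x * 3456\<rfloor>, \<lfloor>y * 3456\<rfloor>, \<lfloor>z * 3456\<rfloor>)"]) (auto simp: le_floor_iff floor_le_iff)
    have wV: "?w \<in> carrier ?V" using \<open>?w \<in> T\<close> T by blast
    have "mass_le wedge ?w ?v"
      unfolding wedge_mass_le using down(1)[of x] down(1)[of y] down(1)[of z] by simp
    then have "mass_le wedge (f ?w) (f ?v)"
      using scott_mono[OF sc[OF f(1)] wV simplex_point_carrier[OF xyz]] by simp
    then have "sum (f ?w) U \<le> sum (f ?v) U" using U by (rule mass_leD)
    moreover have "sum ?w U - 1/1152 \<le> sum (f ?w) U" by (rule f(2)[OF \<open>?w \<in> T\<close> U])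
    moreover have "sum ?v U - 1/1152 \<le> sum ?w U"
      using U down(2)[of x] down(2)[of y] down(2)[of z] down(1)[of x] down(1)[of y] down(1)[of z]
      unfolding wedge_upper by auto
    ultimately show ?thesis by linarith
  qed
  then show ?thesis using f(1) by blast
qed

lemma wedge_not_rb: "\<not> rb_domain (valuations wedge)"
proof
  let ?V = "valuations wedge"
  assume "rb_domain ?V"
  then obtain F where F: "directed (pointwise_le ?V) F" "pointwise_sup_id ?V F"
    and sc: "\<And>f. f \<in> F \<Longrightarrow> scott_continuous ?V ?V f"
    and defl: "\<And>f. f \<in> F \<Longrightarrow> pointwise_le ?V f id" "\<And>f. f \<in> F \<Longrightarrow> finite (f ` carrier ?V)"
    unfolding rb_domain_def by blast
  obtain f where f: "f \<in> F"
    and near: "\<And>x y z U. \<lbrakk>x \<in> {-1/16..1/8}; y \<in> {-1/16..1/8}; z \<in> {-1/16..3/16}; upper_set wedge U\<rbrakk> \<Longrightarrow>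
      sum (simplex_point x y z) U - 1/576 \<le> sum (f (simplex_point x y z)) U"
    using wedge_deflation_near[OF F(1) sc F(2)] by blast
  define M where "M = f ` carrier ?V"
  define K where "K = card M"
  \<comment> \<open>With \<open>\<eta> * N = 1/16\<close> and error 1/576 the bound on the scales
    becomes \<open>L / 32 \<le> 72 * K\<close>, so any \<open>L\<close> above
    \<open>2304 * K\<close> refutes it.\<close>
  define L where "L = 2304 * K + 1"
  define N :: nat where "N = 2 ^ L"
  define \<eta> where "\<eta> = 1 / (16 * real N)"
  \<comment> \<open>The number of image points strictly below \<open>v\<close>: it increases
    strictly along the order of the image and never exceeds \<open>K\<close>.\<close>
  define R where "R v = card {m \<in> M. mass_le wedge m v \<and> m \<noteq> v}" for v
  define p where "p i j k = simplex_point (\<eta> * of_int i) (\<eta> * of_int j) (\<eta> * of_int k)" for i j k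
  have N: "0 < N" by (simp add: N_def)
  have \<eta>: "0 < \<eta>" "\<eta> * real N = 1/16" using N by (simp_all add: \<eta>_def)
  have finM: "finite M" unfolding M_def by (rule defl(2)[OF f])
  have scaled: "\<eta> * of_int t \<in> {-1/16..of_int c / 16}" if "t \<in> {- int N..c * int N}" for t c
  proof -
    have "real_of_int (- int N) \<le> of_int t" "real_of_int t \<le> of_int (c * int N)"
      unfolding of_int_le_iff using that by auto
    from this[THEN mult_left_mono, of \<eta>]
    have "- (\<eta> * real N) \<le> \<eta> * of_int t" "\<eta> * of_int t \<le> of_int c * (\<eta> * real N)"
      using \<eta>(1) by (simp_all add: mult.left_commute)
    then show ?thesis by (simp add: \<eta>(2))
  qed
  have coords: "\<eta> * of_int i \<in> {-1/16..1/8}" "\<eta> * of_int j \<in> {-1/16..1/8}" "\<eta> * of_int k \<in> {-1/16..3/16}"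
    if "i \<in> {- int N..2 * int N}" "j \<in> {- int N..2 * int N}" "k \<in> {- int N..3 * int N}" for i j k
    using scaled[OF that(1)] scaled[OF that(2)] scaled[OF that(3)] by auto
  have pV: "p i j k \<in> carrier ?V"
    if "i \<in> {- int N..2 * int N}" "j \<in> {- int N..2 * int N}" "k \<in> {- int N..3 * int N}" for i j k
    unfolding p_def by (rule simplex_point_carrier[OF coords[OF that]])
  have fM: "f v \<in> M" if "v \<in> carrier ?V" for v using that by (simp add: M_def)
  have MV: "M \<subseteq> carrier ?V" unfolding M_def using scott_carrier[OF sc[OF f]] by blast
  have R_strict: "R v < R w" if vw: "v \<in> M" "w \<in> M" "mass_le wedge v w" "v \<noteq> w" for v w
    unfolding R_def
  proof (rule psubset_card_mono)
    have "mass_le wedge m w \<and> m \<noteq> w" if m: "m \<in> M" "mass_le wedge m v" "m \<noteq> v" for m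
      using mass_le_trans[OF m(2) vw(3)] po_antisym[OF wedge.valuations_po, of m v] m vw MV by auto
    then have "{m \<in> M. mass_le wedge m v \<and> m \<noteq> v} \<subseteq> {m \<in> M. mass_le wedge m w \<and> m \<noteq> w}" by blast
    moreover have "v \<in> {m \<in> M. mass_le wedge m w \<and> m \<noteq> w}" using vw by simp
    ultimately show "{m \<in> M. mass_le wedge m v \<and> m \<noteq> v} \<subset> {m \<in> M. mass_le wedge m w \<and> m \<noteq> w}" by blast
  qed (use finM in simp)
  \<comment> \<open>The functionals are the masses of the four nonempty upper sets. Their linear
    relation is modularity for \<open>{0, 2}\<close> and \<open>{1, 2}\<close>, whose union is the
    carrier and whose intersection is \<open>{2}\<close>.\<close>
  interpret square_cone_steps N K "\<lambda>i j k. f (p i j k)" "\<lambda>v. v 2" "\<lambda>v. v 0 + v 1 + v 2"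
    "\<lambda>v. v 0 + v 2" "\<lambda>v. v 1 + v 2" R \<eta> "1/576" "1/4" "3/4" "1/2" "1/2"
  proof
    fix i j k assume ijk: "i \<in> {- int N..2 * int N}" "j \<in> {- int N..2 * int N}" "k \<in> {- int N..3 * int N}"
    note pc = pV[OF ijk]
    note fc = scott_carrier[OF sc[OF f] pc]
    show "f (p i j k) 2 + (f (p i j k) 0 + f (p i j k) 1 + f (p i j k) 2) =
        f (p i j k) 0 + f (p i j k) 2 + (f (p i j k) 1 + f (p i j k) 2)" by simp
    show "0 \<le> f (p i j k) 2 \<and> f (p i j k) 2 \<le> 1 \<and>
        0 \<le> f (p i j k) 0 + f (p i j k) 1 + f (p i j k) 2 \<and> f (p i j k) 0 + f (p i j k) 1 + f (p i j k) 2 \<le> 1"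
      using fc unfolding valuations_carrier by (simp add: add.assoc)
    have le: "mass_le wedge (f (p i j k)) (p i j k)"
      using defl(1)[OF f] pc by (simp add: pointwise_le_def)
    have ge: "sum (p i j k) U - 1/576 \<le> sum (f (p i j k)) U" if "upper_set wedge U" for U
      unfolding p_def by (rule near[OF coords[OF ijk] that])
    have "p i j k 2 - 1/576 \<le> f (p i j k) 2"
      "p i j k 0 + p i j k 1 + p i j k 2 - 1/576 \<le> f (p i j k) 0 + f (p i j k) 1 + f (p i j k) 2"
      "p i j k 0 + p i j k 2 - 1/576 \<le> f (p i j k) 0 + f (p i j k) 2"
      "p i j k 1 + p i j k 2 - 1/576 \<le> f (p i j k) 1 + f (p i j k) 2"
      using ge[of "{2}"] ge[of "{0, 1, 2}"] ge[of "{0, 2}"] ge[of "{1, 2}"]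
      by (simp_all add: wedge_upper add.assoc)
    then show "\<bar>f (p i j k) 2 - (1/4 + \<eta> * of_int (i + j + k))\<bar> \<le> 1/576 \<and>
        \<bar>f (p i j k) 0 + f (p i j k) 1 + f (p i j k) 2 - (3/4 + \<eta> * of_int k)\<bar> \<le> 1/576 \<and>
        \<bar>f (p i j k) 0 + f (p i j k) 2 - (1/2 + \<eta> * of_int (j + k))\<bar> \<le> 1/576 \<and>
        \<bar>f (p i j k) 1 + f (p i j k) 2 - (1/2 + \<eta> * of_int (i + k))\<bar> \<le> 1/576"
      using le unfolding wedge_mass_le by (auto simp: p_def abs_le_iff algebra_simps)
    fix i' j' k'
    assume ijk': "i' \<in> {- int N..2 * int N}" "j' \<in> {- int N..2 * int N}" "k' \<in> {- int N..3 * int N}"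
      and le: "lattice_le (i, j, k) (i', j', k')"
    have "real_of_int k \<le> of_int k'" "real_of_int (i + k) \<le> of_int (i' + k')" "real_of_int (j + k) \<le> of_int (j' + k')"
      "real_of_int (i + j + k) \<le> of_int (i' + j' + k')"
      using le unfolding lattice_le_def by (simp_all del: of_int_add)
    from this[THEN mult_left_mono, of \<eta>] have "mass_le wedge (p i j k) (p i' j' k')"
      using \<eta>(1) unfolding wedge_mass_le p_def by (simp add: algebra_simps)
    then have "mass_le wedge (f (p i j k)) (f (p i' j' k'))"
      using scott_mono[OF sc[OF f] pc pV[OF ijk']] by simp
    moreover from this have "f (p i j k) = f (p i' j' k') \<or> R (f (p i j k)) < R (f (p i' j' k'))"
      using R_strict[OF fM[OF pc] fM[OF pV[OF ijk']]] by blast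
    ultimately show "f (p i j k) 2 \<le> f (p i' j' k') 2 \<and>
        f (p i j k) 0 + f (p i j k) 1 + f (p i j k) 2 \<le> f (p i' j' k') 0 + f (p i' j' k') 1 + f (p i' j' k') 2 \<and>
        f (p i j k) 0 + f (p i j k) 2 \<le> f (p i' j' k') 0 + f (p i' j' k') 2 \<and>
        f (p i j k) 1 + f (p i j k) 2 \<le> f (p i' j' k') 1 + f (p i' j' k') 2 \<and>
        (f (p i j k) = f (p i' j' k') \<or> R (f (p i j k)) < R (f (p i' j' k')))"
      unfolding wedge_mass_le by blast
  next
    show "R v \<le> K" for v unfolding R_def K_def by (rule card_mono[OF finM]) auto
  qed
  have "real L * (\<eta> * real N - 18 * (1/576)) \<le> 72 * real K"
    by (rule scales_bounded) (simp add: N_def)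
  then show False unfolding \<eta>(2) by (simp add: L_def)
qed


section \<open>The inclusions\<close>

lemma omega_BC_subset: "omega_BC \<subseteq> omega_FVA"
  using omega_BC_fva_rb(1) by (auto simp: omega_FVA_def)

lemma omega_FVA_subset: "omega_FVA \<subseteq> omega_FS_bot"
  using fva_fs by (auto simp: omega_FVA_def omega_FS_bot_def)

theorem theorem6p6:
  shows "((omega_BC :: 'a gorder set) \<subseteq> omega_FVA \<and> (omega_FVA :: 'a gorder set) \<subseteq> omega_FS_bot) \<and>
    (omega_BC :: (nat \<Rightarrow> real) gorder set) \<subset> omega_FVA \<and>
    (omega_FVA :: (nat \<Rightarrow> real) gorder set) \<subset> omega_FS_bot \<and>
    \<not> (omega_FVA :: (nat \<Rightarrow> real) gorder set) \<subseteq> omega_RB_bot \<and>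
    \<not> (omega_RB_bot :: (nat \<Rightarrow> real) gorder set) \<subseteq> omega_FVA"
proof -
  have wedge: "valuations wedge \<in> omega_FVA" "valuations wedge \<notin> omega_RB_bot" "valuations wedge \<notin> omega_BC"
    using fva_valuations[OF finite_poset_wedge] wedge_not_rb omega_BC_fva_rb(2)
    by (auto simp: omega_FVA_def omega_RB_bot_def)
  have five: "five \<notin> omega_FVA" using five_not_fva by (simp add: omega_FVA_def)
  show ?thesis
    by (intro conjI psubsetI omega_BC_subset omega_FVA_subset) (use wedge five five_omega in auto)
qed

end
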